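(* Let $d\ge 2$ be an integer, let $A,B,C\in\mathbb{Q}[z]$ be non-zero polynomials, and let $f(z)\in\mathbb{Q}((z^{-1}))$, not a rational function, satisfy $$f(z)=\frac{A(z)f(z^d)+C(z)}{B(z)}.$$ Let $b\in\mathbb{Z}$, $|b|\ge2$, be inside the disc of convergence of $f$, with $A(b^{d^t})B(b^{d^t})\ne0$ for all $t\in\mathbb{N}$, and suppose that $f(b)$ is irrational. Without loss of generality (in the sense of the normalisation described in the context, which replaces $f$ by $f$ times a polynomial and does not change the irrationality exponent at $b$), we may assume that $A(z)$ contains no powers of $z$ (that is, $z\nmid A(z)$) and that there does not exist $n\in\mathbb{N}$ coprime to $d$ such that the $n$-th cyclotomic polynomial $\Phi_n(z)$ divides both $A(z)$ and $B(z)$. The following assumptions refer to $f,A,B,C$ after this normalisation. Let $K=\deg(f(z))$. (i) If $B(z)$ contains non-cyclotomic factors (that is, $B_m(z)$, the non-cyclotomic part of $B$, is non-constant), assume: (a) $B_m(z)$ is coprime to $A(z^{d^t})$ for all $t\ge0$; (b) every irreducible factor $B'(z)$ of $B_m(z)$ has a root $z_0\in\mathbb{C}$ with $|z_0|>1$; (c) $\deg(C(z))>dK+\deg(A(z))$; (d) for each such $B'$ and its root $z_0$ from (b), with $u\ge0$ an integer such that $B(z_0^{d^{t+1}})C(z_0^{d^t})\neq0$ for all $t\ge u$, one has $$\sum_{k=0}^{\infty}\ \prod_{t=u}^{k-1}\frac{C(z_0^{d^{t+1}})A(z_0^{d^t})}{C(z_0^{d^t})B(z_0^{d^{t+1}})}\neq0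 .$$ (ii) If $B(z)$ contains cyclotomic factors, assume that for every primitive gap sequence $([u_n,v_n])_{n\ge0}$ of $f$, the polynomial $A(z)p_{u_n}(z^d)+C(z)q_{u_n}(z^d)$ is, for all sufficiently large $n$, coprime to every cyclotomic factor of $B(z)$. Then the irrationality exponent $\mu(f(b))$ is rational (both for the normalised $f$ and for the original one, since the two exponents are equal).
   Context: $\mathbb{N}=\{0,1,2,\dots\}$. Products whose lower index exceeds their upper index equal $1$. For $\alpha\in\mathbb{R}$, the irrationality exponent $\mu(\alpha)$ is the supremum of the set of $\mu\in\mathbb{R}$ such that $|\alpha-p/q|<q^{-\mu}$ has infinitely many solutions in integers $p,q$ with $q\ge 1$. $\mathbb{Q}((z^{-1}))$ is the set of formal Laurent series $f(z)=\sum_{k=-n}^{\infty}c_kz^{-k}$ with $n\in\mathbb{Z}$, $c_k\in\mathbb{Q}$; $\deg f$ is the largest exponent of $z$ with non-zero coefficient. There is $\rho\in[0,\infty]$ such that $f(z)$ converges for complex $|z|>\rho$ and diverges for $|z|<\rho$; "inside the disc of convergence" means $|b|>\rho$. Normalisation: (1) For an integer $N\geq 0$, $g(z)=z^Nf(z)$ satisfies $g(z)=\frac{A(z)g(z^d)+C(z)z^{dN}}{B(z)z^{(d-1)N}}$; for $N$ large enough, all powers of $z$ in $A(z)$ cancel from numerator and denominator, giving an equation of the same form for $g$ whose "$A$" is not divisible by $z$. (2) If $\Phi_n(z)$, with $n$ coprime to $d$, divides both $A$ and $B$, then $g(z)=\Phi_n(z)f(z)$ satisfies $g(z)=\frac{A^*(z)g(z^d)+C(z)\prod_{r\mid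 d,\,r\ne1}\Phi_{rn}(z)}{B^*(z)\prod_{r\mid d,\,r\ne1}\Phi_{rn}(z)}$ with $A^*=A/\Phi_n$, $B^*=B/\Phi_n$; this is repeated until no such common factor remains. In both cases $g(b)$ is a non-zero rational multiple of $f(b)$, so $\mu(g(b))=\mu(f(b))$, and $f$ with its equation is replaced by $g$ with its equation. Convergents: $\lfloor f\rfloor$ denotes the polynomial part of $f$. Put $a_0=\lfloor f\rfloor$, $f_1=(f-a_0)^{-1}$, and for $n\ge1$ $a_n=\lfloor f_n\rfloor$, $f_{n+1}=(f_n-a_n)^{-1}$. Put $P_0=a_0$, $Q_0=1$, $P_1=a_1a_0+1$, $Q_1=a_1$, $P_n=a_nP_{n-1}+P_{n-2}$, $Q_n=a_nQ_{n-1}+Q_{n-2}$ for $n\ge2$. The rational functions $P_n/Q_n$ are the convergents of $f$; $P_n,Q_n$ are coprime polynomials and $\deg Q_n$ is strictly increasing. Let $\Phi=\{\deg Q_n: n\ge 0\}$. For $u\in\Phi$, $p_u(z)/q_u(z)$ denotes the convergent with $\deg q_u=u$. Gaps: a gap in $\Phi$ of size $v-u$ is a pair $[u,v]$ of consecutive elements $u<v$ of $\Phi$. With $r_a=\deg A$, $r_b=\deg B$, the gap is big if $v-u>\frac{r_a+r_b}{d-1}$. The gap $[u',v']$ is the direct successor of $[u,v]$ if $\frac{p_{u'}(z)}{q_{u'}(z)}=\frac{A(z)p_u(z^d)+C(z)q_u(z^d)}{B(z)q_u(z^d)}$. Every big gap has a direct successor, which is again big. A gap is primitive if it is big and is not the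 direct successor of any other big gap. The primitive gap sequence from a primitive gap $[u_0,v_0]$ is the sequence $([u_n,v_n])_{n\ge0}$ in which $[u_{n+1},v_{n+1}]$ is the direct successor of $[u_n,v_n]$ for all $n$. Cyclotomic polynomials are the monic irreducible (over $\mathbb{Q}$) factors of the polynomials $z^k-1$, $k\ge1$; $\Phi_n(z)$ is the one whose roots are the primitive $n$-th roots of unity. Factor $B(z)=B_0(z)B_m(z)B_c(z)$ with $B_0$ a power of $z$, $B_c$ a product of cyclotomic polynomials (with multiplicity), and $B_m$ having no factor $z$ and no cyclotomic factor; $B_m$ is the non-cyclotomic part of $B$. *)

theory Defs
  imports
    "HOL-Complex_Analysis.Complex_Analysis"
    "HOL-Computational_Algebra.Computational_Algebra"
    "HOL-Library.Multiset"
begin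

subsection \<open>Irrationality exponent\<close>

definition irrationality_exponent :: "real \<Rightarrow> ereal" where
  "irrationality_exponent \<alpha> =
     (SUP \<mu> \<in> {\<mu> :: real. infinite {(p :: int, q :: int).
                  q \<ge> 1 \<and> \<bar>\<alpha> - of_int p / of_int q\<bar> < of_int q powr (- \<mu>)}}. ereal \<mu>)"


subsection \<open>Laurent series in the inverse variable\<close>

text \<open>
  A series \<open>f(z) = \<Sum> c\<^sub>k z\<^sup>-\<^sup>k\<close> with rational coefficients is represented by the formal Laurent
  series in the variable \<open>X = 1/z\<close>: the coefficient \<open>c\<^sub>k\<close> of \<open>z\<^sup>-\<^sup>k\<close> is \<^term>\<open>fls_nth f k\<close>, the variable
  \<open>z\<close> is \<^term>\<open>fls_X_inv\<close>, and \<open>f(z\<^sup>d)\<close> is \<^term>\<open>fls_compose_power f d\<close>.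
\<close>

definition poly_to_fls :: "rat poly \<Rightarrow> rat fls" where
  "poly_to_fls p = poly (map_poly fls_const p) fls_X_inv"

definition laurent_degree :: "rat fls \<Rightarrow> int" where
  "laurent_degree f = - fls_subdegree f"

definition is_rational_function :: "rat fls \<Rightarrow> bool" where
  "is_rational_function f \<longleftrightarrow> (\<exists>p q. q \<noteq> 0 \<and> f = poly_to_fls p / poly_to_fls q)"

lift_definition fls_of_rat :: "rat fls \<Rightarrow> complex fls" is "\<lambda>f n. of_rat (f n)"
  by (auto elim!: MOST_mono)

text \<open>
  In terms of \<open>X = 1/z\<close>, the series converges for \<open>|z| > \<rho>\<close> where \<open>\<rho> = 1/R\<close> and \<open>R\<close> is the radius
  of convergence in \<open>X\<close>.
\<close>

definition inside_disc_of_convergence :: "rat fls \<Rightarrow> int \<Rightarrow> bool" where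
  "inside_disc_of_convergence f b \<longleftrightarrow>
     b \<noteq> 0 \<and> ereal (1 / \<bar>of_int b\<bar>) < fls_conv_radius (fls_of_rat f)"

text \<open>The series has rational coefficients, so its value at an integer is real.\<close>

definition value_at :: "rat fls \<Rightarrow> int \<Rightarrow> real" where
  "value_at f b = Re (eval_fls (fls_of_rat f) (1 / of_int b))"

abbreviation poly_cx :: "rat poly \<Rightarrow> complex \<Rightarrow> complex" where
  "poly_cx p x \<equiv> poly (map_poly of_rat p) x"

abbreviation poly_compose_power :: "rat poly \<Rightarrow> nat \<Rightarrow> rat poly" where
  "poly_compose_power p n \<equiv> pcompose p (monom 1 n)"


subsection \<open>Cyclotomic polynomials\<close>

definition is_cyclotomic :: "rat poly \<Rightarrow> bool" where
  "is_cyclotomic P \<longleftrightarrow> lead_coeff P = 1 \<and> irreducible P \<and> (\<exists>k\<ge>1. P dvd monom 1 k - 1)"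

definition primitive_root_of_unity :: "nat \<Rightarrow> complex \<Rightarrow> bool" where
  "primitive_root_of_unity n x \<longleftrightarrow> n \<ge> 1 \<and> x ^ n = 1 \<and> (\<forall>k. 0 < k \<and> k < n \<longrightarrow> x ^ k \<noteq> 1)"

definition cyclotomic_poly :: "nat \<Rightarrow> rat poly" where
  "cyclotomic_poly n =
     (THE P. is_cyclotomic P \<and> {x. poly_cx P x = 0} = {x. primitive_root_of_unity n x})"

text \<open>
  The decomposition \<open>B = B\<^sub>0 B\<^sub>m B\<^sub>c\<close> into a power of \<open>z\<close>, the non-cyclotomic part \<open>B\<^sub>m\<close> and a
  product \<open>B\<^sub>c\<close> of cyclotomic polynomials. For \<open>B \<noteq> 0\<close> it determines \<open>B\<^sub>m\<close> uniquely.
\<close>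

definition is_noncyclotomic_part :: "rat poly \<Rightarrow> rat poly \<Rightarrow> bool" where
  "is_noncyclotomic_part B Bm \<longleftrightarrow>
     (\<exists>k M. (\<forall>P \<in># M. is_cyclotomic P) \<and> B = monom 1 k * Bm * prod_mset M) \<and>
     \<not> monom 1 1 dvd Bm \<and> (\<forall>P. is_cyclotomic P \<longrightarrow> \<not> P dvd Bm)"


subsection \<open>Mahler equations and their normalisation\<close>

definition mahler_equation :: "nat \<Rightarrow> rat fls \<Rightarrow> rat poly \<Rightarrow> rat poly \<Rightarrow> rat poly \<Rightarrow> bool" where
  "mahler_equation d f A B C \<longleftrightarrow>
     f = (poly_to_fls A * fls_compose_power f d + poly_to_fls C) / poly_to_fls B"

type_synonym mahler_data = "rat fls \<times> rat poly \<times> rat poly \<times> rat poly"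

text \<open>
  Passing from \<open>f\<close> to \<open>g = z\<^sup>N f\<close>, where
  \<open>g(z) = (A(z) g(z\<^sup>d) + C(z) z\<^sup>d\<^sup>N) / (B(z) z\<^sup>(\<^sup>d\<^sup>-\<^sup>1\<^sup>)\<^sup>N)\<close>, and cancelling all powers \<open>z\<^sup>m\<close> of \<open>z\<close> in
  \<open>A\<close> from numerator and denominator.
\<close>

inductive remove_powers :: "nat \<Rightarrow> mahler_data \<Rightarrow> mahler_data \<Rightarrow> bool" for d :: nat where
  "A = monom 1 m * A' \<Longrightarrow> \<not> monom 1 1 dvd A' \<Longrightarrow>
   B * monom 1 ((d - 1) * N) = monom 1 m * B' \<Longrightarrow>
   C * monom 1 (d * N) = monom 1 m * C' \<Longrightarrow>
   remove_powers d (f, A, B, C) (poly_to_fls (monom 1 N) * f, A', B', C')"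

text \<open>
  Passing from \<open>f\<close> to \<open>\<Phi>\<^sub>n f\<close> for a common factor \<open>\<Phi>\<^sub>n\<close> of \<open>A\<close> and \<open>B\<close>; this uses
  \<open>\<Phi>\<^sub>n(z\<^sup>d) = \<Prod>\<^bsub>r|d\<^esub> \<Phi>\<^bsub>rn\<^esub>(z)\<close> for \<open>n\<close> coprime to \<open>d\<close>. Since \<open>d \<ge> 2\<close>, coprimality excludes \<open>n = 0\<close>.
\<close>

inductive remove_cyclotomic :: "nat \<Rightarrow> mahler_data \<Rightarrow> mahler_data \<Rightarrow> bool" for d :: nat where
  "coprime n d \<Longrightarrow> A = cyclotomic_poly n * A' \<Longrightarrow> B = cyclotomic_poly n * B' \<Longrightarrow>
   R = (\<Prod>r \<in> {r. r dvd d \<and> r \<noteq> 1}. cyclotomic_poly (r * n)) \<Longrightarrow>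
   remove_cyclotomic d (f, A, B, C) (poly_to_fls (cyclotomic_poly n) * f, A', B' * R, C * R)"

definition is_normalised :: "nat \<Rightarrow> rat poly \<Rightarrow> rat poly \<Rightarrow> bool" where
  "is_normalised d A B \<longleftrightarrow> \<not> monom 1 1 dvd A \<and>
     \<not> (\<exists>n. coprime n d \<and> cyclotomic_poly n dvd A \<and> cyclotomic_poly n dvd B)"

definition normalises_to :: "nat \<Rightarrow> mahler_data \<Rightarrow> mahler_data \<Rightarrow> bool" where
  "normalises_to d D E \<longleftrightarrow>
     (\<exists>D'. remove_powers d D D' \<and> (remove_cyclotomic d)\<^sup>*\<^sup>* D' E) \<and>
     (case E of (g, A, B, C) \<Rightarrow> is_normalised d A B)"


subsection \<open>Continued fraction and convergents\<close>

text \<open>\<^const>\<open>fls_prpart\<close> omits the constant term.\<close>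

definition fls_floor :: "rat fls \<Rightarrow> rat poly" where
  "fls_floor f = fls_prpart f + [:fls_nth f 0:]"

primrec cf_complete_quotient :: "rat fls \<Rightarrow> nat \<Rightarrow> rat fls" where
  "cf_complete_quotient f 0 = f"
| "cf_complete_quotient f (Suc n) =
     inverse (cf_complete_quotient f n - poly_to_fls (fls_floor (cf_complete_quotient f n)))"

definition cf_quotient :: "rat fls \<Rightarrow> nat \<Rightarrow> rat poly" where
  "cf_quotient f n = fls_floor (cf_complete_quotient f n)"

fun cf_num :: "rat fls \<Rightarrow> nat \<Rightarrow> rat poly" where
  "cf_num f 0 = cf_quotient f 0"
| "cf_num f (Suc 0) = cf_quotient f 1 * cf_quotient f 0 + 1"
| "cf_num f (Suc (Suc n)) = cf_quotient f (Suc (Suc n)) * cf_num f (Suc n) + cf_num f n"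

fun cf_den :: "rat fls \<Rightarrow> nat \<Rightarrow> rat poly" where
  "cf_den f 0 = 1"
| "cf_den f (Suc 0) = cf_quotient f 1"
| "cf_den f (Suc (Suc n)) = cf_quotient f (Suc (Suc n)) * cf_den f (Suc n) + cf_den f n"

definition cf_degrees :: "rat fls \<Rightarrow> nat set" where
  "cf_degrees f = range (\<lambda>n. degree (cf_den f n))"

text \<open>
  The numerator \<open>p\<^sub>u\<close> and denominator \<open>q\<^sub>u\<close> of the convergent with \<open>deg q\<^sub>u = u\<close>, for
  \<open>u \<in> cf_degrees f\<close>.
\<close>

definition conv_num :: "rat fls \<Rightarrow> nat \<Rightarrow> rat poly" where
  "conv_num f u = cf_num f (THE n. degree (cf_den f n) = u)"

definition conv_den :: "rat fls \<Rightarrow> nat \<Rightarrow> rat poly" where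
  "conv_den f u = cf_den f (THE n. degree (cf_den f n) = u)"


subsection \<open>Gaps\<close>

definition is_gap :: "rat fls \<Rightarrow> nat \<times> nat \<Rightarrow> bool" where
  "is_gap f = (\<lambda>(u, v). u \<in> cf_degrees f \<and> v \<in> cf_degrees f \<and> u < v \<and>
                 (\<forall>w \<in> cf_degrees f. \<not> (u < w \<and> w < v)))"

definition is_big_gap :: "nat \<Rightarrow> mahler_data \<Rightarrow> nat \<times> nat \<Rightarrow> bool" where
  "is_big_gap d = (\<lambda>(f, A, B, C) (u, v). is_gap f (u, v) \<and>
     real (v - u) > real (degree A + degree B) / real (d - 1))"

definition next_num :: "nat \<Rightarrow> mahler_data \<Rightarrow> nat \<Rightarrow> rat poly" where
  "next_num d = (\<lambda>(f, A, B, C) u.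
     A * poly_compose_power (conv_num f u) d + C * poly_compose_power (conv_den f u) d)"

definition direct_successor :: "nat \<Rightarrow> mahler_data \<Rightarrow> nat \<times> nat \<Rightarrow> nat \<times> nat \<Rightarrow> bool" where
  "direct_successor d = (\<lambda>(f, A, B, C) (u, v) (u', v').
     is_gap f (u, v) \<and> is_gap f (u', v') \<and>
     Fract (conv_num f u') (conv_den f u') =
       Fract (next_num d (f, A, B, C) u) (B * poly_compose_power (conv_den f u) d))"

definition is_primitive_gap :: "nat \<Rightarrow> mahler_data \<Rightarrow> nat \<times> nat \<Rightarrow> bool" where
  "is_primitive_gap d D g \<longleftrightarrow> is_big_gap d D g \<and>
     \<not> (\<exists>h. h \<noteq> g \<and> is_big_gap d D h \<and> direct_successor d D h g)"

definition is_primitive_gap_sequence :: "nat \<Rightarrow> mahler_data \<Rightarrow> (nat \<Rightarrow> nat \<times> nat) \<Rightarrow> bool" where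
  "is_primitive_gap_sequence d D g \<longleftrightarrow>
     is_primitive_gap d D (g 0) \<and> (\<forall>n. direct_successor d D (g n) (g (Suc n)))"

end

theory Submission
  imports Defs "HOL-Computational_Algebra.Field_as_Ring"
begin

text \<open>
  Let \<open>u\<^sub>0 < u\<^sub>1 < \<dots>\<close> be the degrees of the denominators of the convergents of the normalised series
  \<open>g\<close>. Iterating the functional equation on a convergent and evaluating at \<open>b\<close> gives rational
  approximations to \<open>g(b)\<close> whose logarithmic sizes are known up to a factor that tends to \<open>1\<close> as the
  convergent varies, and whose integer common factors are bounded by the determinant of the iteration.
  Hence \<open>\<mu>(g(b)) = 1 + limsup u\<^bsub>k+1\<^esub> / u\<^sub>k\<close>.

  Every large gap lies in a primitive gap sequence and the primitive gaps have bounded size, so the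
  limit superior is \<open>1\<close> or a maximum of finitely many limits \<open>lim v\<^sub>n / u\<^sub>n\<close> along primitive gap
  sequences. Such a limit is rational as soon as the degree of the polynomial cancelled in the step
  from \<open>n\<close> to \<open>n + 1\<close> is eventually constant. This is checked root by root: the order of a denominator at
  \<open>x\<close> is determined by the order of the previous denominator at \<open>x\<^sup>d\<close>, and the hypotheses exclude a
  cancellation with the factor \<open>B\<close>. For a non-cyclotomic factor of \<open>B\<close> with a root \<open>z\<^sub>0\<close> outside the unit
  disc, the numerator \<open>A(z\<^sub>0) p\<^sub>n(z\<^sub>0\<^sup>d) + C(z\<^sub>0) q\<^sub>n(z\<^sub>0\<^sup>d)\<close> does not vanish for large \<open>n\<close> whether or
  not its limit does, since the convergents approach their limit on the orbit of \<open>z\<^sub>0\<close> without reaching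
  it.
\<close>

section \<open>Rational polynomials and their complex roots\<close>

text \<open>Two limits are taken in turn. For a fixed convergent \<open>k\<close> the logarithms
  after \<open>t\<close> steps are \<open>d ^ t\<close> times a degree plus a bounded amount. This
  bound \<open>M\<close> does not depend on \<open>k\<close>, so it becomes negligible as
  \<open>k\<close> grows; but how large \<open>t\<close> must be does depend on \<open>k\<close>.
  The upper bound for the exponent may therefore use only finitely many \<open>k\<close>: a block of
  degrees whose end exceeds \<open>d\<close> times its beginning, where the next \<open>t\<close>
  takes over.

  Rationality rests on a linear law: with cancelled factor \<open>G\<close>, a step sends
  \<open>u\<close> to \<open>d * u + deg B - deg G\<close> and the following degree \<open>v\<close>
  to \<open>d * v + deg G - deg A\<close>. Once \<open>deg G\<close> is constant, both are geometric
  after a shift. \<open>G\<close> always divides \<open>A * B\<close>, so finitely many points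
  decide its degree. The obstacle there is that a recurrence leads from \<open>x\<close> to another
  point \<open>x ^ d\<close>. The orbit is followed until it closes up to conjugacy (roots of unity)
  or has left all relevant zeros (other points), and the result is pulled back to
  \<open>x\<close>.\<close>

lemma map_poly_of_rat_add:
  "(map_poly of_rat (p + q) :: 'a :: field_char_0 poly) = map_poly of_rat p + map_poly of_rat q"
  by (intro poly_eqI) (simp add: coeff_map_poly of_rat_add)

lemma map_poly_of_rat_mult:
  "(map_poly of_rat (p * q) :: 'a :: field_char_0 poly) = map_poly of_rat p * map_poly of_rat q"
  by (intro poly_eqI) (simp add: coeff_map_poly coeff_mult of_rat_sum of_rat_mult)

lemma map_poly_of_rat_pcompose:
  "(map_poly of_rat (pcompose p q) :: 'a :: field_char_0 poly) =
     pcompose (map_poly of_rat p) (map_poly of_rat q)"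
  by (induction p)
    (simp_all add: pcompose_pCons map_poly_pCons map_poly_of_rat_add map_poly_of_rat_mult)

lemma map_poly_of_rat_eq_0_iff [simp]:
  "(map_poly of_rat p :: 'a :: field_char_0 poly) = 0 \<longleftrightarrow> p = 0"
  by (rule map_poly_eq_0_iff) auto

lemma degree_map_poly_of_rat [simp]:
  "degree (map_poly of_rat p :: 'a :: field_char_0 poly) = degree p"
  by (rule degree_map_poly) auto

lemma poly_of_rat_of_rat:
  "poly (map_poly of_rat p :: 'a :: field_char_0 poly) (of_rat x) = of_rat (poly p x)"
  by (induction p) (simp_all add: map_poly_pCons of_rat_add of_rat_mult)

lemma map_poly_of_rat_monom [simp]:
  "(map_poly of_rat (monom c n) :: 'a :: field_char_0 poly) = monom (of_rat c) n"
  by (simp add: map_poly_monom)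

lemma poly_cx_mult: "poly_cx (p * q) x = poly_cx p x * poly_cx q x"
  by (simp add: map_poly_of_rat_mult)

lemma poly_cx_add: "poly_cx (p + q) x = poly_cx p x + poly_cx q x"
  by (simp add: map_poly_of_rat_add)

lemma poly_cx_compose_power [simp]: "poly_cx (poly_compose_power p d) x = poly_cx p (x ^ d)"
  by (simp add: map_poly_of_rat_pcompose poly_pcompose poly_monom)

lemma poly_cx_dvd: "p dvd q \<Longrightarrow> poly_cx p x = 0 \<Longrightarrow> poly_cx q x = 0"
  by (auto simp: poly_cx_mult elim!: dvdE)

lemma degree_compose_power [simp]:
  "degree (poly_compose_power p d) = degree p * d"
  by (simp add: degree_pcompose degree_monom_eq)

lemma compose_power_eq_0_iff [simp]:
  "d > 0 \<Longrightarrow> poly_compose_power p d = 0 \<longleftrightarrow> p = 0"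
  by (subst pcompose_eq_0_iff) (auto simp: degree_monom_eq)

lemma coprime_bezout_poly:
  fixes p q :: "'a :: field_gcd poly"
  assumes "coprime p q"
  obtains s t where "s * p + t * q = 1"
  using assms bezout_coefficients_fst_snd[of p q] by (metis coprime_iff_gcd_eq_1)

lemma coprime_no_common_root:
  assumes "coprime p q" "poly_cx p x = 0"
  shows "poly_cx q x \<noteq> 0"
proof
  assume q: "poly_cx q x = 0"
  obtain s t where "s * p + t * q = 1"
    using coprime_bezout_poly[OF assms(1)] .
  hence "poly_cx (s * p + t * q) x = 1" by simp
  thus False using q assms(2) by (simp add: poly_cx_add poly_cx_mult)
qed

text \<open>The bridge between divisibility over the rationals and vanishing at one complex number:
  an irreducible polynomial that does not divide \<open>q\<close> is coprime to it, and coprime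
  polynomials share no root. It allows a root to be exchanged for a conjugate.\<close>

lemma irreducible_dvd_iff_root:
  assumes "irreducible P" "poly_cx P x = 0"
  shows "P dvd q \<longleftrightarrow> poly_cx q x = 0"
proof
  assume q: "poly_cx q x = 0"
  show "P dvd q"
  proof (rule ccontr)
    assume "\<not> P dvd q"
    hence "coprime P q"
      using assms(1) by (simp add: irreducible_imp_prime_elem prime_elem_imp_coprime)
    from coprime_no_common_root[OF this assms(2)] q show False by simp
  qed
qed (use assms poly_cx_dvd in blast)

text \<open>A nonzero polynomial of least degree among those vanishing at \<open>x\<close> is
  irreducible: one factor of a product already vanishes at \<open>x\<close> and so cannot have
  smaller degree.\<close>

lemma minimal_polynomial:
  assumes "q \<noteq> 0" "poly_cx q x = 0"
  obtains P where "irreducible P" "poly_cx P x = 0" "P dvd q" "lead_coeff P = 1"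
proof -
  define n where "n = (LEAST n. \<exists>P. P \<noteq> 0 \<and> poly_cx P x = 0 \<and> degree P = n)"
  have "\<exists>P. P \<noteq> 0 \<and> poly_cx P x = 0 \<and> degree P = n"
    unfolding n_def by (rule LeastI[of _ "degree q"]) (use assms in blast)
  then obtain P where P: "P \<noteq> 0" "poly_cx P x = 0" "degree P = n" by blast
  have min: "n \<le> degree Q" if "Q \<noteq> 0" "poly_cx Q x = 0" for Q
    unfolding n_def by (rule Least_le) (use that in blast)
  have irr: "irreducible P"
  proof (rule irreducibleI)
    show "\<not> is_unit P"
    proof
      assume "P dvd 1"
      from poly_cx_dvd[OF this P(2)] show False by simp
    qed
  next
    fix a b assume ab: "P = a * b"
    hence "poly_cx a x = 0 \<or> poly_cx b x = 0" using P(2) by (simp add: poly_cx_mult)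
    moreover have "a \<noteq> 0" "b \<noteq> 0" using ab P(1) by auto
    moreover have "degree a + degree b = n" using ab P(3) calculation by (simp add: degree_mult_eq)
    ultimately have "degree a = 0 \<or> degree b = 0" using min[of a] min[of b] by linarith
    thus "is_unit a \<or> is_unit b"
      using \<open>a \<noteq> 0\<close> \<open>b \<noteq> 0\<close> by (simp add: is_unit_iff_degree)
  qed (use P in auto)
  define R where "R = smult (inverse (lead_coeff P)) P"
  have lc: "inverse (lead_coeff P) \<noteq> 0" using P(1) by simp
  have u: "is_unit [:inverse (lead_coeff P):]" using lc by (simp add: is_unit_iff_degree)
  have R: "R = [:inverse (lead_coeff P):] * P" by (simp add: R_def)
  have "irreducible R" unfolding R using irr irreducible_mult_unit_left[OF u] by blast
  moreover have "poly_cx R x = 0" unfolding R poly_cx_mult P(2) by simp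
  moreover from calculation have "R dvd q" using assms irreducible_dvd_iff_root by blast
  moreover have "lead_coeff R = 1" using P(1) by (simp add: R_def)
  ultimately show ?thesis using that by blast
qed

lemma pcompose_power_left: "pcompose (p ^ n) q = pcompose (p :: 'a :: comm_ring_1 poly) q ^ n"
  by (induction n) (simp_all add: pcompose_1 pcompose_mult)

text \<open>Away from zero the map \<open>z ^ d\<close> is unramified: \<open>z ^ d - x ^ d\<close>
  has a simple zero at \<open>x\<close>, so orders are carried over unchanged. At
  \<open>x = 0\<close> they would be multiplied by \<open>d\<close>, which is why the origin needs
  separate treatment.\<close>

lemma order_compose_power:
  fixes q :: "'a :: field_char_0 poly"
  assumes "q \<noteq> 0" "x \<noteq> 0" "d > 0"
  shows "order x (pcompose q (monom 1 d)) = order (x ^ d) q"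
proof -
  define m where "m = order (x ^ d) q"
  obtain r where r: "q = [:- (x ^ d), 1:] ^ m * r" "\<not> [:- (x ^ d), 1:] dvd r"
    using order_decomp[OF assms(1)] unfolding m_def by blast
  have r0: "poly r (x ^ d) \<noteq> 0" using r(2) by (simp add: poly_eq_0_iff_dvd)
  define L where "L = pcompose [:- (x ^ d), 1:] (monom 1 d)"
  have L: "L = monom 1 d - [:x ^ d:]" by (simp add: L_def pcompose_pCons)
  have Lne: "L \<noteq> 0"
  proof
    assume "L = 0"
    hence "coeff L d = 0" by simp
    thus False using assms(3) by (simp add: L coeff_pCons split: nat.splits)
  qed
  have root: "poly L x = 0" by (simp add: L poly_monom)
  have dL: "pderiv L = monom (of_nat d) (d - 1)"
    by (simp add: L pderiv_diff pderiv_monom pderiv_pCons)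
  have "poly (pderiv L) x \<noteq> 0" using assms by (simp add: dL poly_monom)
  hence "order x (pderiv L) = 0" by (rule order_0I)
  moreover have "order x L = Suc (order x (pderiv L))"
    using order_pderiv[OF Lne root] .
  ultimately have oL: "order x L = 1" by simp
  have eq: "pcompose q (monom 1 d) = L ^ m * pcompose r (monom 1 d)"
    by (subst r(1)) (simp add: pcompose_mult L_def pcompose_power_left)
  have rn: "poly (pcompose r (monom 1 d)) x \<noteq> 0" using r0 by (simp add: poly_pcompose poly_monom)
  have "order x (pcompose q (monom 1 d)) = order x (L ^ m) + order x (pcompose r (monom 1 d))"
    unfolding eq by (rule order_mult) (use Lne rn in auto)
  also have "order x (pcompose r (monom 1 d)) = 0" using rn by (rule order_0I)
  also have "order x (L ^ m) = m"
    using Lne oL by (induction m) (auto simp: order_mult)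
  finally show ?thesis by (simp add: m_def)
qed

section \<open>Laurent series in the inverse variable and their values\<close>

lemma poly_to_fls_0 [simp]: "poly_to_fls 0 = 0"
  by (simp add: poly_to_fls_def)

lemma poly_to_fls_pCons [simp]:
  "poly_to_fls (pCons a p) = fls_const a + fls_X_inv * poly_to_fls p"
  by (simp add: poly_to_fls_def map_poly_pCons)

lemma poly_to_fls_1 [simp]: "poly_to_fls 1 = 1"
  by (simp add: one_pCons)

lemma poly_to_fls_add: "poly_to_fls (p + q) = poly_to_fls p + poly_to_fls q"
  by (induction p q rule: poly_induct2) (simp_all add: algebra_simps flip: fls_plus_const)

lemma poly_to_fls_smult: "poly_to_fls (smult c p) = fls_const c * poly_to_fls p"
  by (induction p) (simp_all add: algebra_simps flip: fls_const_mult_const)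

lemma poly_to_fls_mult: "poly_to_fls (p * q) = poly_to_fls p * poly_to_fls q"
  by (induction p) (simp_all add: poly_to_fls_add poly_to_fls_smult algebra_simps)

lemma poly_to_fls_uminus: "poly_to_fls (- p) = - poly_to_fls p"
  by (induction p) (simp_all add: fls_const_uminus)

lemma poly_to_fls_diff: "poly_to_fls (p - q) = poly_to_fls p - poly_to_fls q"
  using poly_to_fls_add[of p "- q"] by (simp add: poly_to_fls_uminus)

lemma nth_poly_to_fls:
  "fls_nth (poly_to_fls p) n = (if n \<le> 0 then coeff p (nat (- n)) else 0)"
proof (induction p arbitrary: n)
  case (pCons a p)
  have "nat (- n) = Suc (nat (- (n + 1)))" if "n < 0" using that by linarith
  thus ?case using pCons.IH[of "n + 1"]
    by (auto simp: fls_X_inv_times_conv_shift coeff_pCons not_less split: nat.splits)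
qed simp

lemma poly_to_fls_eq_0_iff [simp]: "poly_to_fls p = 0 \<longleftrightarrow> p = 0"
proof
  assume eq: "poly_to_fls p = 0"
  show "p = 0"
  proof (rule poly_eqI)
    fix k show "coeff p k = coeff 0 k"
      using nth_poly_to_fls[of p "- int k"] by (simp add: eq)
  qed
qed simp

lemma poly_to_fls_eq_iff [simp]: "poly_to_fls p = poly_to_fls q \<longleftrightarrow> p = q"
  using poly_to_fls_eq_0_iff[of "p - q"] by (simp add: poly_to_fls_diff del: poly_to_fls_eq_0_iff)

lemma subdegree_poly_to_fls [simp]: "fls_subdegree (poly_to_fls p) = - int (degree p)"
proof (cases "p = 0")
  case False
  show ?thesis
  proof (rule fls_subdegree_eqI)
    show "fls_nth (poly_to_fls p) (- int (degree p)) \<noteq> 0" using False by (simp add: nth_poly_to_fls)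
    fix k assume "k < - int (degree p)"
    thus "fls_nth (poly_to_fls p) k = 0"
      by (auto simp: nth_poly_to_fls intro!: coeff_eq_0)
  qed
qed simp

lemma poly_to_fls_compose_power:
  assumes "d > 0"
  shows "poly_to_fls (poly_compose_power p d) = fls_compose_power (poly_to_fls p) d"
proof -
  have X: "poly_to_fls (monom 1 n) = fls_X_inv ^ n" for n
    by (induction n) (simp_all add: monom_0 monom_Suc)
  have Y: "fls_compose_power (fls_X_inv :: rat fls) d = fls_X_inv ^ d"
    using assms by (simp add: fls_X_inv_power_conv_shift_1)
  show ?thesis
    using assms by (induction p) (simp_all add: pcompose_pCons poly_to_fls_add poly_to_fls_mult X Y)
qed

lemma subdegree_compose_power:
  fixes f :: "'a :: zero fls"
  assumes "d > 0"
  shows "fls_subdegree (fls_compose_power f d) = int d * fls_subdegree f"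
proof (cases "f = 0")
  case False
  show ?thesis
  proof (rule fls_subdegree_eqI)
    show "fls_nth (fls_compose_power f d) (int d * fls_subdegree f) \<noteq> 0"
      using assms False by (simp add: fls_nth_compose_power)
    fix k assume k: "k < int d * fls_subdegree f"
    show "fls_nth (fls_compose_power f d) k = 0"
    proof (cases "int d dvd k")
      case True
      then obtain j where j: "k = int d * j" by blast
      hence "j < fls_subdegree f" using k assms by simp
      thus ?thesis using assms by (simp add: fls_nth_compose_power j)
    qed (use assms in \<open>simp add: fls_nth_compose_power\<close>)
  qed
qed simp

lemma fls_compose_power_eq_0_iff:
  fixes f :: "'a :: zero fls"
  assumes "d > 0"
  shows "fls_compose_power f d = 0 \<longleftrightarrow> f = 0"
proof
  assume eq: "fls_compose_power f d = 0"
  show "f = 0"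
  proof (rule fls_eqI)
    fix n show "fls_nth f n = fls_nth 0 n"
      using fls_nth_compose_power[OF assms, of f "int d * n"] assms by (simp add: eq)
  qed
qed simp

section \<open>Complex coefficients, convergence and evaluation\<close>

lemma nth_fls_of_rat [simp]: "fls_nth (fls_of_rat f) n = of_rat (fls_nth f n)"
  by transfer simp

lemma fls_of_rat_0 [simp]: "fls_of_rat 0 = 0"
  by (intro fls_eqI) simp

lemma fls_of_rat_eq_0_iff [simp]: "fls_of_rat f = 0 \<longleftrightarrow> f = 0"
  by (auto simp: fls_eq_iff)

lemma subdegree_fls_of_rat [simp]: "fls_subdegree (fls_of_rat f) = fls_subdegree f"
proof (cases "f = 0")
  case False
  thus ?thesis by (intro fls_subdegree_eqI) auto
qed simp

lemma fls_of_rat_add: "fls_of_rat (f + g) = fls_of_rat f + fls_of_rat g"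
  by (intro fls_eqI) (simp add: of_rat_add)

lemma fls_of_rat_diff: "fls_of_rat (f - g) = fls_of_rat f - fls_of_rat g"
  by (intro fls_eqI) (simp add: of_rat_diff)

lemma fls_of_rat_mult: "fls_of_rat (f * g) = fls_of_rat f * fls_of_rat g"
  by (intro fls_eqI) (simp add: fls_times_nth(1) of_rat_sum of_rat_mult)

lemma fls_of_rat_const [simp]: "fls_of_rat (fls_const c) = fls_const (of_rat c)"
  by (intro fls_eqI) simp

lemma fls_of_rat_X_inv [simp]: "fls_of_rat fls_X_inv = fls_X_inv"
  by (intro fls_eqI) simp

lemma fls_of_rat_compose_power:
  "d > 0 \<Longrightarrow> fls_of_rat (fls_compose_power f d) = fls_compose_power (fls_of_rat f) d"
  by (intro fls_eqI) (simp add: fls_nth_compose_power)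

text \<open>The complex-valued form of \<open>value_at\<close>, as a function of \<open>z\<close>
  and not of \<open>X = 1/z\<close>. It is used at the integer \<open>b\<close> and also on the
  orbits of complex roots of \<open>B\<close>.\<close>

definition fls_value :: "rat fls \<Rightarrow> complex \<Rightarrow> complex" where
  "fls_value f z = eval_fls (fls_of_rat f) (inverse z)"

text \<open>Since \<open>inverse 0 = 0\<close>, the inequality alone would accept
  \<open>z = 0\<close> whenever the radius is positive; the origin is therefore excluded
  explicitly.\<close>

definition fls_converges :: "rat fls \<Rightarrow> complex \<Rightarrow> bool" where
  "fls_converges f z \<longleftrightarrow> z \<noteq> 0 \<and> ereal (inverse (norm z)) < fls_conv_radius (fls_of_rat f)"

lemma fls_conv_radius_of_rat_poly [simp]: "fls_conv_radius (fls_of_rat (poly_to_fls p)) = \<infinity>"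
proof -
  have "fls_regpart (fls_of_rat (poly_to_fls p)) = fps_const (of_rat (coeff p 0))"
    by (intro fps_ext) (simp add: nth_poly_to_fls)
  thus ?thesis by (simp add: fls_conv_radius_def)
qed

lemma fls_converges_poly [simp]: "fls_converges (poly_to_fls p) z \<longleftrightarrow> z \<noteq> 0"
  by (simp add: fls_converges_def)

lemma norm_inverse_conv: "fls_converges f z \<Longrightarrow> ereal (norm (inverse z)) < fls_conv_radius (fls_of_rat f)"
  by (simp add: fls_converges_def norm_inverse)

lemma fls_converges_diff: "fls_converges f z \<Longrightarrow> fls_converges g z \<Longrightarrow> fls_converges (f - g) z"
  and fls_converges_mult: "fls_converges f z \<Longrightarrow> fls_converges g z \<Longrightarrow> fls_converges (f * g) z"
  using fls_conv_radius_diff[of "fls_of_rat f" "fls_of_rat g"]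
    fls_conv_radius_mult[of "fls_of_rat f" "fls_of_rat g"]
  unfolding fls_converges_def fls_of_rat_diff fls_of_rat_mult
  by (auto simp: min_def split: if_splits)

lemma fls_value_add:
  "fls_converges f z \<Longrightarrow> fls_converges g z \<Longrightarrow> fls_value (f + g) z = fls_value f z + fls_value g z"
  and fls_value_diff:
  "fls_converges f z \<Longrightarrow> fls_converges g z \<Longrightarrow> fls_value (f - g) z = fls_value f z - fls_value g z"
  and fls_value_mult:
  "fls_converges f z \<Longrightarrow> fls_converges g z \<Longrightarrow> fls_value (f * g) z = fls_value f z * fls_value g z"
  using norm_inverse_conv[of f z] norm_inverse_conv[of g z]
  unfolding fls_value_def fls_of_rat_add fls_of_rat_diff fls_of_rat_mult
  by (auto simp: eval_fls_add eval_fls_diff eval_fls_mult fls_converges_def)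

lemma fls_value_poly [simp]:
  assumes "z \<noteq> 0"
  shows "fls_value (poly_to_fls p) z = poly_cx p z"
proof (induction p)
  case 0
  have "fls_of_rat 0 = 0" by simp
  thus ?case by (simp add: fls_value_def)
next
  case (pCons a p)
  have X: "fls_value fls_X_inv z = z"
    using assms eval_fls_X_intpow[of "- 1" "inverse z"] unfolding fls_value_def fls_of_rat_X_inv
    by (simp add: fls_X_inv_conv_shift_1)
  have c: "fls_value (fls_const a) z = of_rat a" by (simp add: fls_value_def)
  have 1: "fls_converges (fls_const a) z" 
    using fls_converges_poly[of "[:a:]" z] assms by simp
  have 2: "fls_converges fls_X_inv z"
    using fls_converges_poly[of "[:0, 1:]" z] assms by simp
  have 3: "fls_converges (poly_to_fls p) z" using assms by simp
  show ?case
    using fls_value_add[OF 1 fls_converges_mult[OF 2 3]] fls_value_mult[OF 2 3] X c pCons.IH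
    by (simp add: map_poly_pCons)
qed

lemma sums_reindex_multiples:
  fixes g :: "nat \<Rightarrow> 'a :: real_normed_vector"
  assumes "d > 0" "\<And>n. \<not> d dvd n \<Longrightarrow> g n = 0"
  shows "g sums S \<longleftrightarrow> (\<lambda>k. g (d * k)) sums S"
proof -
  have "strict_mono (\<lambda>k. d * k)" using assms(1) by (simp add: strict_mono_def)
  moreover have "g n = 0" if "n \<notin> range (\<lambda>k. d * k)" for n
    using that assms(2)[of n] by (auto simp: dvd_def)
  ultimately show ?thesis using sums_mono_reindex[of "\<lambda>k. d * k" g S] by blast
qed

text \<open>A number \<open>r\<close> is chosen strictly between \<open>norm w ^ d\<close> and the
  radius. Convergence at its \<open>d\<close>-th root \<open>s\<close> follows by inserting zero
  terms into the series at \<open>r\<close>; only coefficients of nonnegative index enter the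
  radius.\<close>

lemma fls_conv_radius_compose_power:
  assumes "d > 0" "ereal (norm w ^ d) < fls_conv_radius F"
  shows "ereal (norm w) < fls_conv_radius (fls_compose_power F d)"
proof -
  obtain r where r: "ereal (norm w ^ d) < ereal r" "ereal r < fls_conv_radius F"
    using ereal_dense2[OF assms(2)] by blast
  have "0 \<le> norm w ^ d" by simp
  hence "r > 0" using r(1) unfolding ereal_less_eq less_ereal.simps by linarith
  define s where "s = root d r"
  have s: "s > 0" "s ^ d = r" using \<open>r > 0\<close> assms(1) by (auto simp: s_def)
  have lt: "norm w < s"
  proof (rule power_less_imp_less_base)
    show "norm w ^ d < s ^ d" using r(1) s by simp
  qed (use s in auto)
  have "summable (\<lambda>n. fls_nth F n * (of_real r :: complex) ^ n)"
    by (rule summable_fls) (use r \<open>r > 0\<close> in simp)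
  then obtain S where "(\<lambda>n. fls_nth F n * (of_real r :: complex) ^ n) sums S"
    by (auto simp: summable_def)
  moreover have "fls_nth F (int n) * (of_real r :: complex) ^ n =
      fls_nth (fls_compose_power F d) (int (d * n)) * of_real s ^ (d * n)" for n
    using assms(1) s(2) by (simp add: fls_nth_compose_power power_mult flip: of_real_power)
  ultimately have "(\<lambda>n. fls_nth (fls_compose_power F d) (int (d * n)) * of_real s ^ (d * n)) sums S"
    by simp
  hence "(\<lambda>n. fls_nth (fls_compose_power F d) (int n) * of_real s ^ n) sums S"
    by (subst sums_reindex_multiples[OF assms(1)])
       (use assms(1) in \<open>auto simp: fls_nth_compose_power\<close>)
  hence "summable (\<lambda>n. fls_nth (fls_compose_power F d) (int n) * of_real s ^ n)"
    by (rule sums_summable)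
  hence "fls_conv_radius (fls_compose_power F d) \<ge> ereal (norm (of_real s :: complex))"
    unfolding fls_conv_radius_def fps_conv_radius_def by (intro conv_radius_geI) simp
  moreover have "ereal (norm w) < ereal (norm (of_real s :: complex))" using lt s by simp
  ultimately show ?thesis by (rule less_le_trans[rotated])
qed

lemma eval_fls_compose_power:
  assumes "d > 0" "w \<noteq> 0" "ereal (norm w ^ d) < fls_conv_radius F"
  shows "eval_fls (fls_compose_power F d) w = eval_fls F (w ^ d)"
proof -
  define n where "n = fls_subdegree F"
  have "(\<lambda>k. fls_nth F (int k + n) * (w ^ d) powi (int k + n)) sums eval_fls F (w ^ d)"
    unfolding n_def by (rule sums_eval_fls) (use assms in \<open>auto simp: norm_power\<close>)
  moreover have "fls_nth F (int k + n) * (w ^ d) powi (int k + n) =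
     fls_nth (fls_compose_power F d) (int (d * k) + int d * n) * w powi (int (d * k) + int d * n)" for k
  proof -
    have eq: "int (d * k) + int d * n = int d * (int k + n)" by (simp add: algebra_simps)
    show ?thesis unfolding eq using assms(1) by (simp add: fls_nth_compose_power power_int_mult)
  qed
  ultimately have "(\<lambda>k. fls_nth (fls_compose_power F d) (int (d * k) + int d * n) *
      w powi (int (d * k) + int d * n)) sums eval_fls F (w ^ d)" by simp
  hence "(\<lambda>k. fls_nth (fls_compose_power F d) (int k + int d * n) *
      w powi (int k + int d * n)) sums eval_fls F (w ^ d)"
  proof (subst sums_reindex_multiples[OF assms(1)])
    fix k assume "\<not> d dvd k"
    hence "\<not> int d dvd int k + int d * n" by (simp add: dvd_add_left_iff)
    thus "fls_nth (fls_compose_power F d) (int k + int d * n) * w powi (int k + int d * n) = 0"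
      using assms(1) by (simp add: fls_nth_compose_power)
  qed auto
  thus ?thesis
    by (intro eval_fls_eq[where N = "int d * n"])
       (use assms in \<open>auto simp: subdegree_compose_power n_def\<close>)
qed

lemma fls_value_compose_power:
  assumes "d > 0" "z \<noteq> 0" "fls_converges f (z ^ d)"
  shows "fls_value (fls_compose_power f d) z = fls_value f (z ^ d)"
    and "fls_converges (fls_compose_power f d) z"
proof -
  have *: "ereal (norm (inverse z) ^ d) < fls_conv_radius (fls_of_rat f)"
    using assms(3) by (simp add: fls_converges_def norm_inverse norm_power power_inverse)
  show "fls_value (fls_compose_power f d) z = fls_value f (z ^ d)"
    using eval_fls_compose_power[OF assms(1) _ *] assms
    by (simp add: fls_value_def fls_of_rat_compose_power power_inverse)
  show "fls_converges (fls_compose_power f d) z"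
    using fls_conv_radius_compose_power[OF assms(1) *] assms
    by (simp add: fls_converges_def fls_of_rat_compose_power norm_inverse)
qed

text \<open>The point at infinity is \<open>X = 0\<close>: after the leading power is split off, the
  remaining power series in \<open>X\<close> is continuous there, and its value is the leading
  coefficient.\<close>

lemma fls_value_asymp:
  assumes "fls_conv_radius (fls_of_rat f) > 0"
  shows "((\<lambda>z. fls_value f z / z powi (- fls_subdegree f)) \<longlongrightarrow> of_rat (fls_nth f (fls_subdegree f)))
           at_infinity"
proof -
  define G where "G = fls_base_factor_to_fps (fls_of_rat f)"
  have "isCont (eval_fps G) 0"
    by (intro continuous_intros) 
       (use assms fls_conv_radius_altdef[of "fls_of_rat f"] in \<open>auto simp: G_def zero_ereal_def\<close>)
  hence "eval_fps G \<midarrow>0\<rightarrow> eval_fps G 0" by (meson isContD)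
  moreover have "filterlim (inverse :: complex \<Rightarrow> complex) (at 0) at_infinity"
    by (simp add: filterlim_def at_to_infinity)
  ultimately have "((\<lambda>z. eval_fps G (inverse z)) \<longlongrightarrow> eval_fps G 0) at_infinity"
    by (rule filterlim_compose)
  moreover have "eval_fps G 0 = of_rat (fls_nth f (fls_subdegree f))"
    by (simp add: eval_fps_at_0 G_def)
  moreover have "eventually (\<lambda>z. eval_fps G (inverse z) = fls_value f z / z powi (- fls_subdegree f)) at_infinity"
    using eventually_not_equal_at_infinity[of 0]
    by eventually_elim
       (auto simp: fls_value_def eval_fls_def G_def power_int_minus power_int_inverse field_simps)
  ultimately show ?thesis by (simp add: filterlim_cong)
qed

lemma poly_cx_asymp:
  assumes "p \<noteq> 0"
  shows "\<exists>c. c \<noteq> 0 \<and> ((\<lambda>z. poly_cx p z / z powi int (degree p)) \<longlongrightarrow> c) at_infinity"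
proof -
  have "((\<lambda>z. fls_value (poly_to_fls p) z / z powi int (degree p)) \<longlongrightarrow>
      of_rat (fls_nth (poly_to_fls p) (- int (degree p)))) at_infinity"
    using fls_value_asymp[of "poly_to_fls p"] by simp
  moreover have "\<forall>\<^sub>F z in at_infinity. fls_value (poly_to_fls p) z / z powi int (degree p) =
      poly_cx p z / z powi int (degree p)"
    using eventually_not_equal_at_infinity[of 0] by eventually_elim simp
  ultimately have "((\<lambda>z. poly_cx p z / z powi int (degree p)) \<longlongrightarrow>
      of_rat (fls_nth (poly_to_fls p) (- int (degree p)))) at_infinity"
    by (rule Lim_transform_eventually)
  moreover have "(of_rat (fls_nth (poly_to_fls p) (- int (degree p))) :: complex) \<noteq> 0"
    using assms by (simp add: nth_poly_to_fls)
  ultimately show ?thesis by blast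
qed

lemma fls_converges_mono:
  assumes "fls_converges f z" "norm z \<le> norm w"
  shows "fls_converges f w"
proof -
  have "norm z > 0" using assms(1) by (simp add: fls_converges_def)
  hence "inverse (norm w) \<le> inverse (norm z)" "w \<noteq> 0"
    using assms(2) by (auto intro: le_imp_inverse_le)
  thus ?thesis using assms(1) unfolding fls_converges_def
    by (meson ereal_less_eq(3) le_less_trans)
qed

lemma fls_converges_at_infinity:
  assumes "fls_conv_radius (fls_of_rat f) > 0"
  shows "eventually (fls_converges f) at_infinity"
proof -
  obtain r where r: "0 < ereal r" "ereal r < fls_conv_radius (fls_of_rat f)"
    using ereal_dense2[OF assms] by blast
  hence "r > 0" by simp
  have "fls_converges f (of_real (inverse r))"
    using r \<open>r > 0\<close> by (simp add: fls_converges_def norm_inverse)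
  hence "fls_converges f w" if "norm w \<ge> inverse r" for w
    using fls_converges_mono[of f "of_real (inverse r)" w] \<open>r > 0\<close> that by (simp add: norm_inverse)
  thus ?thesis by (auto simp: eventually_at_infinity)
qed

lemma fls_converges_imp_conv_radius_pos:
  "fls_converges f z \<Longrightarrow> fls_conv_radius (fls_of_rat f) > 0"
  by (metis fls_converges_def le_less_trans ereal_less_eq(5) inverse_nonnegative_iff_nonnegative norm_ge_zero)

section \<open>Convergents\<close>

lemma is_rational_function_poly: "is_rational_function (poly_to_fls p)"
  unfolding is_rational_function_def by (rule exI[of _ p], rule exI[of _ 1]) simp

lemma is_rational_function_inverse:
  assumes "is_rational_function f"
  shows "is_rational_function (inverse f)"
proof -
  obtain p q where pq: "q \<noteq> 0" "f = poly_to_fls p / poly_to_fls q"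
    using assms unfolding is_rational_function_def by blast
  show ?thesis
  proof (cases "p = 0")
    case True
    thus ?thesis using pq is_rational_function_poly[of 0] by simp
  next
    case False
    thus ?thesis using pq unfolding is_rational_function_def
      by (intro exI[of _ q] exI[of _ p]) simp
  qed
qed

lemma is_rational_function_add_poly:
  assumes "is_rational_function f"
  shows "is_rational_function (f + poly_to_fls a)"
proof -
  obtain p q where pq: "q \<noteq> 0" "f = poly_to_fls p / poly_to_fls q"
    using assms unfolding is_rational_function_def by blast
  thus ?thesis unfolding is_rational_function_def
    by (intro exI[of _ "p + a * q"] exI[of _ q])
       (simp add: poly_to_fls_add poly_to_fls_mult field_simps)
qed

lemma is_rational_function_mult_poly_iff:
  assumes "a \<noteq> 0"
  shows "is_rational_function (poly_to_fls a * f) \<longleftrightarrow> is_rational_function f"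
proof
  assume "is_rational_function f"
  then obtain p q where pq: "q \<noteq> 0" "f = poly_to_fls p / poly_to_fls q"
    unfolding is_rational_function_def by blast
  thus "is_rational_function (poly_to_fls a * f)" unfolding is_rational_function_def
    by (intro exI[of _ "a * p"] exI[of _ q]) (simp add: poly_to_fls_mult)
next
  assume "is_rational_function (poly_to_fls a * f)"
  then obtain p q where pq: "q \<noteq> 0" "poly_to_fls a * f = poly_to_fls p / poly_to_fls q"
    unfolding is_rational_function_def by blast
  have "f = (poly_to_fls a * f) / poly_to_fls a" using assms by simp
  also have "\<dots> = poly_to_fls p / poly_to_fls (a * q)"
    unfolding pq(2) by (simp add: poly_to_fls_mult)
  finally show "is_rational_function f" using pq(1) assms unfolding is_rational_function_def
    by (intro exI[of _ p] exI[of _ "a * q"]) simp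
qed

text \<open>The hypothesis that the remainder is nonzero excludes the default
  \<open>fls_subdegree 0 = 0\<close>.\<close>

lemma fls_floor_remainder:
  assumes "f - poly_to_fls (fls_floor f) \<noteq> 0"
  shows "fls_subdegree (f - poly_to_fls (fls_floor f)) \<ge> 1"
proof (rule fls_subdegree_geI[OF assms])
  fix k :: int assume "k < 1"
  thus "fls_nth (f - poly_to_fls (fls_floor f)) k = 0"
    by (cases "k = 0") (auto simp: nth_poly_to_fls fls_floor_def coeff_pCons split: nat.splits)
qed

lemma degree_fls_floor:
  assumes "fls_subdegree f < 0"
  shows "int (degree (fls_floor f)) = - fls_subdegree f"
  using assms unfolding fls_floor_def by (subst degree_add_eq_left) auto

locale irrational_series =
  fixes f :: "rat fls"
  assumes irrational_f: "\<not> is_rational_function f"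
begin

abbreviation "cq \<equiv> cf_complete_quotient f"
abbreviation "pp \<equiv> cf_num f"
abbreviation "qq \<equiv> cf_den f"
abbreviation "aa \<equiv> cf_quotient f"

definition cf_error :: "nat \<Rightarrow> rat fls" where
  "cf_error n = poly_to_fls (qq n) * f - poly_to_fls (pp n)"

text \<open>The expansion never stops: no remainder vanishes, so \<open>inverse\<close> never meets
  its default value at zero.\<close>

lemma cq_irrational: "\<not> is_rational_function (cq n)"
proof (induction n)
  case (Suc n)
  let ?a = "fls_floor (cq n)"
  show ?case
  proof
    assume "is_rational_function (cq (Suc n))"
    from is_rational_function_add_poly[OF is_rational_function_inverse[OF this], of ?a]
    show False using Suc by simp
  qed
qed (use irrational_f in simp)

lemma cq_Suc: "cq (Suc n) * (cq n - poly_to_fls (aa n)) = 1"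
  and cq_Suc_subdegree: "fls_subdegree (cq (Suc n)) \<le> -1"
proof -
  let ?r = "cq n - poly_to_fls (aa n)"
  have "?r \<noteq> 0" using cq_irrational[of n] is_rational_function_poly[of "aa n"] by auto
  moreover have "cq (Suc n) = inverse ?r" by (simp add: cf_quotient_def)
  ultimately show "cq (Suc n) * ?r = 1" "fls_subdegree (cq (Suc n)) \<le> -1"
    using fls_floor_remainder[of "cq n"] by (simp_all add: cf_quotient_def)
qed

lemma degree_aa: "int (degree (aa (Suc n))) = - fls_subdegree (cq (Suc n))"
  and degree_aa_pos: "degree (aa (Suc n)) > 0"
proof -
  show "int (degree (aa (Suc n))) = - fls_subdegree (cq (Suc n))"
    unfolding cf_quotient_def by (rule degree_fls_floor) (use cq_Suc_subdegree[of n] in linarith)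
  thus "degree (aa (Suc n)) > 0" using cq_Suc_subdegree[of n] by linarith
qed

lemma degree_qq_Suc: "qq n \<noteq> 0 \<and> qq (Suc n) \<noteq> 0 \<and>
    degree (qq (Suc n)) = degree (aa (Suc n)) + degree (qq n)"
proof (induction n)
  case 0
  have "aa (Suc 0) \<noteq> 0" using degree_aa_pos[of 0] by auto
  thus ?case by simp
next
  case (Suc n)
  have a: "aa (Suc (Suc n)) \<noteq> 0" "degree (aa (Suc (Suc n))) > 0" using degree_aa_pos[of "Suc n"] by auto
  have "degree (aa (Suc (Suc n)) * qq (Suc n)) = degree (aa (Suc (Suc n))) + degree (qq (Suc n))"
    using a Suc by (simp add: degree_mult_eq)
  moreover have "degree (qq n) < degree (aa (Suc (Suc n)) * qq (Suc n))"
    using calculation Suc a by simp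
  ultimately have "degree (qq (Suc (Suc n))) = degree (aa (Suc (Suc n))) + degree (qq (Suc n))"
    by (simp add: degree_add_eq_left)
  moreover from this have "qq (Suc (Suc n)) \<noteq> 0" using a by force
  ultimately show ?case using Suc by blast
qed

lemma qq_nonzero [simp]: "qq n \<noteq> 0"
  using degree_qq_Suc by blast

lemma degree_qq_less: "degree (qq n) < degree (qq (Suc n))"
  using degree_qq_Suc[of n] degree_aa_pos[of n] by simp

lemma strict_mono_degree_qq: "strict_mono (\<lambda>n. degree (qq n))"
  using degree_qq_less by (simp add: strict_mono_Suc_iff)

lemma degree_qq_less_iff [simp]: "degree (qq m) < degree (qq n) \<longleftrightarrow> m < n"
  using strict_mono_less[OF strict_mono_degree_qq] .

lemma degree_qq_eq_iff [simp]: "degree (qq m) = degree (qq n) \<longleftrightarrow> m = n"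
  using strict_mono_degree_qq strict_mono_eq[of "\<lambda>n. degree (qq n)"] by simp

lemma le_degree_qq: "n \<le> degree (qq n)"
  using strict_mono_degree_qq by (rule strict_mono_imp_increasing)

lemma minus_mult_cancel:
  fixes c r x :: "'a :: comm_ring_1"
  assumes "c * r = 1"
  shows "(- r * x) * c = - x"
proof -
  have "(- r * x) * c = - ((c * r) * x)" by (simp add: algebra_simps)
  thus ?thesis using assms by simp
qed

text \<open>In this multiplicative form each error arises from the previous one by division by a
  complete quotient, up to sign. Subdegrees therefore add up and the exact degree of every error can
  be read off, where the three-term recurrence for sums would give only an estimate.\<close>

lemma cf_error_recurrence:
  "cf_error 0 * cq (Suc 0) = 1" "cf_error (Suc n) * cq (Suc (Suc n)) = - cf_error n"
proof -
  have 0: "cf_error 0 = f - poly_to_fls (aa 0)" by (simp add: cf_error_def)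
  show e0: "cf_error 0 * cq (Suc 0) = 1"
    using cq_Suc[of 0] by (simp add: 0 mult.commute)
  show "cf_error (Suc n) * cq (Suc (Suc n)) = - cf_error n"
  proof (induction n)
    case 0
    have "cf_error (Suc 0) = poly_to_fls (aa (Suc 0)) * cf_error 0 - 1"
      by (simp add: cf_error_def poly_to_fls_add poly_to_fls_mult algebra_simps)
    also have "\<dots> = - (cq (Suc 0) - poly_to_fls (aa (Suc 0))) * cf_error 0"
      using e0 by (simp add: algebra_simps)
    finally show ?case using minus_mult_cancel[OF cq_Suc[of "Suc 0"], of "cf_error 0"] by argo
  next
    case (Suc n)
    have "cf_error (Suc (Suc n)) = poly_to_fls (aa (Suc (Suc n))) * cf_error (Suc n) + cf_error n"
      by (simp add: cf_error_def poly_to_fls_add poly_to_fls_mult algebra_simps)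
    also have "cf_error n = - (cf_error (Suc n) * cq (Suc (Suc n)))" using Suc by simp
    also have "poly_to_fls (aa (Suc (Suc n))) * cf_error (Suc n) + \<dots> =
        - (cq (Suc (Suc n)) - poly_to_fls (aa (Suc (Suc n)))) * cf_error (Suc n)"
      by (simp add: algebra_simps)
    finally show ?case using minus_mult_cancel[OF cq_Suc[of "Suc (Suc n)"], of "cf_error (Suc n)"] by argo
  qed
qed

lemma approximation_error_nonzero:
  assumes "Q \<noteq> 0"
  shows "poly_to_fls Q * f - poly_to_fls P \<noteq> 0"
proof
  assume "poly_to_fls Q * f - poly_to_fls P = 0"
  hence "f = poly_to_fls P / poly_to_fls Q" using assms by (simp add: field_simps)
  thus False using irrational_f assms unfolding is_rational_function_def by blast
qed

lemma cf_error_nonzero [simp]: "cf_error n \<noteq> 0"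
  unfolding cf_error_def by (rule approximation_error_nonzero) simp

lemma cf_error_subdegree: "fls_subdegree (cf_error n) = int (degree (qq (Suc n)))"
proof (induction n)
  case 0
  have "cq (Suc 0) \<noteq> 0" using cf_error_recurrence(1) by force
  hence "fls_subdegree (cf_error 0) + fls_subdegree (cq (Suc 0)) = fls_subdegree (cf_error 0 * cq (Suc 0))"
    by (simp del: cf_complete_quotient.simps)
  also have "\<dots> = 0" by (subst cf_error_recurrence) simp
  finally show ?case using degree_aa[of 0] by (simp del: cf_complete_quotient.simps)
next
  case (Suc n)
  have "cq (Suc (Suc n)) \<noteq> 0" using cf_error_recurrence(2)[of n] cf_error_nonzero[of n]
    by (metis mult_zero_right neg_equal_0_iff_equal)
  hence "fls_subdegree (cf_error (Suc n)) + fls_subdegree (cq (Suc (Suc n))) =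
      fls_subdegree (cf_error (Suc n) * cq (Suc (Suc n)))"
    by (simp del: cf_complete_quotient.simps)
  also have "\<dots> = fls_subdegree (cf_error n)" by (subst cf_error_recurrence) simp
  finally show ?case using degree_aa[of "Suc n"] degree_qq_Suc[of "Suc n"] Suc
    by (simp del: cf_complete_quotient.simps cf_den.simps)
qed

lemma convergent_determinant:
  "pp (Suc n) * qq n - pp n * qq (Suc n) = (-1) ^ n"
  by (induction n) (simp_all add: algebra_simps)

lemma coprime_convergent: "coprime (pp n) (qq n)"
proof (rule coprimeI)
  fix c assume c: "c dvd pp n" "c dvd qq n"
  hence "c dvd pp (Suc n) * qq n - pp n * qq (Suc n)" by (intro dvd_diff dvd_mult dvd_mult2)
  hence "c dvd (-1) ^ n * (-1) ^ n" unfolding convergent_determinant by (rule dvd_mult)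
  thus "is_unit c" by (simp flip: power_mult_distrib)
qed

text \<open>The polynomial \<open>Q * p - P * q\<close> equals
  \<open>q * (Q * f - P) - Q * (q * f - p)\<close>. The assumptions give both terms positive
  subdegree, whereas a nonzero polynomial in \<open>z\<close> has subdegree at most zero.\<close>

lemma approximations_proportional:
  assumes "Q \<noteq> 0" "q \<noteq> 0"
    and "fls_subdegree (poly_to_fls Q * f - poly_to_fls P) > int (degree q)"
    and "fls_subdegree (poly_to_fls q * f - poly_to_fls p) > int (degree Q)"
  shows "Q * p = P * q"
proof (rule ccontr)
  assume "Q * p \<noteq> P * q"
  define x where "x = poly_to_fls q * (poly_to_fls Q * f - poly_to_fls P)"
  define y where "y = - (poly_to_fls Q * (poly_to_fls q * f - poly_to_fls p))"
  have eq: "poly_to_fls (Q * p - P * q) = x + y"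
    by (simp add: x_def y_def poly_to_fls_diff poly_to_fls_mult algebra_simps)
  have nz: "x + y \<noteq> 0" using \<open>Q * p \<noteq> P * q\<close> by (simp flip: eq)
  have "fls_subdegree x > 0" "fls_subdegree y > 0" unfolding x_def y_def
    using assms approximation_error_nonzero by simp_all
  moreover have "min (fls_subdegree x) (fls_subdegree y) \<le> fls_subdegree (x + y)"
    using nz by (rule fls_plus_subdegree)
  ultimately have "fls_subdegree (x + y) > 0" by linarith
  thus False by (simp flip: eq)
qed

lemma coprime_proportional:
  fixes P Q p q :: "rat poly"
  assumes "coprime p q" "q \<noteq> 0" "Q * p = P * q"
  obtains G where "P = G * p" "Q = G * q"
proof -
  have "q dvd Q * p" unfolding assms(3) by simp
  hence "q dvd Q" using assms(1) by (simp add: coprime_commute coprime_dvd_mult_left_iff)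
  then obtain G where G: "Q = G * q" by (metis dvdE mult.commute)
  have "G * p * q = P * q" using assms(3) by (simp add: G algebra_simps)
  hence "P = G * p" using assms(2) by simp
  from this G show ?thesis by (rule that)
qed

text \<open>Legendre's criterion for Laurent series: a sufficiently good fraction is a convergent up
  to a common factor. The factor 2 of the real case does not occur because the absolute value is
  ultrametric.\<close>

lemma best_approximation:
  assumes "Q \<noteq> 0" "fls_subdegree (poly_to_fls Q * f - poly_to_fls P) > int (degree Q)"
  obtains k G where "P = G * pp k" "Q = G * qq k"
proof -
  \<comment> \<open>The least such index, so that the degree of \<open>Q\<close> is at least that of
    \<open>qq k\<close> and below that of \<open>qq (Suc k)\<close>.\<close>
  define k where "k = (LEAST k. degree Q < degree (qq (Suc k)))"
  have ex: "degree Q < degree (qq (Suc (degree Q)))"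
    using le_degree_qq[of "Suc (degree Q)"] by linarith
  hence k: "degree Q < degree (qq (Suc k))" unfolding k_def by (rule LeastI)
  have "degree (qq k) \<le> degree Q"
  proof (cases k)
    case (Suc j)
    thus ?thesis using not_less_Least[of j "\<lambda>k. degree Q < degree (qq (Suc k))"] by (simp add: k_def)
  qed simp
  hence "Q * pp k = P * qq k"
    using assms k cf_error_subdegree[of k] unfolding cf_error_def
    by (intro approximations_proportional) auto
  thus ?thesis using coprime_proportional[OF coprime_convergent] that qq_nonzero by metis
qed

lemma conv_num_degree [simp]: "conv_num f (degree (qq k)) = pp k"
  and conv_den_degree [simp]: "conv_den f (degree (qq k)) = qq k"
  by (simp_all add: conv_num_def conv_den_def)

lemma is_gap_iff: "is_gap f (u, v) \<longleftrightarrow> (\<exists>k. u = degree (qq k) \<and> v = degree (qq (Suc k)))"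
proof
  assume gap: "is_gap f (u, v)"
  then obtain k l where kl: "u = degree (qq k)" "v = degree (qq l)" "k < l"
    unfolding is_gap_def cf_degrees_def by auto
  have "l = Suc k"
  proof (rule ccontr)
    assume "l \<noteq> Suc k"
    hence "u < degree (qq (Suc k))" "degree (qq (Suc k)) < v" using kl by (auto simp del: cf_den.simps)
    thus False using gap unfolding is_gap_def cf_degrees_def by (auto simp del: cf_den.simps)
  qed
  thus "\<exists>k. u = degree (qq k) \<and> v = degree (qq (Suc k))" using kl by blast
next
  assume "\<exists>k. u = degree (qq k) \<and> v = degree (qq (Suc k))"
  thus "is_gap f (u, v)" unfolding is_gap_def cf_degrees_def by (auto simp del: cf_den.simps)
qed

end

section \<open>Gaps and their successors\<close>

declare cf_den.simps [simp del] cf_num.simps [simp del] cf_complete_quotient.simps [simp del]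

locale mahler_series = irrational_series f for f +
  fixes d :: nat and A B C :: "rat poly"
  assumes d_ge_2: "d \<ge> 2"
    and A_nonzero [simp]: "A \<noteq> 0" and B_nonzero [simp]: "B \<noteq> 0"
    and equation: "mahler_equation d f A B C"
begin

abbreviation "uu k \<equiv> degree (qq k)"

definition step_num :: "nat \<Rightarrow> rat poly" where
  "step_num k = A * poly_compose_power (pp k) d + C * poly_compose_power (qq k) d"

definition step_den :: "nat \<Rightarrow> rat poly" where
  "step_den k = B * poly_compose_power (qq k) d"

text \<open>The cancelled factor \<open>G\<close> is part of the relation: its degree is the only
  unknown in the degree recurrences, and the rationality of the limits reduces to following
  it.\<close>

definition step :: "nat \<Rightarrow> nat \<Rightarrow> rat poly \<Rightarrow> bool" where
  "step k l G \<longleftrightarrow> step_num k = G * pp l \<and> step_den k = G * qq l"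

text \<open>The inequality of \<open>is_big_gap\<close> multiplied by \<open>d - 1\<close>, which
  keeps it within the natural numbers.\<close>

definition big :: "nat \<Rightarrow> bool" where
  "big k \<longleftrightarrow> (d - 1) * (uu (Suc k) - uu k) > degree A + degree B"

lemma d_pos [simp]: "d > 0" and d_neq_0 [simp]: "d \<noteq> 0"
  using d_ge_2 by auto

lemma equation_cleared:
  "poly_to_fls B * f = poly_to_fls A * fls_compose_power f d + poly_to_fls C"
proof -
  define E where "E = poly_to_fls A * fls_compose_power f d + poly_to_fls C"
  have "f = E / poly_to_fls B" using equation by (simp add: mahler_equation_def E_def)
  hence "poly_to_fls B * f = E" by simp
  thus ?thesis by (simp add: E_def)
qed

text \<open>When an approximation is substituted into the right-hand side of the equation,
  \<open>C\<close> cancels in the error and the old error at \<open>z ^ d\<close>, times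
  \<open>A\<close>, is left. Both the degrees and the values of errors after a step are read off
  from this identity.\<close>

lemma step_error:
  "poly_to_fls (B * poly_compose_power q d) * f -
     poly_to_fls (A * poly_compose_power p d + C * poly_compose_power q d) =
   poly_to_fls A * fls_compose_power (poly_to_fls q * f - poly_to_fls p) d"
proof -
  define q' where "q' = poly_to_fls (poly_compose_power q d)"
  have "poly_to_fls (B * poly_compose_power q d) * f = (poly_to_fls B * f) * q'"
    by (simp add: poly_to_fls_mult q'_def)
  thus ?thesis unfolding equation_cleared
    by (simp add: q'_def poly_to_fls_mult poly_to_fls_add poly_to_fls_compose_power algebra_simps)
qed

lemma step_den_nonzero [simp]: "step_den k \<noteq> 0"
  by (simp add: step_den_def)

lemma degree_step_den: "degree (step_den k) = degree B + d * uu k"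
  by (simp add: step_den_def degree_mult_eq mult.commute)

lemma step_error_subdegree:
  "fls_subdegree (poly_to_fls (step_den k) * f - poly_to_fls (step_num k)) =
     int d * int (uu (Suc k)) - int (degree A)"
proof -
  have eq: "poly_to_fls (step_den k) * f - poly_to_fls (step_num k) =
      poly_to_fls A * fls_compose_power (cf_error k) d"
    unfolding step_den_def step_num_def cf_error_def by (rule step_error)
  have "fls_compose_power (cf_error k) d \<noteq> 0"
    by (simp add: fls_compose_power_eq_0_iff)
  thus ?thesis unfolding eq
    by (simp add: subdegree_compose_power cf_error_subdegree)
qed

text \<open>The two degree laws compare denominators and errors before and after the cancellation of
  \<open>G\<close>. That \<open>G\<close> divides \<open>A * B\<close> is a determinant argument:
  the step acts on the pair of numerator and denominator by a triangular matrix of determinant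
  \<open>A * B\<close>, and \<open>pp k\<close>, \<open>qq k\<close> stay coprime when
  \<open>z\<close> is replaced by \<open>z ^ d\<close>.\<close>

lemma step_degrees:
  assumes "step k l G"
  shows "uu l + degree G = d * uu k + degree B"
    and "uu (Suc l) + degree A = d * uu (Suc k) + degree G"
    and "G dvd A * B" "degree G \<le> degree A + degree B" "G \<noteq> 0"
proof -
  have P: "step_num k = G * pp l" and Q: "step_den k = G * qq l"
    using assms by (auto simp: step_def)
  show G: "G \<noteq> 0" using Q step_den_nonzero[of k] by auto
  thus "uu l + degree G = d * uu k + degree B"
    using degree_step_den[of k] by (simp add: Q degree_mult_eq)
  have "poly_to_fls (step_den k) * f - poly_to_fls (step_num k) = poly_to_fls G * cf_error l"
    unfolding P Q by (simp add: cf_error_def poly_to_fls_mult algebra_simps)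
  hence "int d * int (uu (Suc k)) - int (degree A) = int (uu (Suc l)) - int (degree G)"
    using step_error_subdegree[of k] G by (simp add: cf_error_subdegree)
  hence "int (d * uu (Suc k) + degree G) = int (uu (Suc l) + degree A)"
    unfolding of_nat_add of_nat_mult by linarith
  thus "uu (Suc l) + degree A = d * uu (Suc k) + degree G"
    by (metis of_nat_eq_iff)
  obtain s t where st: "s * pp k + t * qq k = 1"
    using coprime_bezout_poly[OF coprime_convergent] .
  let ?c = "\<lambda>p. poly_compose_power p d"
  have "?c (s * pp k + t * qq k) = 1" unfolding st by (simp add: pcompose_1)
  hence st': "?c s * ?c (pp k) + ?c t * ?c (qq k) = 1"
    by (simp add: pcompose_add pcompose_mult)
  have "A * B = A * B * (?c s * ?c (pp k) + ?c t * ?c (qq k))" unfolding st' by simp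
  also have "\<dots> = ?c s * (B * step_num k - C * step_den k) + ?c t * A * step_den k"
    by (simp add: step_num_def step_den_def algebra_simps)
  finally show dvd: "G dvd A * B"
    unfolding P Q by (metis dvd_add dvd_diff dvd_mult dvd_triv_left)
  show "degree G \<le> degree A + degree B"
    using dvd_imp_degree_le[OF dvd] by (simp add: degree_mult_eq)
qed

lemma step_exists:
  assumes "d * (uu (Suc k) - uu k) > degree A + degree B"
  obtains l G where "step k l G"
proof -
  have "d * uu (Suc k) > degree A + degree B + d * uu k"
    using assms degree_qq_less[of k] by (simp add: diff_mult_distrib2)
  hence "int (d * uu (Suc k)) > int (degree A + degree B + d * uu k)" by (simp only: of_nat_less_iff)
  hence "fls_subdegree (poly_to_fls (step_den k) * f - poly_to_fls (step_num k)) > int (degree (step_den k))"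
    unfolding step_error_subdegree degree_step_den by simp
  then obtain l G where "step_num k = G * pp l" "step_den k = G * qq l"
    using best_approximation[OF step_den_nonzero] by metis
  thus ?thesis using that by (simp add: step_def)
qed

lemma step_unique:
  assumes "step k l G" "step k l' G'"
  shows "l = l'" "G = G'"
proof -
  have e: "G * pp l = G' * pp l'" "G * qq l = G' * qq l'" using assms by (auto simp: step_def)
  have nz: "G \<noteq> 0" "G' \<noteq> 0" using step_degrees(5) assms by auto
  have "G * (qq l * pp l') = (G * qq l) * pp l'" by simp
  also have "\<dots> = qq l' * (G' * pp l')" unfolding e by simp
  also have "\<dots> = G * (pp l * qq l')" unfolding e(1)[symmetric] by simp
  finally have "qq l * pp l' = pp l * qq l'" using nz by simp
  then obtain H where H: "qq l = H * qq l'"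
    using coprime_proportional[OF coprime_convergent qq_nonzero] by metis
  from \<open>qq l * pp l' = pp l * qq l'\<close> have "qq l' * pp l = pp l' * qq l" by (simp add: mult.commute)
  then obtain H' where H': "qq l' = H' * qq l"
    using coprime_proportional[OF coprime_convergent qq_nonzero] by metis
  have "qq l dvd qq l'" "qq l' dvd qq l" using H H' by (metis dvd_triv_right)+
  hence "uu l = uu l'" by (intro antisym dvd_imp_degree_le) auto
  thus "l = l'" by simp
  thus "G = G'" using e(2) by simp
qed

text \<open>Take the last \<open>j\<close> whose stepped denominator still has degree below
  \<open>uu (Suc k)\<close>. The large gap after \<open>k\<close> then forces the error of the
  stepped fraction to be small compared with \<open>qq k\<close>, and both fractions approximate
  \<open>f\<close> so well that they agree.\<close>

lemma predecessor_exists: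
  assumes "uu (Suc k) - uu k > degree A + degree B"
  obtains j G where "step j k G"
proof -
  have as: "uu (Suc k) > uu k + degree A + degree B" using assms by simp
  define S where "S = {j. d * uu j + degree B < uu (Suc k)}"
  have "0 \<in> S" using as by (simp add: S_def cf_den.simps(1))
  have "S \<subseteq> {..uu (Suc k)}"
  proof
    fix j assume "j \<in> S"
    hence "d * uu j < uu (Suc k)" by (simp add: S_def)
    moreover have "uu j \<le> d * uu j" using mult_le_mono1[of 1 d "uu j"] d_ge_2 by simp
    ultimately show "j \<in> {..uu (Suc k)}" unfolding atMost_iff using le_degree_qq[of j] by linarith
  qed
  hence fin: "finite S" by (rule finite_subset) simp
  define j where "j = Max S"
  have "j \<in> S" unfolding j_def using fin \<open>0 \<in> S\<close> by (intro Max_in) auto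
  hence j1: "d * uu j + degree B < uu (Suc k)" by (simp add: S_def)
  have "Suc j \<notin> S" using Max_ge[OF fin, of "Suc j"] unfolding j_def by auto
  hence j2: "d * uu (Suc j) + degree B \<ge> uu (Suc k)" by (simp add: S_def)
  have "step_den j * pp k = step_num j * qq k"
  proof (rule approximations_proportional)
    have "d * uu (Suc j) > uu k + degree A" using j2 as by linarith
    hence "int (d * uu (Suc j)) > int (uu k + degree A)" by (simp only: of_nat_less_iff)
    thus "int (uu k) < fls_subdegree (poly_to_fls (step_den j) * f - poly_to_fls (step_num j))"
      unfolding step_error_subdegree by simp
    have "int (degree (step_den j)) < int (uu (Suc k))"
      unfolding degree_step_den using j1 by (simp only: of_nat_less_iff)
    thus "int (degree (step_den j)) < fls_subdegree (poly_to_fls (qq k) * f - poly_to_fls (pp k))"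
      using cf_error_subdegree[of k] unfolding cf_error_def by simp
  qed auto
  thus ?thesis
    using coprime_proportional[OF coprime_convergent qq_nonzero] that unfolding step_def by metis
qed

lemma step_size:
  assumes "step k l G"
  shows "int (uu (Suc l) - uu l) = int d * int (uu (Suc k) - uu k) - int (degree A) - int (degree B)
    + 2 * int (degree G)"
proof -
  have "int (uu l + degree G) = int (d * uu k + degree B)"
    "int (uu (Suc l) + degree A) = int (d * uu (Suc k) + degree G)"
    using step_degrees(1,2)[OF assms] by (simp_all only:)
  thus ?thesis
    unfolding of_nat_diff[OF less_imp_le[OF degree_qq_less[of k]]]
      of_nat_diff[OF less_imp_le[OF degree_qq_less[of l]]]
    by (simp add: algebra_simps)
qed

text \<open>A step turns the gap size \<open>x\<close> into at least
  \<open>d * x - deg A - deg B\<close>, and bigness is exactly the condition that this exceeds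
  \<open>x\<close>. The strict growth makes the backward search for a primitive gap
  terminate.\<close>

lemma big_step:
  assumes "big k" "step k l G"
  shows "big l" "uu (Suc l) - uu l > uu (Suc k) - uu k"
proof -
  define x where "x = uu (Suc k) - uu k"
  define y where "y = uu (Suc l) - uu l"
  have "(d - 1) * x > degree A + degree B" using assms(1) by (simp add: big_def x_def)
  hence "int ((d - 1) * x) > int (degree A + degree B)" by (simp only: of_nat_less_iff)
  hence "int d * int x - int x > int (degree A) + int (degree B)"
    using d_ge_2 by (simp add: of_nat_diff algebra_simps)
  thus lt: "y > x" using step_size[OF assms(2)] unfolding x_def[symmetric] y_def[symmetric] by linarith
  have "(d - 1) * x \<le> (d - 1) * y" using lt by simp
  thus "big l" using \<open>(d - 1) * x > degree A + degree B\<close> unfolding big_def y_def[symmetric] by linarith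
qed

lemma big_step_exists:
  assumes "big k"
  obtains l G where "step k l G"
proof -
  have "(d - 1) * (uu (Suc k) - uu k) \<le> d * (uu (Suc k) - uu k)" by (intro mult_le_mono1) simp
  hence "d * (uu (Suc k) - uu k) > degree A + degree B" using assms unfolding big_def by linarith
  thus ?thesis using step_exists that by blast
qed

section \<open>Primitive gaps and the sequences they generate\<close>

definition primitive :: "nat \<Rightarrow> bool" where
  "primitive k \<longleftrightarrow> big k \<and> \<not> (\<exists>j G. big j \<and> step j k G)"

text \<open>Write \<open>W = deg A + deg B\<close>. A gap of size \<open>y > 3 * W\<close> has a
  predecessor of some size \<open>x\<close> with \<open>y \<le> d * x + W\<close>, because the
  cancelled factor has degree at most \<open>W\<close>. So \<open>d * x > 2 * W\<close>, and
  \<open>2 * (d - 1) \<ge> d\<close> makes that predecessor big. The bound keeps the ratios of late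
  starting gaps close to 1.\<close>

lemma primitive_size:
  assumes "primitive k"
  shows "uu (Suc k) - uu k \<le> 3 * (degree A + degree B)"
proof (rule ccontr)
  define y where "y = uu (Suc k) - uu k"
  define W where "W = degree A + degree B"
  assume "\<not> uu (Suc k) - uu k \<le> 3 * (degree A + degree B)"
  hence y: "y > 3 * W" by (simp add: y_def W_def)
  then obtain j G where j: "step j k G"
    using predecessor_exists[of k] unfolding y_def W_def by fastforce
  define x where "x = uu (Suc j) - uu j"
  have "int y = int d * int x - int W + 2 * int (degree G)" "degree G \<le> W"
    using step_size[OF j] step_degrees(4)[OF j] by (simp_all add: x_def y_def W_def)
  hence "int d * int x > 2 * int W" using y by linarith
  moreover have "2 * (int d - 1) \<ge> int d" using d_ge_2 by simp
  hence "2 * (int d - 1) * int x \<ge> int d * int x" by (intro mult_right_mono) auto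
  ultimately have "(int d - 1) * int x > int W" by linarith
  hence "int ((d - 1) * x) > int W" using d_ge_2 by (simp add: of_nat_diff)
  hence "big j" unfolding big_def x_def W_def by (simp only: of_nat_less_iff)
  thus False using assms j unfolding primitive_def by blast
qed

definition primitive_sequence :: "(nat \<Rightarrow> nat) \<Rightarrow> (nat \<Rightarrow> rat poly) \<Rightarrow> bool" where
  "primitive_sequence k G \<longleftrightarrow> primitive (k 0) \<and> (\<forall>n. step (k n) (k (Suc n)) (G n))"

lemma primitive_sequence_big:
  assumes "primitive_sequence k G"
  shows "big (k n)"
  using assms by (induction n) (auto simp: primitive_sequence_def primitive_def intro: big_step)

lemma primitive_sequence_inj:
  assumes "primitive_sequence k G"
  shows "inj k"
proof -
  have "strict_mono (\<lambda>n. uu (Suc (k n)) - uu (k n))"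
    unfolding strict_mono_Suc_iff
  proof
    fix n
    have "step (k n) (k (Suc n)) (G n)" using assms by (simp add: primitive_sequence_def)
    thus "uu (Suc (k n)) - uu (k n) < uu (Suc (k (Suc n))) - uu (k (Suc n))"
      by (rule big_step(2)[OF primitive_sequence_big[OF assms]])
  qed
  hence "inj (\<lambda>n. uu (Suc (k n)) - uu (k n))" by (rule strict_mono_imp_inj_on)
  thus ?thesis unfolding inj_on_def by metis
qed

lemma primitive_sequence_exists:
  assumes "primitive j"
  obtains k G where "primitive_sequence k G" "k 0 = j"
proof -
  have "\<forall>l. \<exists>m. big l \<longrightarrow> (\<exists>G. step l m G)" using big_step_exists by metis
  then obtain nx where nx: "\<And>l. big l \<Longrightarrow> \<exists>G. step l (nx l) G" by metis
  define k where "k n = (nx ^^ n) j" for n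
  have b: "big (k n)" for n
  proof (induction n)
    case (Suc n)
    show ?case using nx[OF Suc] big_step(1)[OF Suc] by (auto simp: k_def)
  qed (use assms in \<open>simp add: k_def primitive_def\<close>)
  have "\<exists>G. step (k n) (k (Suc n)) G" for n using nx[OF b[of n]] by (simp add: k_def)
  then obtain G where "\<And>n. step (k n) (k (Suc n)) (G n)" by metis
  thus ?thesis using that[of k G] assms by (simp add: primitive_sequence_def k_def)
qed

text \<open>Going back through big predecessors decreases the size, so the search ends at a
  primitive gap. As successors are unique, any sequence that starts there runs through
  \<open>j\<close>, whichever one was chosen.\<close>

lemma big_in_primitive_sequence:
  assumes "big j"
  obtains i where "primitive i" "\<And>k G. primitive_sequence k G \<Longrightarrow> k 0 = i \<Longrightarrow> j \<in> range k"
proof -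
  have "\<exists>i. primitive i \<and> (\<forall>k G. primitive_sequence k G \<and> k 0 = i \<longrightarrow> j \<in> range k)"
    using assms
  proof (induction "uu (Suc j) - uu j" arbitrary: j rule: less_induct)
    case less
    show ?case
    proof (cases "primitive j")
      case False
      then obtain i G where i: "big i" "step i j G" using less.prems by (auto simp: primitive_def)
      obtain h where h: "primitive h" "\<forall>k G. primitive_sequence k G \<and> k 0 = h \<longrightarrow> i \<in> range k"
        using less.hyps[OF big_step(2)[OF i] i(1)] by blast
      have "j \<in> range k" if k: "primitive_sequence k G'" "k 0 = h" for k G'
      proof -
        obtain n where "i = k n" using h k by blast
        hence "step i (k (Suc n)) (G' n)" using k by (simp add: primitive_sequence_def)
        hence "j = k (Suc n)" using step_unique(1) i(2) by blast
        thus ?thesis by blast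
      qed
      thus ?thesis using h by blast
    qed blast
  qed
  thus ?thesis using that by blast
qed

end

section \<open>The ratios of consecutive denominator degrees\<close>

context mahler_series begin

text \<open>At \<open>k = 0\<close> the degree \<open>uu 0\<close> is zero and the quotient takes
  the default value 0, so the lower bound 1 is stated for \<open>k > 0\<close> only.\<close>

definition gap_ratio :: "nat \<Rightarrow> real" where
  "gap_ratio k = real (uu (Suc k)) / real (uu k)"

lemma filterlim_degree_qq: "filterlim (\<lambda>k. real (uu k)) at_top sequentially"
  by (intro filterlim_compose[OF filterlim_real_sequentially] filterlim_subseq strict_mono_degree_qq)

lemma gap_ratio_gt_1:
  assumes "k > 0"
  shows "gap_ratio k > 1"
proof -
  have "uu k > 0" using le_degree_qq[of k] assms by linarith
  moreover have "real (uu k) < real (uu (Suc k))" using degree_qq_less[of k] by (simp only: of_nat_less_iff)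
  ultimately show ?thesis by (simp add: gap_ratio_def)
qed

lemma primitive_sequence_filterlim:
  assumes "primitive_sequence k G"
  shows "filterlim k at_top sequentially"
  unfolding filterlim_at_top
proof
  fix M
  have "finite (k -` {..<M})" using primitive_sequence_inj[OF assms] by (intro finite_vimageI) auto
  moreover have "{n. \<not> M \<le> k n} = k -` {..<M}" by auto
  ultimately have "eventually (\<lambda>n. M \<le> k n) cofinite" by (simp add: eventually_cofinite)
  thus "eventually (\<lambda>n. M \<le> k n) sequentially" by (simp add: cofinite_eq_sequentially)
qed

text \<open>The limit is the quotient of the two shifted degrees at the index \<open>N\<close> from
  which the cancelled degree is constant; it is built from integers, hence rational.\<close>

lemma primitive_sequence_ratio_tendsto:
  assumes seq: "primitive_sequence k G" and c: "\<And>n. n \<ge> N \<Longrightarrow> degree (G n) = c"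
  shows "\<exists>\<theta> :: rat. (\<lambda>n. gap_ratio (k n)) \<longlonglongrightarrow> of_rat \<theta>"
proof -
  define e where "e = real d - 1"
  have e: "e > 0" using d_ge_2 by (simp add: e_def)
  \<comment> \<open>The shifts to the fixed points of the affine recurrences for the two degrees,
    multiplied by \<open>d - 1\<close> to avoid fractions; \<open>x\<close> and \<open>y\<close> are
    then exactly geometric from \<open>N\<close> on.\<close>
  define x where "x n = e * real (uu (k n)) + (real (degree B) - real c)" for n
  define y where "y n = e * real (uu (Suc (k n))) + (real c - real (degree A))" for n
  have st: "step (k n) (k (Suc n)) (G n)" for n using seq by (simp add: primitive_sequence_def)
  have rec: "x (Suc n) = real d * x n" "y (Suc n) = real d * y n" if "n \<ge> N" for n
  proof -
    have "real (uu (k (Suc n)) + degree (G n)) = real (d * uu (k n) + degree B)"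
      "real (uu (Suc (k (Suc n))) + degree A) = real (d * uu (Suc (k n)) + degree (G n))"
      using step_degrees(1,2)[OF st[of n]] by (simp_all only:)
    hence *: "real (uu (k (Suc n))) = real d * real (uu (k n)) + real (degree B) - real c"
      "real (uu (Suc (k (Suc n)))) = real d * real (uu (Suc (k n))) + real c - real (degree A)"
      using c[OF that] by simp_all
    thus "x (Suc n) = real d * x n" "y (Suc n) = real d * y n"
      unfolding x_def y_def e_def * by (simp_all add: algebra_simps)
  qed
  have xN: "x (N + n) = real d ^ n * x N" "y (N + n) = real d ^ n * y N" for n
    by (induction n) (simp_all add: rec)
  have ulim: "filterlim (\<lambda>n. real (uu (k n))) at_top sequentially"
    by (rule filterlim_compose[OF filterlim_degree_qq primitive_sequence_filterlim[OF seq]])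
  hence xlim: "filterlim x at_top sequentially" unfolding x_def
    using filterlim_tendsto_add_at_top[OF tendsto_const
        filterlim_tendsto_pos_mult_at_top[OF tendsto_const e ulim], of "real (degree B) - real c"]
    by (simp add: add.commute)
  \<comment> \<open>Positivity at a late index carries back to \<open>N\<close> because
    \<open>x\<close> is geometric from there on.\<close>
  have "eventually (\<lambda>n. x (N + n) > 0) sequentially"
    using filterlim_at_top_dense[THEN iffD1, OF xlim, rule_format, of 0]
    using eventually_sequentially_seg[of "\<lambda>n. x n > 0" N] by (simp add: add.commute)
  then obtain m where "x (N + m) > 0" by (auto simp: eventually_sequentially)
  hence xpos: "x N > 0" unfolding xN by (simp add: zero_less_mult_iff)
  define \<theta> :: rat where "\<theta> = ((of_nat d - 1) * of_nat (uu (Suc (k N))) + of_nat c - of_nat (degree A)) /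
      ((of_nat d - 1) * of_nat (uu (k N)) + of_nat (degree B) - of_nat c)"
  have \<theta>: "of_rat \<theta> = y N / x N"
    unfolding \<theta>_def of_rat_divide of_rat_mult of_rat_add of_rat_diff of_rat_of_nat_eq of_rat_1
      x_def y_def e_def by (simp only: add_diff_eq)
  have "gap_ratio (k n) = (of_rat \<theta> * x n + (real (degree A) - real c)) / (x n + (real c - real (degree B)))"
    if n: "n \<ge> N" for n
  proof -
    obtain i where i: "n = N + i" using le_Suc_ex[OF n] by (elim exE)
    have "of_rat \<theta> * x n = y n" unfolding i xN \<theta> using xpos by simp
    hence "gap_ratio (k n) = (e * real (uu (Suc (k n)))) / (e * real (uu (k n)))"
      using e by (simp add: gap_ratio_def)
    thus ?thesis unfolding \<open>of_rat \<theta> * x n = y n\<close> by (simp add: x_def y_def)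
  qed
  moreover have "(\<lambda>n. (of_rat \<theta> * x n + (real (degree A) - real c)) / (x n + (real c - real (degree B)))) \<longlonglongrightarrow> of_rat \<theta>"
  proof -
    define a where "a = real (degree A) - real c"
    define b' where "b' = real c - real (degree B)"
    have lim: "filterlim (\<lambda>n. x n + b') at_top sequentially"
      using filterlim_tendsto_add_at_top[OF tendsto_const xlim, of b'] by (simp add: add.commute)
    have "(\<lambda>n. of_rat \<theta> + (a - of_rat \<theta> * b') / (x n + b')) \<longlonglongrightarrow> of_rat \<theta> + 0"
      by (rule tendsto_add[OF tendsto_const real_tendsto_divide_at_top[OF tendsto_const lim]])
    moreover have "\<forall>\<^sub>F n in sequentially. of_rat \<theta> + (a - of_rat \<theta> * b') / (x n + b') = (of_rat \<theta> * x n + a) / (x n + b')"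
      using filterlim_at_top_dense[THEN iffD1, OF lim, rule_format, of 0]
      by eventually_elim (simp add: field_simps)
    ultimately show ?thesis unfolding a_def[symmetric] b'_def[symmetric]
      using Lim_transform_eventually by fastforce
  qed
  ultimately have "(\<lambda>n. gap_ratio (k n)) \<longlonglongrightarrow> of_rat \<theta>"
    by (subst tendsto_cong[of _ "\<lambda>n. (of_rat \<theta> * x n + (real (degree A) - real c)) / (x n + (real c - real (degree B)))"])
       (auto simp: eventually_sequentially)
  thus ?thesis by blast
qed

text \<open>Nothing is assumed here on \<open>degree (G n)\<close> beyond the bounds 0 and
  \<open>degree A + degree B\<close>. With the worst value in each recurrence \<open>x\<close> grows
  at least, and \<open>y\<close> at most, geometrically, so the bound depends on the first gap
  alone.\<close>

lemma primitive_sequence_ratio_bound: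
  assumes seq: "primitive_sequence k G" and pos: "real (d - 1) * real (uu (k 0)) > real (degree A)"
  shows "gap_ratio (k n) \<le> (real (d - 1) * real (uu (Suc (k 0))) + real (degree B)) /
    (real (d - 1) * real (uu (k 0)) - real (degree A))"
proof -
  define e where "e = real (d - 1)"
  have e: "e > 0" "e = real d - 1" using d_ge_2 by (auto simp: e_def)
  define x where "x n = e * real (uu (k n)) - real (degree A)" for n
  define y where "y n = e * real (uu (Suc (k n))) + real (degree B)" for n
  have st: "step (k n) (k (Suc n)) (G n)" for n using seq by (simp add: primitive_sequence_def)
  have rec: "x (Suc n) \<ge> real d * x n" "y (Suc n) \<le> real d * y n" for n
  proof -
    have "real (uu (k (Suc n)) + degree (G n)) = real (d * uu (k n) + degree B)"
      "real (uu (Suc (k (Suc n))) + degree A) = real (d * uu (Suc (k n)) + degree (G n))"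
      using step_degrees(1,2)[OF st[of n]] by (simp_all only:)
    moreover have "real (degree (G n)) \<le> real (degree A + degree B)"
      using step_degrees(4)[OF st[of n]] by (simp only: of_nat_le_iff)
    ultimately have *: "real (uu (k (Suc n))) \<ge> real d * real (uu (k n)) - real (degree A)"
      "real (uu (Suc (k (Suc n)))) \<le> real d * real (uu (Suc (k n))) + real (degree B)"
      by simp_all
    have "e * real (uu (k (Suc n))) \<ge> e * (real d * real (uu (k n)) - real (degree A))"
      "e * real (uu (Suc (k (Suc n)))) \<le> e * (real d * real (uu (Suc (k n))) + real (degree B))"
      using * e(1) by (auto intro!: mult_left_mono)
    thus "x (Suc n) \<ge> real d * x n" "y (Suc n) \<le> real d * y n"
      unfolding x_def y_def e(2) by (simp_all add: algebra_simps)
  qed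
  have xn: "x n \<ge> real d ^ n * x 0" for n
  proof (induction n)
    case (Suc n)
    have "real d ^ Suc n * x 0 \<le> real d * x n" using mult_left_mono[OF Suc, of "real d"] by simp
    thus ?case using rec(1)[of n] by linarith
  qed simp
  have yn: "y n \<le> real d ^ n * y 0" for n
  proof (induction n)
    case (Suc n)
    have "real d ^ Suc n * y 0 \<ge> real d * y n" using mult_left_mono[OF Suc, of "real d"] by simp
    thus ?case using rec(2)[of n] by linarith
  qed simp
  have x0: "x 0 > 0" using pos unfolding x_def e_def by linarith
  have y0: "y 0 \<ge> 0" using e by (simp add: y_def)
  have dp: "real d ^ n > 0" by simp
  have xpos: "x n > 0" using xn[of n] mult_pos_pos[OF dp x0] by linarith
  have upos: "e * real (uu (k n)) \<ge> x n" by (simp add: x_def)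
  have "gap_ratio (k n) = (e * real (uu (Suc (k n)))) / (e * real (uu (k n)))"
    using e by (simp add: gap_ratio_def)
  also have "\<dots> \<le> y n / x n"
    using xpos upos e by (intro frac_le) (auto simp: y_def)
  also have "\<dots> \<le> (real d ^ n * y 0) / (real d ^ n * x 0)"
    using xn[of n] yn[of n] y0 x0 by (intro frac_le) auto
  also have "\<dots> = y 0 / x 0" by simp
  finally show ?thesis by (simp add: x_def y_def e_def)
qed

theorem limsup_gap_ratio:
  assumes stab: "\<And>k G. primitive_sequence k G \<Longrightarrow> \<exists>N c. \<forall>n\<ge>N. degree (G n) = c"
  shows "\<exists>L :: rat. (\<forall>\<epsilon>>0. \<forall>\<^sub>F k in sequentially. gap_ratio k < of_rat L + \<epsilon>) \<and>
    (\<forall>\<epsilon>>0. \<exists>\<^sub>F k in sequentially. gap_ratio k > of_rat L - \<epsilon>)"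
\<comment> \<open>Either the limit superior is 1, or some \<open>1 + \<delta>\<close> is reached
  infinitely often; in the second case only ratios above \<open>1 + \<delta> / 2\<close> have to be
  controlled.\<close>
proof (cases "\<forall>\<epsilon>>0. \<forall>\<^sub>F k in sequentially. gap_ratio k < 1 + \<epsilon>")
  case True
  have "\<exists>\<^sub>F k in sequentially. gap_ratio k > 1 - \<epsilon>" if "\<epsilon> > 0" for \<epsilon>
  proof -
    have "\<forall>\<^sub>F k in sequentially. gap_ratio k > 1 - \<epsilon>"
      using eventually_gt_at_top[of 0]
    proof eventually_elim
      case (elim k)
      show ?case using gap_ratio_gt_1[OF elim] that by linarith
    qed
    thus ?thesis by (intro eventually_frequently trivial_limit_sequentially)
  qed
  with True have "(\<forall>\<epsilon>>0. \<forall>\<^sub>F k in sequentially. gap_ratio k < of_rat 1 + \<epsilon>) \<and>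
    (\<forall>\<epsilon>>0. \<exists>\<^sub>F k in sequentially. gap_ratio k > of_rat 1 - \<epsilon>)"
    unfolding of_rat_1 by blast
  thus ?thesis by (rule exI)
next
  case False
  then obtain \<delta> where \<delta>: "\<delta> > 0" "\<exists>\<^sub>F k in sequentially. gap_ratio k \<ge> 1 + \<delta>"
    by (auto simp: not_eventually not_less)
  define W where "W = degree A + degree B"
  define e where "e = real (d - 1)"
  have e: "e \<ge> 1" using d_ge_2 by (simp add: e_def)
  \<comment> \<open>Chosen so that a primitive sequence starting beyond \<open>X\<close> has no
    ratio above \<open>1 + \<delta> / 2\<close>. The summands pay for the size \<open>3 * W\<close>
    of the first gap, for \<open>deg B\<close> and for \<open>deg A\<close>; the surplus in the last
    one makes the denominator of the ratio bound positive.\<close>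
  define X where "X = (3 * e * real W + real (degree B) + (2 + \<delta> / 2) * (real (degree A) + 1)) / (\<delta> / 2)"
  have small: "gap_ratio (k n) \<le> 1 + \<delta> / 2"
    if seq: "primitive_sequence k G" and u: "real (uu (k 0)) > X" for k G n
  proof -
    have "primitive (k 0)" using seq by (simp add: primitive_sequence_def)
    hence "uu (Suc (k 0)) \<le> uu (k 0) + 3 * W" using primitive_size[of "k 0"] by (simp add: W_def)
    hence v: "real (uu (Suc (k 0))) \<le> real (uu (k 0) + 3 * W)" by (simp only: of_nat_le_iff)
    have "X * (\<delta> / 2) = 3 * e * real W + real (degree B) + (2 + \<delta> / 2) * (real (degree A) + 1)"
      using \<delta> by (simp add: X_def)
    hence big_u: "real (uu (k 0)) * (\<delta> / 2) > 3 * e * real W + real (degree B) + (2 + \<delta> / 2) * (real (degree A) + 1)"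
      using mult_strict_right_mono[OF u, of "\<delta> / 2"] \<delta> by linarith
    have "(2 + \<delta> / 2) * (real (degree A) + 1) =
        2 * real (degree A) + 2 + real (degree A) * (\<delta> / 2) + \<delta> / 2" by (simp add: algebra_simps)
    moreover have "3 * e * real W \<ge> 0" using e by simp
    ultimately have "real (degree A) * (\<delta> / 2) < real (uu (k 0)) * (\<delta> / 2)"
      using big_u \<delta> by linarith
    hence "real (degree A) < real (uu (k 0))" using \<delta> by simp
    also have "\<dots> \<le> e * real (uu (k 0))" using mult_right_mono[OF e, of "real (uu (k 0))"] by simp
    finally have pos: "e * real (uu (k 0)) > real (degree A)" .
    have "gap_ratio (k n) \<le> (e * real (uu (Suc (k 0))) + real (degree B)) / (e * real (uu (k 0)) - real (degree A))"
      using primitive_sequence_ratio_bound[OF seq pos[unfolded e_def]] unfolding e_def .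
    also have "\<dots> \<le> 1 + \<delta> / 2"
    proof (subst pos_divide_le_eq)
      have 1: "e * real (uu (Suc (k 0))) \<le> e * (real (uu (k 0)) + 3 * real W)"
        using v e by (intro mult_left_mono) auto
      have 2: "e * (real (uu (k 0)) * (\<delta> / 2)) \<ge> 1 * (real (uu (k 0)) * (\<delta> / 2))"
        using e \<delta> by (intro mult_right_mono) auto
      have "real (degree A) + real (degree A) * (\<delta> / 2) \<le> (2 + \<delta> / 2) * (real (degree A) + 1)"
        using \<delta> by (simp add: algebra_simps)
      thus "e * real (uu (Suc (k 0))) + real (degree B) \<le> (1 + \<delta> / 2) * (e * real (uu (k 0)) - real (degree A))"
        using 1 2 big_u by (simp add: algebra_simps)
    qed (use pos in simp)
    finally show ?thesis .
  qed
  define T where "T = {j. primitive j \<and> real (uu j) \<le> X}"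
  have "T \<subseteq> {..nat \<lfloor>X\<rfloor>}"
  proof
    fix j assume "j \<in> T"
    hence "real j \<le> X" using le_degree_qq[of j] unfolding T_def by simp
    thus "j \<in> {..nat \<lfloor>X\<rfloor>}" by (simp add: le_nat_floor)
  qed
  hence finT: "finite T" by (rule finite_subset) simp
  have "\<exists>k G \<theta>. primitive_sequence k G \<and> k 0 = j \<and> (\<lambda>n. gap_ratio (k n)) \<longlonglongrightarrow> of_rat \<theta>" if "j \<in> T" for j
  proof -
    have "primitive j" using that by (simp add: T_def)
    then obtain k G where k: "primitive_sequence k G" "k 0 = j" by (rule primitive_sequence_exists)
    obtain N c where Nc: "\<And>n. n \<ge> N \<Longrightarrow> degree (G n) = c" using stab[OF k(1)] by metis
    obtain \<theta> :: rat where "(\<lambda>n. gap_ratio (k n)) \<longlonglongrightarrow> of_rat \<theta>"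
      using primitive_sequence_ratio_tendsto[OF k(1), of N c] Nc by blast
    with k show ?thesis by (intro exI conjI)
  qed
  then obtain K GG \<theta> where K: "\<And>j. j \<in> T \<Longrightarrow> primitive_sequence (K j) (GG j)"
      "\<And>j. j \<in> T \<Longrightarrow> K j 0 = j" "\<And>j. j \<in> T \<Longrightarrow> (\<lambda>n. gap_ratio (K j n)) \<longlonglongrightarrow> of_rat (\<theta> j)"
    by metis
  \<comment> \<open>A late ratio above \<open>1 + \<delta> / 2\<close> forces a gap longer than
    \<open>W\<close>, hence a big one, and its primitive sequence cannot start beyond
    \<open>X\<close>.\<close>
  have cover: "\<forall>\<^sub>F m in sequentially. gap_ratio m > 1 + \<delta> / 2 \<longrightarrow> (\<exists>j\<in>T. \<exists>n. m = K j n)"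
  proof -
    have "\<forall>\<^sub>F m in sequentially. real (uu m) > 2 * real W / \<delta>"
      using filterlim_at_top_dense[THEN iffD1, OF filterlim_degree_qq] by blast
    thus ?thesis using eventually_gt_at_top[of 0]
    proof eventually_elim
      case (elim m)
      show ?case
      proof
        assume r: "gap_ratio m > 1 + \<delta> / 2"
        have um: "real (uu m) > 0" using elim le_degree_qq[of m] by linarith
        have "real W < real (uu m) * (\<delta> / 2)" using elim \<delta> by (simp add: field_simps)
        moreover have "(1 + \<delta> / 2) * real (uu m) < real (uu (Suc m))"
          using r um by (simp add: gap_ratio_def pos_less_divide_eq)
        ultimately have "real (uu m + W) < real (uu (Suc m))" by (simp add: algebra_simps)
        hence lt: "uu m + W < uu (Suc m)" by (simp only: of_nat_less_iff)
        hence "1 * (uu (Suc m) - uu m) \<le> (d - 1) * (uu (Suc m) - uu m)"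
          using d_ge_2 by (intro mult_le_mono1) simp
        hence "big m" unfolding big_def W_def[symmetric] using lt by linarith
        then obtain i where i: "primitive i" "\<And>k G. primitive_sequence k G \<Longrightarrow> k 0 = i \<Longrightarrow> m \<in> range k"
          using big_in_primitive_sequence by blast
        have "i \<in> T"
        proof (rule ccontr)
          assume "i \<notin> T"
          hence "real (uu i) > X" using i by (simp add: T_def)
          moreover obtain k G where k: "primitive_sequence k G" "k 0 = i"
            using primitive_sequence_exists[OF i(1)] .
          moreover obtain n where "m = k n" using i(2)[OF k] by blast
          ultimately show False using small[of k G n] r by simp
        qed
        thus "\<exists>j\<in>T. \<exists>n. m = K j n" using i(2)[OF K(1,2)] by blast
      qed
    qed
  qed
  obtain m1 where m1: "gap_ratio m1 \<ge> 1 + \<delta>" "gap_ratio m1 > 1 + \<delta> / 2 \<longrightarrow> (\<exists>j\<in>T. \<exists>n. m1 = K j n)"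
    using frequently_ex[OF frequently_eventually_conj[OF \<delta>(2) cover]] by blast
  have "gap_ratio m1 > 1 + \<delta> / 2" using m1(1) \<delta>(1) by linarith
  hence neT: "T \<noteq> {}" using m1(2) by blast
  define L where "L = Max (\<theta> ` T)"
  have L_ge: "\<theta> j \<le> L" if "j \<in> T" for j unfolding L_def using finT that by simp
  have "L \<in> \<theta> ` T" unfolding L_def using finT neT by (intro Max_in) simp_all
  then obtain j0 where j0: "j0 \<in> T" "\<theta> j0 = L" by blast
  have upper: "\<forall>\<^sub>F m in sequentially. gap_ratio m > 1 + \<delta> / 2 \<longrightarrow> gap_ratio m < of_rat L + \<epsilon>"
    if \<epsilon>: "\<epsilon> > 0" for \<epsilon>
  proof -
    have "\<exists>N. \<forall>n\<ge>N. gap_ratio (K j n) < of_rat (\<theta> j) + \<epsilon>" if "j \<in> T" for j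
      using order_tendstoD(2)[OF K(3)[OF that], of "of_rat (\<theta> j) + \<epsilon>"] \<epsilon>
      by (simp add: eventually_sequentially)
    then obtain N where N: "\<And>j n. j \<in> T \<Longrightarrow> n \<ge> N j \<Longrightarrow> gap_ratio (K j n) < of_rat (\<theta> j) + \<epsilon>"
      by metis
    \<comment> \<open>The early terms of the finitely many sequences. Away from this finite set the
      limits along the sequences give a bound for all remaining \<open>m\<close>.\<close>
    define E where "E = (\<Union>j\<in>T. K j ` {..<N j})"
    have "finite E" unfolding E_def using finT by auto
    hence "\<forall>\<^sub>F m in sequentially. m \<notin> E"
      by (simp add: eventually_cofinite flip: cofinite_eq_sequentially)
    thus ?thesis using cover
    proof eventually_elim
      case (elim m)
      show ?case
      proof
        assume "gap_ratio m > 1 + \<delta> / 2"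
        then obtain j n where j: "j \<in> T" "m = K j n" using elim by blast
        have "n \<ge> N j"
        proof (rule ccontr)
          assume "\<not> n \<ge> N j"
          hence "K j n \<in> K j ` {..<N j}" by simp
          hence "m \<in> E" unfolding E_def using j by blast
          thus False using elim(1) by simp
        qed
        hence "gap_ratio m < of_rat (\<theta> j) + \<epsilon>" unfolding j(2) by (rule N[OF j(1)])
        also have "\<dots> \<le> of_rat L + \<epsilon>" using L_ge[OF j(1)] by (simp add: of_rat_less_eq)
        finally show "gap_ratio m < of_rat L + \<epsilon>" .
      qed
    qed
  qed
  \<comment> \<open>Otherwise \<open>upper\<close> would keep all late ratios below
    \<open>1 + \<delta> / 2\<close>, against the choice of \<open>\<delta>\<close>. So
    \<open>of_rat L\<close> also bounds the ratios on which \<open>upper\<close> is silent.\<close>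
  have L: "of_rat L \<ge> 1 + \<delta> / 2"
  proof (rule ccontr)
    assume "\<not> of_rat L \<ge> 1 + \<delta> / 2"
    hence "\<forall>\<^sub>F m in sequentially. gap_ratio m > 1 + \<delta> / 2 \<longrightarrow> gap_ratio m < of_rat L + (1 + \<delta> / 2 - of_rat L)"
      by (intro upper) simp
    from frequently_eventually_conj[OF \<delta>(2) this] obtain m where
      "gap_ratio m \<ge> 1 + \<delta>" "gap_ratio m > 1 + \<delta> / 2 \<longrightarrow> gap_ratio m < of_rat L + (1 + \<delta> / 2 - of_rat L)"
      by (blast dest: frequently_ex)
    thus False using \<delta>(1) by linarith
  qed
  have "\<forall>\<^sub>F m in sequentially. gap_ratio m < of_rat L + \<epsilon>" if "\<epsilon> > 0" for \<epsilon>
    using upper[OF that]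
  proof eventually_elim
    case (elim m)
    thus ?case using L that by linarith
  qed
  moreover have "\<exists>\<^sub>F m in sequentially. gap_ratio m > of_rat L - \<epsilon>" if "\<epsilon> > 0" for \<epsilon>
  proof -
    have "\<forall>\<^sub>F n in sequentially. gap_ratio (K j0 n) > of_rat L - \<epsilon>"
      using order_tendstoD(1)[OF K(3)[OF j0(1)], of "of_rat L - \<epsilon>"] that j0 by simp
    show ?thesis unfolding frequently_def
    proof
      assume "\<forall>\<^sub>F m in sequentially. \<not> gap_ratio m > of_rat L - \<epsilon>"
      from eventually_compose_filterlim[OF this primitive_sequence_filterlim[OF K(1)[OF j0(1)]]]
      have "\<forall>\<^sub>F n in sequentially. False"
        using \<open>\<forall>\<^sub>F n in sequentially. gap_ratio (K j0 n) > of_rat L - \<epsilon>\<close>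
        by eventually_elim simp
      thus False by simp
    qed
  qed
  ultimately show ?thesis by blast
qed

end

section \<open>Cyclotomic polynomials\<close>

lemma clear_denominators:
  obtains a :: int and p :: "int poly"
  where "a > 0" "map_poly of_int p = smult (of_int a :: rat) P"
proof -
  have "\<exists>a :: int. \<exists>p. a > 0 \<and> map_poly of_int p = smult (of_int a) P"
  proof (induction P)
    case 0
    show ?case by (intro exI[of _ 1] exI[of _ 0]) simp
  next
    case (pCons c P)
    then obtain a p where ap: "a > 0" "map_poly of_int p = smult (of_int a) P" by blast
    obtain m n where mn: "quotient_of c = (m, n)" by (cases "quotient_of c")
    hence n: "n > 0" and c: "c = of_int m / of_int n"
      using quotient_of_denom_pos quotient_of_div by blast+
    have "map_poly of_int (pCons (a * m) (smult n p)) = smult (of_int (a * n)) (pCons c P)"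
      using n ap(2) c by (simp add: map_poly_pCons map_poly_smult mult.commute)
    thus ?case using ap(1) n by (intro exI[of _ "a * n"] exI) auto
  qed
  thus ?thesis using that by blast
qed

lemma map_poly_of_int_mult:
  "(map_poly of_int (p * q) :: 'a :: field_char_0 poly) = map_poly of_int p * map_poly of_int q"
  by (intro poly_eqI) (simp add: coeff_map_poly coeff_mult of_int_sum of_int_mult)

lemma map_poly_of_int_eq_iff:
  "(map_poly of_int p :: 'a :: field_char_0 poly) = map_poly of_int q \<longleftrightarrow> p = q"
  by (auto simp: poly_eq_iff coeff_map_poly)

lemma map_poly_of_int_pcompose:
  "(map_poly of_int (pcompose p q) :: 'a :: field_char_0 poly) =
     pcompose (map_poly of_int p) (map_poly of_int q)"
proof -
  have add: "(map_poly of_int (p + q) :: 'a poly) = map_poly of_int p + map_poly of_int q" for p q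
    by (intro poly_eqI) (simp add: coeff_map_poly)
  show ?thesis
    by (induction p) (simp_all add: pcompose_pCons map_poly_pCons add map_poly_of_int_mult)
qed

lemma degree_map_poly_of_int [simp]:
  "degree (map_poly of_int p :: 'a :: field_char_0 poly) = degree p"
  by (rule degree_map_poly) auto

text \<open>Gauss's lemma. With denominators cleared by \<open>a\<close> and \<open>b\<close>, the
  contents of \<open>p\<close> and \<open>q\<close> divide the leading coefficients \<open>a\<close>
  and \<open>b\<close>, while their product is \<open>a * b\<close> since the monic \<open>R\<close>
  is primitive. So \<open>content p = a\<close>, and \<open>p\<close> can be divided by
  \<open>a\<close>.\<close>

lemma monic_factor_integral:
  fixes P Q :: "rat poly" and R :: "int poly"
  assumes eq: "P * Q = map_poly of_int R" and monic: "lead_coeff P = 1" "lead_coeff Q = 1"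
  obtains p where "P = map_poly of_int p" "lead_coeff p = 1"
proof -
  obtain a p where p: "a > 0" "map_poly of_int p = smult (of_int a :: rat) P" by (rule clear_denominators)
  obtain b q where q: "b > 0" "map_poly of_int q = smult (of_int b :: rat) Q" by (rule clear_denominators)
  have "degree p = degree P" "degree q = degree Q"
    using p q degree_map_poly_of_int[of p, where 'a = rat] degree_map_poly_of_int[of q, where 'a = rat]
    by auto
  moreover have "coeff (map_poly of_int p :: rat poly) (degree P) = of_int a"
    "coeff (map_poly of_int q :: rat poly) (degree Q) = of_int b"
    unfolding p(2) q(2) using monic by auto
  ultimately have lc: "lead_coeff p = a" "lead_coeff q = b" by (simp_all add: coeff_map_poly)
  have "map_poly of_int (p * q) = (map_poly of_int (smult (a * b) R) :: rat poly)"
    by (simp add: map_poly_of_int_mult p q map_poly_smult mult.commute flip: eq)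
  hence pq: "p * q = smult (a * b) R" by (simp only: map_poly_of_int_eq_iff)
  have "lead_coeff (p * q) = a * b" using lc by (simp add: lead_coeff_mult)
  hence "lead_coeff R = 1" unfolding pq using p(1) q(1) by simp
  have c0: "content q \<ge> 0" for q :: "int poly"
    by (metis abs_ge_zero normalize_content normalize_int_def)
  from \<open>lead_coeff R = 1\<close> have "content R dvd 1" by (metis content_dvd_coeff)
  hence "content R = 1" using c0[of R] by simp
  hence cont: "content p * content q = a * b"
    using arg_cong[OF pq, of content] p(1) q(1) by (simp add: content_mult)
  have "content p dvd a" "content q dvd b" using lc content_dvd_coeff by metis+
  hence le: "content p \<le> a" "content q \<le> b" using p(1) q(1) by (auto intro: zdvd_imp_le)
  have "content p = a"
  proof (rule ccontr)
    assume "content p \<noteq> a"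
    hence "content p * content q < a * b" using le c0[of p] c0[of q] p(1) q(1)
      by (smt (verit, best) mult_left_mono mult_strict_right_mono)
    thus False using cont by simp
  qed
  then obtain p' where p': "p = smult a p'" by (metis content_times_primitive_part)
  have "smult (of_int a) (map_poly of_int p') = smult (of_int a :: rat) P"
    using p(2) unfolding p' by (simp add: map_poly_smult)
  hence "P = map_poly of_int p'" using p(1) by (metis of_int_eq_0_iff order_less_irrefl smult_cancel)
  moreover have "lead_coeff p' = 1" using lc(1) p(1) unfolding p' by simp
  ultimately show ?thesis by (rule that)
qed

text \<open>Stated as a divisibility in a commutative ring because it is needed both for integers,
  where it yields Fermat's theorem, and for integer polynomials.\<close>

lemma prime_dvd_add_power_diff:
  fixes x y :: "'a :: comm_ring_1"
  assumes "prime p"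
  shows "of_nat p dvd (x + y) ^ p - x ^ p - y ^ p"
proof -
  have p: "p > 1" using assms by (rule prime_gt_1_nat)
  have "{..p} = insert 0 (insert p {1..<p})" using p by auto
  moreover have "0 \<notin> insert p {1..<p}" "p \<notin> {1..<p}" using p by auto
  ultimately have "(x + y) ^ p = y ^ p + (x ^ p + (\<Sum>k\<in>{1..<p}. of_nat (p choose k) * x ^ k * y ^ (p - k)))"
    by (simp add: binomial_ring)
  hence "(x + y) ^ p - x ^ p - y ^ p = (\<Sum>k\<in>{1..<p}. of_nat (p choose k) * x ^ k * y ^ (p - k))"
    by simp
  also have "of_nat p dvd \<dots>"
  proof (intro dvd_sum dvd_mult2)
    fix k assume "k \<in> {1..<p}"
    hence "p dvd p choose k" using assms by (intro dvd_choose_prime) auto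
    then obtain c where "p choose k = p * c" by (elim dvdE)
    thus "of_nat p dvd (of_nat (p choose k) :: 'a)" by simp
  qed
  finally show ?thesis .
qed

lemma prime_dvd_power_diff_int:
  fixes a :: int
  assumes "prime p"
  shows "int p dvd a ^ p - a"
proof (induction a rule: int_induct[of _ 0])
  case (step1 i)
  have "int p dvd ((i + 1) ^ p - i ^ p - 1 ^ p) + (i ^ p - i)"
    by (rule dvd_add[OF prime_dvd_add_power_diff[OF assms, of i 1, unfolded of_nat_id] step1(2)])
  thus ?case by (simp add: algebra_simps)
next
  case (step2 i)
  have "int p dvd (i ^ p - i) - (((i - 1) + 1) ^ p - (i - 1) ^ p - 1 ^ p)"
    by (rule dvd_diff[OF step2(2) prime_dvd_add_power_diff[OF assms, of "i - 1" 1]])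
  thus ?case by (simp add: algebra_simps)
qed (use prime_gt_0_nat[OF assms] in \<open>simp add: power_0_left\<close>)

text \<open>The Frobenius congruence, by induction on the coefficients: each coefficient contributes
  Fermat's theorem and each addition the binomial congruence.\<close>

lemma prime_dvd_pcompose_diff:
  fixes g :: "int poly"
  assumes "prime p"
  shows "of_nat p dvd pcompose g (monom 1 p) - g ^ p"
proof (induction g)
  case 0
  show ?case using prime_gt_0_nat[OF assms] by (simp add: power_0_left)
next
  case (pCons a g)
  define X where "X = (monom 1 1 :: int poly)"
  have Xp: "X ^ p = monom 1 p" by (simp add: X_def monom_power)
  have eq: "pCons a g = [:a:] + X * g" by (simp add: X_def monom_Suc monom_0)
  have "int p dvd a ^ p - a" by (rule prime_dvd_power_diff_int[OF assms])
  hence 1: "of_nat p dvd [:a:] ^ p - [:a:]"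
    by (auto simp: poly_const_pow of_nat_poly elim!: dvdE)
  have 2: "of_nat p dvd X ^ p * (pcompose g (monom 1 p) - g ^ p)" using pCons.IH by (rule dvd_mult)
  have 3: "of_nat p dvd ([:a:] + X * g) ^ p - [:a:] ^ p - (X * g) ^ p"
    by (rule prime_dvd_add_power_diff[OF assms])
  have "of_nat p dvd X ^ p * (pcompose g (monom 1 p) - g ^ p) - ([:a:] ^ p - [:a:])
      - (([:a:] + X * g) ^ p - [:a:] ^ p - (X * g) ^ p)"
    by (rule dvd_diff[OF dvd_diff[OF 2 1] 3])
  also have "\<dots> = ([:a:] + X ^ p * pcompose g (monom 1 p)) - ([:a:] + X * g) ^ p"
    by (simp add: power_mult_distrib algebra_simps)
  also have "[:a:] + X ^ p * pcompose g (monom 1 p) = pcompose (pCons a g) (monom 1 p)"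
    by (simp add: pcompose_pCons Xp)
  also have "[:a:] + X * g = pCons a g" by (rule eq[symmetric])
  finally show ?case .
qed


lemma poly_cx_monom_minus_1 [simp]: "poly_cx (monom 1 n - 1) x = x ^ n - 1"
proof -
  have "map_poly of_rat (monom 1 n - 1) = (monom 1 n - 1 :: complex poly)"
    by (intro poly_eqI) (simp add: coeff_map_poly of_rat_diff)
  thus ?thesis by (simp add: poly_monom)
qed

lemma lead_coeff_monom_minus_1:
  "n \<ge> 1 \<Longrightarrow> lead_coeff (monom 1 n - 1 :: 'a :: comm_ring_1 poly) = 1"
  "n \<ge> 1 \<Longrightarrow> (monom 1 n - 1 :: 'a poly) \<noteq> 0"
proof -
  assume n: "n \<ge> 1"
  have "degree (monom 1 n - 1 :: 'a poly) = n"
    using n by (intro antisym le_degree degree_diff_le) (auto simp: degree_monom_le)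
  thus "lead_coeff (monom 1 n - 1 :: 'a poly) = 1" using n by simp
  thus "(monom 1 n - 1 :: 'a poly) \<noteq> 0" by (metis coeff_0 zero_neq_one)
qed

text \<open>
  If \<open>x\<^sup>p\<close> had another minimal polynomial \<open>g\<close> than \<open>x\<close>, with minimal polynomial \<open>f\<close>, then
  \<open>z\<^sup>n - 1 = f g h\<close> and the derivative of this identity puts \<open>n\<close> into the ideal \<open>(f, g)\<close> of
  \<open>\<int>[z]\<close>. As \<open>f\<close> divides \<open>g(z\<^sup>p) \<equiv> g\<^sup>p\<close> modulo \<open>p\<close>, this forces \<open>p\<close> to divide \<open>n\<^sup>p\<close>.
\<close>

lemma minimal_polynomial_root_power:
  assumes P: "irreducible P" "lead_coeff P = 1" "poly_cx P x = 0" and n: "n \<ge> 1" "x ^ n = 1"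
    and p: "prime p" "\<not> p dvd n"
  shows "poly_cx P (x ^ p) = 0"
proof (rule ccontr)
  assume neq: "poly_cx P (x ^ p) \<noteq> 0"
  define Z where "Z = (monom 1 n - 1 :: rat poly)"
  have Z: "Z \<noteq> 0" "lead_coeff Z = 1" unfolding Z_def using lead_coeff_monom_minus_1[OF n(1)] by auto
  have Zx: "poly_cx Z x = 0" "poly_cx Z (x ^ p) = 0" unfolding Z_def
    using n by (simp_all flip: power_mult add: mult.commute[of p]) (simp add: power_mult)
  obtain Q where Q: "irreducible Q" "poly_cx Q (x ^ p) = 0" "Q dvd Z" "lead_coeff Q = 1"
    using minimal_polynomial[OF Z(1) Zx(2)] .
  have PZ: "P dvd Z" using irreducible_dvd_iff_root[OF P(1,3)] Zx(1) by blast
  have "\<not> Q dvd P" using poly_cx_dvd[OF _ Q(2)] neq by blast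
  hence "coprime Q P" using Q(1) by (simp add: irreducible_imp_prime_elem prime_elem_imp_coprime)
  hence "P * Q dvd Z" using PZ Q(3) by (simp add: divides_mult coprime_commute)
  then obtain H where H: "Z = P * Q * H" by blast
  have lcH: "lead_coeff H = 1" using Z(2) P(2) Q(4) unfolding H by (simp add: lead_coeff_mult)
  define Zi where "Zi = (monom 1 n - 1 :: int poly)"
  have Zi: "map_poly of_int Zi = Z" unfolding Z_def Zi_def
    by (intro poly_eqI) (simp add: coeff_map_poly)
  obtain f where f: "P = map_poly of_int f" "lead_coeff f = 1"
    using monic_factor_integral[of P "Q * H" Zi] P(2) Q(4) lcH Zi H by (auto simp: lead_coeff_mult mult.assoc)
  obtain g where g: "Q = map_poly of_int g" "lead_coeff g = 1"
    using monic_factor_integral[of Q "P * H" Zi] P(2) Q(4) lcH Zi H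
    by (auto simp: lead_coeff_mult mult_ac)
  obtain h where h: "H = map_poly of_int h" "lead_coeff h = 1"
    using monic_factor_integral[of H "P * Q" Zi] P(2) Q(4) lcH Zi H
    by (auto simp: lead_coeff_mult mult_ac)
  have "map_poly of_int (f * g * h) = (map_poly of_int Zi :: rat poly)"
    using H Zi by (simp add: map_poly_of_int_mult f g h)
  hence fgh: "f * g * h = Zi" by (simp only: map_poly_of_int_eq_iff)
  define X where "X = (monom 1 1 :: int poly)"
  \<comment> \<open>Multiplication by \<open>X\<close> after differentiation reproduces
    \<open>z ^ n\<close> up to the factor \<open>n\<close>, so \<open>n\<close> itself, and not a
    multiple by a power of \<open>z\<close>, becomes a combination of \<open>f\<close> and
    \<open>g\<close>.\<close>
  have "X * pderiv Zi = of_nat n * (Zi + 1)"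
    using n(1) by (simp add: X_def Zi_def pderiv_diff pderiv_monom mult_monom of_nat_poly)
       (simp add: smult_monom)
  define V where "V = X * pderiv f * h"
  define U where "U = X * pderiv g * h + X * g * pderiv h - of_nat n * g * h"
  have bez: "of_nat n = f * U + g * V"
  proof -
    have "X * pderiv (f * g * h) = of_nat n * (f * g * h + 1)"
      unfolding fgh by fact
    thus ?thesis unfolding U_def V_def by (simp add: pderiv_mult algebra_simps)
  qed
  obtain r where r: "pcompose g (monom 1 p) - g ^ p = of_nat p * r"
    using prime_dvd_pcompose_diff[OF p(1), of g] by blast
  have "P dvd poly_compose_power Q p"
    using irreducible_dvd_iff_root[OF P(1,3)] Q(2) by simp
  then obtain K where K: "P * K = poly_compose_power Q p" by (metis dvdE)
  have pp: "p > 0" using prime_gt_0_nat[OF p(1)] .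
  have "lead_coeff (poly_compose_power Q p) = 1"
  proof -
    have "lead_coeff (pcompose Q (monom 1 p)) = lead_coeff Q * lead_coeff (monom 1 p :: rat poly) ^ degree Q"
      by (rule lead_coeff_comp) (use pp in \<open>simp add: degree_monom_eq\<close>)
    thus ?thesis using Q(4) by (simp add: degree_monom_eq)
  qed
  hence lcK: "lead_coeff K = 1" using P(2) unfolding K[symmetric] by (simp add: lead_coeff_mult)
  have gc: "map_poly of_int (pcompose g (monom 1 p)) = poly_compose_power Q p"
    by (simp add: map_poly_of_int_pcompose g map_poly_monom)
  obtain k where k: "K = map_poly of_int k"
    using monic_factor_integral[of K P "pcompose g (monom 1 p)"] lcK P(2) K gc by (metis mult.commute)
  have "map_poly of_int (f * k) = (map_poly of_int (pcompose g (monom 1 p)) :: rat poly)"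
    using K gc by (simp add: map_poly_of_int_mult f k)
  hence fk: "f * k = pcompose g (monom 1 p)" by (simp only: map_poly_of_int_eq_iff)
  \<comment> \<open>Modulo \<open>f\<close> one has \<open>n = g * V\<close>, hence
    \<open>n ^ p = g ^ p * V ^ p\<close>; here \<open>g ^ p\<close> may be replaced by the multiple
    \<open>f * k\<close> of \<open>f\<close> at the cost of a multiple of \<open>p\<close>.\<close>
  have "f dvd of_nat n - g * V" unfolding bez by simp
  hence "f dvd of_nat n ^ p - (g * V) ^ p"
    unfolding power_diff_sumr2 by (rule dvd_mult2)
  moreover have "f dvd (f * k) * V ^ p" by simp
  ultimately have "f dvd (of_nat n ^ p - (g * V) ^ p) + (f * k) * V ^ p" by (rule dvd_add)
  also have "\<dots> = of_nat n ^ p + (pcompose g (monom 1 p) - g ^ p) * V ^ p"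
    by (simp add: fk power_mult_distrib algebra_simps)
  also have "\<dots> = [:int n ^ p:] + smult (int p) (r * V ^ p)"
    unfolding r by (simp add: of_nat_poly poly_const_pow)
  finally have dvd1: "f dvd [:int n ^ p:] + smult (int p) (r * V ^ p)" .
  \<comment> \<open>For monic \<open>f\<close> pseudo-division is division with remainder over the
    integers. Once the cofactor of \<open>p\<close> is reduced modulo \<open>f\<close>, a multiple
    of \<open>f\<close> of smaller degree is left, which must be zero.\<close>
  obtain q s where qs: "pseudo_divmod (r * V ^ p) f = (q, s)" by (cases "pseudo_divmod (r * V ^ p) f")
  have f0: "f \<noteq> 0" using f(2) by auto
  from pseudo_divmod[OF f0 qs] f(2) have red: "r * V ^ p = f * q + s" and s: "s = 0 \<or> degree s < degree f"
    by auto
  have "f dvd ([:int n ^ p:] + smult (int p) (r * V ^ p)) - f * smult (int p) q"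
    using dvd1 by (rule dvd_diff) (simp only: mult_smult_right[symmetric] dvd_triv_left)
  hence dvd2: "f dvd [:int n ^ p:] + smult (int p) s" unfolding red by (simp add: smult_add_right)
  have degf: "degree f > 0"
  proof (rule ccontr)
    assume "\<not> degree f > 0"
    hence "degree P = 0" unfolding f(1) by simp
    moreover have "P \<noteq> 0" using P(2) by auto
    ultimately have "P dvd 1" by (simp add: is_unit_iff_degree)
    thus False using P(1) by (simp add: irreducible_def)
  qed
  have "degree ([:int n ^ p:] + smult (int p) s) < degree f"
    using s degf by (intro degree_add_less) (auto intro: le_less_trans[OF degree_smult_le])
  hence "[:int n ^ p:] + smult (int p) s = 0" using dvd2 by (metis dvd_imp_degree_le not_less)
  hence "coeff ([:int n ^ p:] + smult (int p) s) 0 = 0" by simp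
  hence "int n ^ p = int p * - coeff s 0" by simp
  hence "int p dvd int n ^ p" by (metis dvd_triv_left)
  hence "p dvd n ^ p" by (simp flip: of_nat_power)
  thus False using p by (meson prime_dvd_power)
qed

lemma primitive_root_power_eq_1_iff:
  assumes "primitive_root_of_unity n x"
  shows "x ^ k = 1 \<longleftrightarrow> n dvd k"
proof
  have n: "n \<ge> 1" "x ^ n = 1" and min: "\<And>k. 0 < k \<Longrightarrow> k < n \<Longrightarrow> x ^ k \<noteq> 1"
    using assms by (auto simp: primitive_root_of_unity_def)
  {
    assume k: "x ^ k = 1"
    have "x ^ k = x ^ (n * (k div n) + k mod n)" by simp
    also have "\<dots> = x ^ (k mod n)" unfolding power_add power_mult n(2) by simp
    finally have "x ^ (k mod n) = 1" using k by simp
    hence "k mod n = 0" using min[of "k mod n"] n(1) by (metis mod_less_divisor neq0_conv less_le_trans zero_less_one)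
    thus "n dvd k" by auto
  }
  assume "n dvd k"
  thus "x ^ k = 1" using n(2) by (auto simp: power_mult)
qed

lemma primitive_root_of_unity_iff:
  "primitive_root_of_unity n x \<longleftrightarrow> n \<ge> 1 \<and> (\<forall>k. x ^ k = 1 \<longleftrightarrow> n dvd k)"
proof
  assume n: "n \<ge> 1 \<and> (\<forall>k. x ^ k = 1 \<longleftrightarrow> n dvd k)"
  hence iff: "x ^ k = 1 \<longleftrightarrow> n dvd k" for k by (elim conjE allE)
  have "x ^ n = 1" unfolding iff by (rule dvd_refl)
  moreover have "x ^ k \<noteq> 1" if "0 < k" "k < n" for k
    unfolding iff by (rule nat_dvd_not_less[OF that])
  ultimately show "primitive_root_of_unity n x"
    using n unfolding primitive_root_of_unity_def by simp
next
  assume x: "primitive_root_of_unity n x"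
  show "n \<ge> 1 \<and> (\<forall>k. x ^ k = 1 \<longleftrightarrow> n dvd k)"
    using primitive_root_power_eq_1_iff[OF x] x[unfolded primitive_root_of_unity_def] by simp
qed

text \<open>The polynomial is the minimal polynomial of \<open>exp (2 * pi * i / n)\<close>.
  Conjugates satisfy the same equations \<open>x ^ k = 1\<close>, so all its roots are primitive;
  every primitive root is reached by raising to one prime factor of the exponent at a time. As
  \<open>cyclotomic_poly\<close> is a definite description, existence must precede any use of
  it.\<close>

lemma cyclotomic_exists:
  assumes n: "n \<ge> 1"
  shows "\<exists>P. is_cyclotomic P \<and> {x. poly_cx P x = 0} = {x. primitive_root_of_unity n x}"
proof -
  define \<zeta> where "\<zeta> = exp (2 * of_real pi * \<i> / of_nat n)"
  have zp: "\<zeta> ^ k = exp (2 * of_real pi * \<i> * of_nat k / of_nat n)" for k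
    unfolding \<zeta>_def exp_of_nat_mult[symmetric] by (rule arg_cong[where f = exp]) simp
  have prim: "primitive_root_of_unity n \<zeta>"
    unfolding primitive_root_of_unity_iff zp using n complex_root_unity_eq_1[OF n] by blast
  have \<zeta>1: "\<zeta> ^ n = 1" using primitive_root_power_eq_1_iff[OF prim, of n] by simp
  obtain P where P: "irreducible P" "poly_cx P \<zeta> = 0" "P dvd monom 1 n - 1" "lead_coeff P = 1"
  proof (rule minimal_polynomial)
    show "monom 1 n - 1 \<noteq> (0 :: rat poly)" by (rule lead_coeff_monom_minus_1(2)[OF n])
    show "poly_cx (monom 1 n - 1) \<zeta> = 0" using \<zeta>1 by simp
  qed
  have pow: "poly_cx P (\<zeta> ^ j) = 0" if "coprime j n" for j
    using that
  proof (induction j rule: prime_divisors_induct)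
    case zero
    hence "n = 1" by simp
    thus ?case using P(2) \<zeta>1 by simp
  next
    case (unit j)
    thus ?case using P(2) by simp
  next
    case (factor p j)
    have p: "prime p" "coprime p n" "coprime j n" using factor by (auto simp: coprime_mult_left_iff)
    have "\<not> p dvd n" using p(1,2) by (metis coprime_absorb_left not_prime_unit)
    have "(\<zeta> ^ j) ^ n = 1" using \<zeta>1 by (metis power_commuting_commutes power_mult mult.commute power_one)
    from minimal_polynomial_root_power[OF P(1,4) factor.IH[OF p(3)] n this p(1) \<open>\<not> p dvd n\<close>]
    show ?case by (simp add: mult.commute flip: power_mult)
  qed
  have "poly_cx P x = 0 \<longleftrightarrow> primitive_root_of_unity n x" for x
  proof
    assume x: "poly_cx P x = 0"
    have "x ^ k = 1 \<longleftrightarrow> n dvd k" for k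
    proof -
      have "x ^ k = 1 \<longleftrightarrow> P dvd monom 1 k - 1"
        using irreducible_dvd_iff_root[OF P(1) x, of "monom 1 k - 1"] by simp
      also have "\<dots> \<longleftrightarrow> \<zeta> ^ k = 1"
        using irreducible_dvd_iff_root[OF P(1,2), of "monom 1 k - 1"] by simp
      finally show ?thesis using primitive_root_power_eq_1_iff[OF prim] by simp
    qed
    thus "primitive_root_of_unity n x" using n by (simp add: primitive_root_of_unity_iff)
  next
    assume x: "primitive_root_of_unity n x"
    hence "x ^ n = 1" by (simp add: primitive_root_of_unity_def)
    then obtain j where j: "x = \<zeta> ^ j"
      using complex_roots_unity[OF n] unfolding zp by blast
    \<comment> \<open>A common factor \<open>g\<close> of \<open>j\<close> and \<open>n\<close>
      makes the order of \<open>x\<close> divide \<open>n div g\<close>, which leaves only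
      \<open>g = 1\<close>.\<close>
    define g where "g = gcd j n"
    have g: "g > 0" "g dvd n" "g dvd j" using n by (auto simp: g_def)
    have "x ^ (n div g) = \<zeta> ^ (n * (j div g))"
      unfolding j using g by (simp add: div_mult_swap mult.commute flip: power_mult)
    hence "x ^ (n div g) = 1" by (simp add: power_mult \<zeta>1)
    hence "n dvd n div g" using primitive_root_power_eq_1_iff[OF x] by simp
    obtain m where m: "n = g * m" using g(2) by (elim dvdE)
    hence "g * m dvd 1 * m" "m > 0" using \<open>n dvd n div g\<close> g(1) n by (auto intro: gr0I)
    hence "g = 1" by (simp only: dvd_mult_cancel2 nat_dvd_1_iff_1 dvd_times_right_cancel_iff)
    thus "poly_cx P x = 0" using pow[of j] unfolding j by (simp add: g_def coprime_iff_gcd_eq_1)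
  qed
  thus ?thesis using P n unfolding is_cyclotomic_def by blast
qed

lemma monic_irreducible_unique:
  assumes "irreducible P" "irreducible Q" "lead_coeff P = 1" "lead_coeff Q = 1"
    and "poly_cx P x = 0" "poly_cx Q x = 0"
  shows "P = Q"
proof -
  have dvd: "P dvd Q" "Q dvd P" using assms irreducible_dvd_iff_root by blast+
  obtain c where c: "Q = P * c" using dvd(1) by (elim dvdE)
  have nz: "P \<noteq> 0" "Q \<noteq> 0" using assms(3,4) by auto
  have "degree P = degree Q" using dvd nz by (intro antisym dvd_imp_degree_le)
  hence "degree c = 0" using nz by (auto simp: c degree_mult_eq)
  moreover have "lead_coeff c = 1" using assms(3,4) by (simp add: c lead_coeff_mult)
  ultimately have "c = 1" by (metis degree_0_id one_pCons)
  thus ?thesis by (simp add: c)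
qed

lemma cyclotomic_poly:
  assumes "n \<ge> 1"
  shows "is_cyclotomic (cyclotomic_poly n)"
    and "poly_cx (cyclotomic_poly n) x = 0 \<longleftrightarrow> primitive_root_of_unity n x"
proof -
  obtain P where P: "is_cyclotomic P" "{x. poly_cx P x = 0} = {x. primitive_root_of_unity n x}"
    using cyclotomic_exists[OF assms] by blast
  have "P \<noteq> 0" "degree P \<noteq> 0" using P(1) unfolding is_cyclotomic_def
    by (auto simp: irreducible_def is_unit_iff_degree)
  hence "degree (map_poly of_rat P :: complex poly) \<noteq> 0" by simp
  hence "\<exists>x. poly_cx P x = 0"
    by (intro fundamental_theorem_of_algebra) (simp add: constant_degree)
  then obtain x0 where x0: "poly_cx P x0 = 0" by blast
  have uniq: "Q = P" if "is_cyclotomic Q" "{x. poly_cx Q x = 0} = {x. primitive_root_of_unity n x}" for Q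
  proof -
    have "poly_cx Q x0 = 0" using x0 that(2) P(2) by blast
    thus ?thesis using that(1) P(1) x0 monic_irreducible_unique unfolding is_cyclotomic_def by blast
  qed
  have "is_cyclotomic (cyclotomic_poly n) \<and>
      {x. poly_cx (cyclotomic_poly n) x = 0} = {x. primitive_root_of_unity n x}"
    unfolding cyclotomic_poly_def by (rule theI[of _ P]) (use P uniq in blast)+
  thus "is_cyclotomic (cyclotomic_poly n)"
    "poly_cx (cyclotomic_poly n) x = 0 \<longleftrightarrow> primitive_root_of_unity n x" by auto
qed

text \<open>In characteristic zero an irreducible polynomial cannot divide its derivative, which is
  nonzero of smaller degree.\<close>

lemma order_irreducible_root:
  assumes P: "irreducible P" and w: "poly_cx P w = 0"
  shows "order w (map_poly of_rat P :: complex poly) = 1"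
proof -
  have nz: "P \<noteq> 0" using P by auto
  hence degP: "degree P > 0" using P by (auto simp: irreducible_def is_unit_iff_degree)
  have "poly_cx (pderiv P) w \<noteq> 0"
  proof
    assume "poly_cx (pderiv P) w = 0"
    hence "P dvd pderiv P" using irreducible_dvd_iff_root[OF P w] by blast
    moreover have "pderiv P \<noteq> 0" using degP by (simp add: pderiv_eq_0_iff)
    ultimately have "degree P \<le> degree (pderiv P)" by (rule dvd_imp_degree_le)
    thus False using degP by (simp add: degree_pderiv)
  qed
  moreover have "map_poly of_rat (pderiv P) = (pderiv (map_poly of_rat P) :: complex poly)"
    by (intro poly_eqI) (simp add: coeff_map_poly coeff_pderiv of_rat_mult of_rat_add)
  ultimately have "poly (pderiv (map_poly of_rat P)) w \<noteq> 0" by simp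
  hence "order w (pderiv (map_poly of_rat P)) = 0" by (rule order_0I)
  thus ?thesis using order_pderiv[of "map_poly of_rat P :: complex poly" w] nz w by simp
qed

text \<open>Both orders equal the multiplicity of the cyclotomic polynomial in \<open>q\<close>: it
  has \<open>x\<close> and \<open>y\<close> as simple roots and divides every rational polynomial
  vanishing at either. This closes the recurrences for orders at roots of unity.\<close>

lemma order_primitive_root_eq:
  assumes q: "q \<noteq> 0" and x: "primitive_root_of_unity n x" and y: "primitive_root_of_unity n y"
  shows "order x (map_poly of_rat q :: complex poly) = order y (map_poly of_rat q)"
proof -
  have n: "n \<ge> 1" using x by (simp add: primitive_root_of_unity_def)
  define P where "P = cyclotomic_poly n"
  have P: "irreducible P" "poly_cx P x = 0" "poly_cx P y = 0"
    using cyclotomic_poly[OF n] x y unfolding P_def is_cyclotomic_def by auto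
  have le: "order u (map_poly of_rat q :: complex poly) \<le> order v (map_poly of_rat q)"
    if "poly_cx P u = 0" "poly_cx P v = 0" for u v
    using q
  proof (induction "degree q" arbitrary: q rule: less_induct)
    case less
    show ?case
    proof (cases "poly_cx q u = 0")
      case False
      thus ?thesis by (simp add: order_0I)
    next
      case True
      hence "P dvd q" using irreducible_dvd_iff_root[OF P(1) that(1)] by blast
      then obtain r where r: "q = P * r" by blast
      have nz: "P \<noteq> 0" "r \<noteq> 0" using less.prems r by auto
      have degP: "degree P > 0" using P(1) nz by (auto simp: irreducible_def is_unit_iff_degree)
      have "order w (map_poly of_rat q :: complex poly) = 1 + order w (map_poly of_rat r)"
        if "poly_cx P w = 0" for w
        unfolding r map_poly_of_rat_mult using nz order_irreducible_root[OF P(1) that] by (subst order_mult) auto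
      moreover have "degree r < degree q" using nz degP by (simp add: r degree_mult_eq)
      ultimately show ?thesis using less.hyps[OF _ nz(2)] that by simp
    qed
  qed
  show ?thesis using le[OF P(2,3)] le[OF P(3,2)] by simp
qed

section \<open>Normalisation\<close>

lemma order_prod:
  assumes "finite I" "\<And>i. i \<in> I \<Longrightarrow> p i \<noteq> (0 :: 'a :: idom poly)"
  shows "order x (prod p I) = (\<Sum>i\<in>I. order x (p i))"
  using assms by (induction I rule: finite_induct) (auto simp: order_mult)

lemma map_poly_of_rat_prod:
  "(map_poly of_rat (prod p I) :: 'a :: field_char_0 poly) = (\<Prod>i\<in>I. map_poly of_rat (p i))"
  by (induction I rule: infinite_finite_induct) (simp_all add: map_poly_of_rat_mult)

lemma rat_poly_eqI_order:
  assumes "lead_coeff p = 1" "lead_coeff q = 1"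
    and "\<And>x :: complex. order x (map_poly of_rat p) = order x (map_poly of_rat q)"
  shows "p = q"
proof -
  define P where "P = (map_poly of_rat p :: complex poly)"
  define Q where "Q = (map_poly of_rat q :: complex poly)"
  have nz: "P \<noteq> 0" "Q \<noteq> 0" unfolding P_def Q_def using assms by auto
  have lc: "lead_coeff P = 1" "lead_coeff Q = 1"
    unfolding P_def Q_def using assms by (simp_all add: coeff_map_poly)
  have ord: "order x P = order x Q" for x unfolding P_def Q_def by (rule assms(3))
  have "poly P x = 0 \<longleftrightarrow> poly Q x = 0" for x
    using ord[of x] nz by (simp add: order_root)
  hence "P = Q"
    using complex_poly_decompose[of P] complex_poly_decompose[of Q] lc ord by simp
  hence "map_poly of_rat (p - q) = (0 :: complex poly)"
    by (intro poly_eqI) (simp add: P_def Q_def coeff_map_poly poly_eq_iff of_rat_diff)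
  thus ?thesis by simp
qed

lemma root_of_unity_is_primitive:
  assumes "x ^ N = 1" "N \<ge> 1"
  obtains m where "primitive_root_of_unity m x"
proof -
  define m where "m = (LEAST m. m \<ge> 1 \<and> x ^ m = 1)"
  have "m \<ge> 1 \<and> x ^ m = 1" unfolding m_def by (rule LeastI[of _ N]) (use assms in simp)
  moreover have "x ^ k \<noteq> 1" if "0 < k" "k < m" for k
    using not_less_Least[of k "\<lambda>m. m \<ge> 1 \<and> x ^ m = 1"] that unfolding m_def by auto
  ultimately have "primitive_root_of_unity m x" unfolding primitive_root_of_unity_def by blast
  thus ?thesis by (rule that)
qed

lemma primitive_root_unique:
  assumes "primitive_root_of_unity m x" "primitive_root_of_unity n x"
  shows "m = n"
proof (rule dvd_antisym)
  have "x ^ n = 1" "x ^ m = 1" using assms unfolding primitive_root_of_unity_def by auto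
  thus "m dvd n" "n dvd m" using assms primitive_root_power_eq_1_iff by blast+
qed

lemma primitive_root_power_coprime_iff:
  assumes "coprime n d" "d \<ge> 1" "n \<ge> 1"
  shows "primitive_root_of_unity n (x ^ d) \<longleftrightarrow> (\<exists>r. r dvd d \<and> primitive_root_of_unity (r * n) x)"
proof
  assume "\<exists>r. r dvd d \<and> primitive_root_of_unity (r * n) x"
  then obtain r where r: "r dvd d" "primitive_root_of_unity (r * n) x" by blast
  then obtain e where e: "d = r * e" by (elim dvdE)
  have r0: "r > 0" using assms(2) e by (auto intro: gr0I)
  have "coprime n e" using assms(1) e by (simp add: coprime_mult_right_iff)
  have "(x ^ d) ^ k = 1 \<longleftrightarrow> n dvd k" for k
  proof -
    have "(x ^ d) ^ k = 1 \<longleftrightarrow> r * n dvd d * k"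
      using primitive_root_power_eq_1_iff[OF r(2)] by (simp flip: power_mult)
    also have "\<dots> \<longleftrightarrow> n dvd e * k" unfolding e mult.assoc using r0 by simp
    also have "\<dots> \<longleftrightarrow> n dvd k" using \<open>coprime n e\<close> by (rule coprime_dvd_mult_right_iff)
    finally show ?thesis .
  qed
  thus "primitive_root_of_unity n (x ^ d)" using assms(3) by (simp add: primitive_root_of_unity_iff)
next
  assume p: "primitive_root_of_unity n (x ^ d)"
  hence "(x ^ d) ^ n = 1" by (simp add: primitive_root_of_unity_def)
  hence x1: "x ^ (d * n) = 1" by (simp add: power_mult)
  moreover have "d * n \<ge> 1" using assms by simp
  ultimately obtain m where m: "primitive_root_of_unity m x" by (rule root_of_unity_is_primitive)
  have "x ^ m = 1" using m by (simp add: primitive_root_of_unity_def)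
  hence "(x ^ d) ^ m = 1" by (metis power_mult mult.commute power_one)
  hence "n dvd m" using primitive_root_power_eq_1_iff[OF p] by simp
  then obtain r where r: "m = r * n" by (metis dvdE mult.commute)
  have "r * n dvd d * n" using x1 primitive_root_power_eq_1_iff[OF m] r by simp
  hence "r dvd d" using assms(3) by simp
  thus "\<exists>r. r dvd d \<and> primitive_root_of_unity (r * n) x" using m r by blast
qed

lemma order_cyclotomic_poly:
  assumes "n \<ge> 1"
  shows "order x (map_poly of_rat (cyclotomic_poly n) :: complex poly) =
    (if primitive_root_of_unity n x then 1 else 0)"
  using order_irreducible_root[of "cyclotomic_poly n" x] cyclotomic_poly[OF assms]
  by (auto simp: is_cyclotomic_def intro: order_0I)

lemma lead_coeff_cyclotomic_poly: "n \<ge> 1 \<Longrightarrow> lead_coeff (cyclotomic_poly n) = 1"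
  using cyclotomic_poly(1) by (simp add: is_cyclotomic_def)

lemma cyclotomic_poly_nonzero: "n \<ge> 1 \<Longrightarrow> cyclotomic_poly n \<noteq> 0"
  using lead_coeff_cyclotomic_poly[of n] by auto

text \<open>Both sides are monic, so it suffices to compare orders at every complex point, and these
  are 1 or 0: on the right at most one \<open>r\<close> fits since a root of unity has only one
  order, on the left \<open>z ^ d\<close> is unramified away from zero.\<close>

lemma cyclotomic_poly_compose_power:
  assumes "coprime n d" "d \<ge> 1" "n \<ge> 1"
  shows "poly_compose_power (cyclotomic_poly n) d = (\<Prod>r\<in>{r. r dvd d}. cyclotomic_poly (r * n))"
proof (rule rat_poly_eqI_order)
  have "lead_coeff (poly_compose_power (cyclotomic_poly n) d) =
      lead_coeff (cyclotomic_poly n) * lead_coeff (monom 1 d :: rat poly) ^ degree (cyclotomic_poly n)"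
    by (rule lead_coeff_comp) (use assms in \<open>simp add: degree_monom_eq\<close>)
  thus "lead_coeff (poly_compose_power (cyclotomic_poly n) d) = 1"
    using assms lead_coeff_cyclotomic_poly[of n] by (simp add: degree_monom_eq)
  have fin: "finite {r. r dvd d}" using assms(2) by simp
  have pos: "r * n \<ge> 1" if "r dvd d" for r using that assms by (auto intro!: Suc_leI gr0I)
  have "lead_coeff (\<Prod>r\<in>I. cyclotomic_poly (r * n)) = 1" if "I \<subseteq> {r. r dvd d}" for I
    using finite_subset[OF that fin] that
    by (induction I rule: finite_induct) (auto simp: lead_coeff_mult lead_coeff_cyclotomic_poly[OF pos])
  thus "lead_coeff (\<Prod>r\<in>{r. r dvd d}. cyclotomic_poly (r * n)) = 1" by blast
  fix x :: complex
  have "order x (map_poly of_rat (\<Prod>r\<in>{r. r dvd d}. cyclotomic_poly (r * n))) =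
      (\<Sum>r\<in>{r. r dvd d}. order x (map_poly of_rat (cyclotomic_poly (r * n)) :: complex poly))"
    unfolding map_poly_of_rat_prod using fin
    by (intro order_prod) (auto simp: cyclotomic_poly_nonzero[OF pos])
  also have "\<dots> = (\<Sum>r\<in>{r. r dvd d}. if primitive_root_of_unity (r * n) x then 1 else 0)"
    by (intro sum.cong refl) (auto simp: order_cyclotomic_poly[OF pos])
  also have "\<dots> = card {r. r dvd d \<and> primitive_root_of_unity (r * n) x}"
    using fin by (simp add: sum.If_cases Int_def)
  also have "\<dots> = (if primitive_root_of_unity n (x ^ d) then 1 else 0)"
  proof (cases "primitive_root_of_unity n (x ^ d)")
    case True
    then obtain r where r: "r dvd d" "primitive_root_of_unity (r * n) x"
      using primitive_root_power_coprime_iff[OF assms] by blast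
    have "s = r" if "primitive_root_of_unity (s * n) x" for s
      using primitive_root_unique[OF that r(2)] assms(3) by simp
    hence "{r. r dvd d \<and> primitive_root_of_unity (r * n) x} = {r}" using r by blast
    thus ?thesis using True by simp
  next
    case False
    hence "{r. r dvd d \<and> primitive_root_of_unity (r * n) x} = {}"
      using primitive_root_power_coprime_iff[OF assms] by blast
    hence "card {r. r dvd d \<and> primitive_root_of_unity (r * n) x} = 0" by (simp only: card.empty)
    thus ?thesis using False by simp
  qed
  also have "\<dots> = order x (map_poly of_rat (poly_compose_power (cyclotomic_poly n) d) :: complex poly)"
  proof (cases "x = 0")
    case True
    have "\<not> primitive_root_of_unity n 0" by (auto simp: primitive_root_of_unity_def power_0_left)
    moreover have "poly_cx (poly_compose_power (cyclotomic_poly n) d) 0 \<noteq> 0"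
      using calculation cyclotomic_poly(2)[OF assms(3)] assms(2) by (simp add: power_0_left)
    ultimately show ?thesis using True assms(2) by (simp add: order_0I power_0_left)
  next
    case False
    have "order x (map_poly of_rat (poly_compose_power (cyclotomic_poly n) d) :: complex poly) =
        order (x ^ d) (map_poly of_rat (cyclotomic_poly n))"
      unfolding map_poly_of_rat_pcompose using False assms cyclotomic_poly_nonzero[OF assms(3)]
      by (simp add: order_compose_power)
    thus ?thesis using order_cyclotomic_poly[OF assms(3)] by simp
  qed
  finally show "order x (map_poly of_rat (poly_compose_power (cyclotomic_poly n) d)) =
      order x (map_poly of_rat (\<Prod>r\<in>{r. r dvd d}. cyclotomic_poly (r * n)))" ..
qed

lemma cyclotomic_poly_int_nonzero:
  assumes "n \<ge> 1" "\<bar>b :: int\<bar> \<ge> 2"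
  shows "poly (cyclotomic_poly n) (of_int b) \<noteq> 0"
proof
  assume "poly (cyclotomic_poly n) (of_int b) = 0"
  hence "poly_cx (cyclotomic_poly n) (of_rat (of_int b)) = 0" by (simp only: poly_of_rat_of_rat of_rat_0)
  hence "(of_int b :: complex) ^ n = 1"
    using cyclotomic_poly(2)[OF assms(1)] by (simp add: primitive_root_of_unity_def)
  hence "b ^ n = 1" by (simp flip: of_int_power)
  hence "\<bar>b\<bar> ^ n = 1" by (simp flip: power_abs)
  moreover have "\<bar>b\<bar> ^ n \<ge> \<bar>b\<bar> ^ 1" using assms by (intro power_increasing) auto
  ultimately show False using assms(2) by simp
qed

lemma mahler_equation_iff:
  assumes "B \<noteq> 0"
  shows "mahler_equation d f A B C \<longleftrightarrow>
    poly_to_fls B * f = poly_to_fls A * fls_compose_power f d + poly_to_fls C"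
  using assms by (auto simp: mahler_equation_def eq_divide_eq mult.commute)

text \<open>Collects what every normalisation step has to preserve for the later argument at
  \<open>b\<close>, so that the reflexive transitive closure can be treated by induction.\<close>

definition admissible :: "nat \<Rightarrow> int \<Rightarrow> mahler_data \<Rightarrow> bool" where
  "admissible d b = (\<lambda>(f, A, B, C). A \<noteq> 0 \<and> B \<noteq> 0 \<and> mahler_equation d f A B C \<and>
     \<not> is_rational_function f \<and> fls_converges f (of_int b) \<and>
     (\<forall>t. poly A (of_int b ^ d ^ t) * poly B (of_int b ^ d ^ t) \<noteq> 0))"

text \<open>Here \<open>W\<close> is the power \<open>z ^ N\<close>, nonzero at \<open>b\<close>.
  The new equation is checked after multiplication by the cancelled power \<open>z ^ m\<close>,
  which avoids dividing polynomials.\<close>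

lemma remove_powers_admissible:
  assumes rem: "remove_powers d D D'" and adm: "admissible d b D" and b: "\<bar>b\<bar> \<ge> 2" and d: "d > 0"
  shows "admissible d b D' \<and> (\<exists>W. poly W (of_int b) \<noteq> 0 \<and> fst D' = poly_to_fls W * fst D)"
  using rem
proof cases
  case (1 A m A' B N B' C C' f)
  define x where "x t = (of_int b ^ d ^ t :: rat)" for t
  have x0: "x t \<noteq> 0" for t using b by (auto simp: x_def)
  have A: "A \<noteq> 0" "B \<noteq> 0" "mahler_equation d f A B C" "\<not> is_rational_function f"
      "fls_converges f (of_int b)" "\<And>t. poly A (x t) * poly B (x t) \<noteq> 0"
    using adm 1 by (auto simp: admissible_def x_def)
  have nz: "A' \<noteq> 0" "B' \<noteq> 0" using A 1 by auto
  have "poly A' (x t) \<noteq> 0" "poly B' (x t) \<noteq> 0" for t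
  proof -
    show "poly A' (x t) \<noteq> 0" using A(6)[of t] by (simp add: 1(3))
    have "poly (B * monom 1 ((d - 1) * N)) (x t) \<noteq> 0" using A(6)[of t] x0 by (simp add: poly_monom)
    thus "poly B' (x t) \<noteq> 0" unfolding 1(5) by simp
  qed
  moreover have "mahler_equation d (poly_to_fls (monom 1 N) * f) A' B' C'"
  proof -
    define F where "F = fls_compose_power f d"
    have eq: "poly_to_fls B * f = poly_to_fls A * F + poly_to_fls C"
      using A(2,3) by (simp add: mahler_equation_iff F_def)
    have comp: "fls_compose_power (poly_to_fls (monom 1 N) * f) d = poly_to_fls (monom 1 (d * N)) * F"
    proof -
      have "poly_compose_power (monom 1 N :: rat poly) d = monom 1 (d * N)"
        by (induction N) (simp_all add: monom_0 monom_Suc pcompose_pCons mult_monom pcompose_1 flip: one_pCons)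
      thus ?thesis using d by (simp add: F_def poly_to_fls_compose_power[symmetric])
    qed
    have dN: "(d - 1) * N + N = d * N" using d by (cases d) auto
    have "poly_to_fls (monom 1 m) * (poly_to_fls B' * (poly_to_fls (monom 1 N) * f)) =
        poly_to_fls (B * monom 1 ((d - 1) * N)) * poly_to_fls (monom 1 N) * f"
      unfolding 1(5) by (simp add: poly_to_fls_mult mult_ac)
    also have "\<dots> = poly_to_fls (monom 1 (d * N)) * (poly_to_fls B * f)"
    proof -
      have "(monom 1 (d * N) :: rat poly) = monom 1 ((d - 1) * N) * monom 1 N"
        by (simp add: mult_monom flip: dN)
      thus ?thesis by (simp only: poly_to_fls_mult mult_ac)
    qed
    also have "\<dots> = poly_to_fls A * (poly_to_fls (monom 1 (d * N)) * F) + poly_to_fls (C * monom 1 (d * N))"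
      unfolding eq by (simp add: poly_to_fls_mult algebra_simps)
    also have "\<dots> = poly_to_fls (monom 1 m) * (poly_to_fls A' * (poly_to_fls (monom 1 (d * N)) * F) + poly_to_fls C')"
      unfolding 1(3) 1(6) by (simp add: poly_to_fls_mult algebra_simps)
    finally show ?thesis unfolding mahler_equation_iff[OF nz(2)] comp by simp
  qed
  ultimately show ?thesis using A nz 1 b unfolding admissible_def
    by (auto simp: x_def is_rational_function_mult_poly_iff fls_converges_mult poly_monom
        intro!: exI[of _ "monom 1 N"])
qed

lemma remove_cyclotomic_admissible:
  assumes rem: "remove_cyclotomic d D D'" and adm: "admissible d b D" and b: "\<bar>b\<bar> \<ge> 2" and d: "d \<ge> 2"
  shows "admissible d b D' \<and> (\<exists>W. poly W (of_int b) \<noteq> 0 \<and> fst D' = poly_to_fls W * fst D)"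
  using rem
proof cases
  case (1 n A A' B B' R f C)
  define x where "x t = (of_int b ^ d ^ t :: rat)" for t
  \<comment> \<open>For \<open>n = 0\<close> coprimality with \<open>d\<close> would mean
    \<open>d = 1\<close>.\<close>
  have n: "n \<ge> 1" using 1(3) d by (cases n) auto
  define W where "W = cyclotomic_poly n"
  have cyc: "poly (cyclotomic_poly k) (x t) \<noteq> 0" if "k \<ge> 1" for k t
  proof -
    have "\<bar>b ^ d ^ t\<bar> \<ge> 2"
    proof -
      have "\<bar>b\<bar> ^ 1 \<le> \<bar>b\<bar> ^ (d ^ t)" using b d by (intro power_increasing) auto
      thus ?thesis using b by (simp add: power_abs)
    qed
    from cyclotomic_poly_int_nonzero[OF that this] show ?thesis by (simp add: x_def)
  qed
  have A: "A \<noteq> 0" "B \<noteq> 0" "mahler_equation d f A B C" "\<not> is_rational_function f"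
      "fls_converges f (of_int b)" "\<And>t. poly A (x t) * poly B (x t) \<noteq> 0"
    using adm 1 by (auto simp: admissible_def x_def)
  have fin: "finite {r. r dvd d}" using d by simp
  hence fin': "finite {r. r dvd d \<and> r \<noteq> 1}" by (rule rev_finite_subset) auto
  have pos: "r * n \<ge> 1" if "r dvd d" for r using that n d by (auto intro!: Suc_leI gr0I)
  \<comment> \<open>By the product formula, \<open>R\<close> is exactly the quotient of
    \<open>W\<close> at \<open>z ^ d\<close> by \<open>W\<close>, the factor that appears when the
    equation is rewritten for \<open>W * f\<close>.\<close>
  have Wd: "poly_compose_power W d = W * R"
  proof -
    have "{r. r dvd d} = insert 1 {r. r dvd d \<and> r \<noteq> 1}" by auto
    hence "(\<Prod>r\<in>{r. r dvd d}. cyclotomic_poly (r * n)) = cyclotomic_poly (1 * n) * R"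
      using fin' unfolding 1(6) by simp
    thus ?thesis using cyclotomic_poly_compose_power[OF 1(3) _ n] d by (simp add: W_def)
  qed
  have Rx: "poly R (x t) \<noteq> 0" for t
    unfolding 1(6) poly_prod using fin' cyc[OF pos] by auto
  have nz: "A' \<noteq> 0" "B' \<noteq> 0" "R \<noteq> 0" "W \<noteq> 0" using A 1 Rx[of 0] by (auto simp: W_def)
  have "poly A' (x t) \<noteq> 0" "poly (B' * R) (x t) \<noteq> 0" for t
    using A(6)[of t] Rx[of t] by (auto simp: 1(4,5))
  moreover have "mahler_equation d (poly_to_fls W * f) A' (B' * R) (C * R)"
  proof -
    have eq: "poly_to_fls B * f = poly_to_fls A * fls_compose_power f d + poly_to_fls C"
      using A(2,3) by (simp add: mahler_equation_iff)
    have comp: "fls_compose_power (poly_to_fls W * f) d = poly_to_fls (W * R) * fls_compose_power f d"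
      using d by (simp add: poly_to_fls_compose_power[symmetric] Wd)
    have "poly_to_fls (B' * R) * (poly_to_fls W * f) = poly_to_fls R * (poly_to_fls B * f)"
      unfolding 1(5) by (simp add: poly_to_fls_mult mult_ac W_def)
    also have "\<dots> = poly_to_fls A' * (poly_to_fls (W * R) * fls_compose_power f d) + poly_to_fls (C * R)"
      unfolding eq 1(4) by (simp add: poly_to_fls_mult algebra_simps W_def)
    finally show ?thesis using nz by (simp only: mahler_equation_iff comp mult_eq_0_iff simp_thms)
  qed
  moreover have "poly W (of_int b) \<noteq> 0" using cyclotomic_poly_int_nonzero[OF n b] by (simp add: W_def)
  ultimately show ?thesis using A nz 1 b unfolding admissible_def
    by (auto simp: x_def is_rational_function_mult_poly_iff fls_converges_mult W_def
        intro!: exI[of _ "cyclotomic_poly n"])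
qed

lemma normalises_to_admissible:
  assumes norm: "normalises_to d D E" and adm: "admissible d b D" and b: "\<bar>b\<bar> \<ge> 2" and d: "d \<ge> 2"
  shows "admissible d b E \<and> (\<exists>W. poly W (of_int b) \<noteq> 0 \<and> fst E = poly_to_fls W * fst D)"
proof -
  obtain D' where D': "remove_powers d D D'" "(remove_cyclotomic d)\<^sup>*\<^sup>* D' E"
    using norm unfolding normalises_to_def by blast
  have 1: "admissible d b D' \<and> (\<exists>W. poly W (of_int b) \<noteq> 0 \<and> fst D' = poly_to_fls W * fst D)"
    using remove_powers_admissible[OF D'(1) adm b] d by simp
  from D'(2) show ?thesis
  proof (induction rule: rtranclp_induct)
    case base
    show ?case by (rule 1)
  next
    case (step E E')
    then obtain W where W: "poly W (of_int b) \<noteq> 0" "fst E = poly_to_fls W * fst D" by blast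
    obtain W' where W': "admissible d b E'" "poly W' (of_int b) \<noteq> 0" "fst E' = poly_to_fls W' * fst E"
      using remove_cyclotomic_admissible[OF step(2) _ b d] step(3) by blast
    thus ?case using W by (intro conjI exI[of _ "W' * W"]) (auto simp: poly_to_fls_mult mult.assoc)
  qed
qed

section \<open>Stabilisation of the cancelled factor\<close>

text \<open>The behaviour of an order that survives both kinds of recurrence, addition of a constant
  and truncated subtraction. Divergence to infinity is harmless because an order enters the
  cancelled factor only through its minimum with a fixed number.\<close>

definition settles :: "(nat \<Rightarrow> nat) \<Rightarrow> bool" where
  "settles s \<longleftrightarrow> (\<exists>c. \<forall>\<^sub>F n in sequentially. s n = c) \<or> filterlim s at_top sequentially"

lemma settles_compose:
  assumes "settles s" and "\<And>n. n \<ge> N \<Longrightarrow> t (Suc n) = h (s n)" and "filterlim h at_top at_top"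
  shows "settles t"
  using assms(1) unfolding settles_def
proof
  assume "\<exists>c. \<forall>\<^sub>F n in sequentially. s n = c"
  then obtain c where "\<forall>\<^sub>F n in sequentially. s n = c" by blast
  hence "\<forall>\<^sub>F n in sequentially. t (Suc n) = h c"
    using eventually_ge_at_top[of N] by eventually_elim (simp add: assms(2))
  thus "(\<exists>c. \<forall>\<^sub>F n in sequentially. t n = c) \<or> filterlim t at_top sequentially"
    unfolding eventually_sequentially_Suc[of "\<lambda>n. t n = h c"] by blast
next
  assume "filterlim s at_top sequentially"
  hence "filterlim (\<lambda>n. h (s n)) at_top sequentially" by (rule filterlim_compose[OF assms(3)])
  moreover have "\<forall>\<^sub>F n in sequentially. h (s n) = t (Suc n)"
    using eventually_ge_at_top[of N] by eventually_elim (simp add: assms(2))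
  ultimately have "filterlim (\<lambda>n. t (Suc n)) at_top sequentially"
    using filterlim_cong[OF refl refl, of "\<lambda>n. h (s n)" "\<lambda>n. t (Suc n)" sequentially at_top] by blast
  thus "(\<exists>c. \<forall>\<^sub>F n in sequentially. t n = c) \<or> filterlim t at_top sequentially"
    unfolding filterlim_sequentially_Suc by blast
qed

lemma settles_min:
  assumes "settles s"
  shows "\<exists>c. \<forall>\<^sub>F n in sequentially. min a (s n) = c"
  using assms unfolding settles_def
proof
  assume "\<exists>c. \<forall>\<^sub>F n in sequentially. s n = c"
  then obtain c where "\<forall>\<^sub>F n in sequentially. s n = c" by blast
  hence "\<forall>\<^sub>F n in sequentially. min a (s n) = min a c" by eventually_elim simp
  thus ?thesis by blast
next
  assume "filterlim s at_top sequentially"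
  hence "\<forall>\<^sub>F n in sequentially. s n \<ge> a" by (simp add: filterlim_at_top)
  hence "\<forall>\<^sub>F n in sequentially. min a (s n) = a" by eventually_elim simp
  thus ?thesis by blast
qed

lemma settles_decreasing:
  assumes "\<And>n. n \<ge> N \<Longrightarrow> s (Suc n) \<le> s n"
  shows "settles s"
proof -
  define m where "m = (LEAST m. \<exists>n\<ge>N. s n = m)"
  have "\<exists>n\<ge>N. s n = m" unfolding m_def by (rule LeastI[of _ "s N"]) blast
  then obtain n0 where n0: "n0 \<ge> N" "s n0 = m" by blast
  have "s n = m" if n: "n \<ge> n0" for n
  proof (rule antisym)
    show "s n \<le> m" using n
    proof (induction n rule: dec_induct)
      case (step i)
      have "s (Suc i) \<le> s i" using step.hyps n0(1) by (intro assms) simp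
      thus ?case using step.IH by simp
    qed (simp add: n0)
    show "m \<le> s n" unfolding m_def by (rule Least_le, rule exI[of _ n]) (use n n0 in simp)
  qed
  thus ?thesis unfolding settles_def eventually_sequentially by blast
qed

lemma settles_increasing:
  assumes "\<And>n. n \<ge> N \<Longrightarrow> s (Suc n) > s n"
  shows "settles s"
proof -
  have "s (N + n) \<ge> n" for n
  proof (induction n)
    case (Suc n)
    have "s (Suc (N + n)) > s (N + n)" by (rule assms) simp
    thus ?case using Suc by simp
  qed simp
  hence ge: "s n \<ge> n - N" if "n \<ge> N" for n using that by (metis le_add_diff_inverse)
  have "filterlim s at_top sequentially" unfolding filterlim_at_top
  proof
    fix Z show "\<forall>\<^sub>F n in sequentially. Z \<le> s n"
      using eventually_ge_at_top[of "N + Z"]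
    proof eventually_elim
      case (elim n)
      thus ?case using ge[of n] by linarith
    qed
  qed
  thus ?thesis unfolding settles_def by blast
qed

section \<open>Orders of zeros along orbits of the power map\<close>

abbreviation root_order :: "complex \<Rightarrow> rat poly \<Rightarrow> nat" where
  "root_order x p \<equiv> order x (map_poly of_rat p)"

lemma root_order_mult:
  "p \<noteq> 0 \<Longrightarrow> q \<noteq> 0 \<Longrightarrow> root_order x (p * q) = root_order x p + root_order x q"
  unfolding map_poly_of_rat_mult by (rule order_mult) simp

lemma root_order_pos_iff: "p \<noteq> 0 \<Longrightarrow> root_order x p > 0 \<longleftrightarrow> poly_cx p x = 0"
  by (subst order_gt_0_iff) auto

lemma finite_roots_rat: "p \<noteq> 0 \<Longrightarrow> finite {x. poly_cx p x = 0}"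
  by (intro poly_roots_finite) simp

text \<open>\<open>S\<close> may be larger than the set of roots, so that one finite set serves all
  cancelled factors at once.\<close>

lemma degree_eq_sum_root_order:
  assumes p: "p \<noteq> 0" and S: "finite S" "\<And>x. poly_cx p x = 0 \<Longrightarrow> x \<in> S"
  shows "degree p = (\<Sum>x\<in>S. root_order x p)"
proof -
  define P where "P = (map_poly of_rat p :: complex poly)"
  have P: "P \<noteq> 0" using p by (simp add: P_def)
  have "degree p = size (proots P)" by (simp add: size_proots_complex P_def)
  also have "\<dots> = (\<Sum>x\<in>{x. poly P x = 0}. order x P)"
    using P by (simp add: size_multiset_overloaded_eq)
  also have "\<dots> = (\<Sum>x\<in>S. order x P)"
    using S P by (intro sum.mono_neutral_left) (auto simp: P_def order_0I)
  finally show ?thesis by (simp add: P_def)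
qed

definition root_of_unity :: "complex \<Rightarrow> bool" where
  "root_of_unity x \<longleftrightarrow> (\<exists>n\<ge>1. x ^ n = 1)"

lemma inj_iterated_powers:
  assumes "\<not> root_of_unity x" "x \<noteq> 0" "d \<ge> 2"
  shows "inj (\<lambda>i. x ^ d ^ i)"
proof (rule linorder_injI)
  fix i j :: nat assume "i < j"
  show "x ^ d ^ i \<noteq> x ^ d ^ j"
  proof
    assume eq: "x ^ d ^ i = x ^ d ^ j"
    have lt: "d ^ i < d ^ j" using \<open>i < j\<close> assms(3) by simp
    have "x ^ d ^ j = x ^ d ^ i * x ^ (d ^ j - d ^ i)"
      using lt by (simp flip: power_add)
    hence "x ^ (d ^ j - d ^ i) = 1" using eq assms(2) by simp
    moreover have "d ^ j - d ^ i \<ge> 1" using lt by simp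
    ultimately show False using assms(1) unfolding root_of_unity_def by blast
  qed
qed

lemma eventually_not_root_iterated_powers:
  assumes "\<not> root_of_unity x" "x \<noteq> 0" "d \<ge> 2" "p \<noteq> 0"
  shows "\<forall>\<^sub>F i in sequentially. poly_cx p (x ^ d ^ i) \<noteq> 0"
proof -
  have "finite ((\<lambda>i. x ^ d ^ i) -` {y. poly_cx p y = 0})"
    using inj_iterated_powers[OF assms(1-3)] finite_roots_rat[OF assms(4)] by (intro finite_vimageI)
  moreover have "(\<lambda>i. x ^ d ^ i) -` {y. poly_cx p y = 0} = {i. \<not> poly_cx p (x ^ d ^ i) \<noteq> 0}" by auto
  ultimately have "\<forall>\<^sub>F i in cofinite. poly_cx p (x ^ d ^ i) \<noteq> 0" by (simp add: eventually_cofinite)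
  thus ?thesis by (simp add: cofinite_eq_sequentially)
qed

text \<open>As \<open>i\<close> increases, the order of \<open>x ^ d ^ i\<close> can only pass to a
  divisor. Where it is smallest it no longer changes, so two consecutive points of the orbit are
  conjugate.\<close>

lemma root_of_unity_same_order:
  assumes "root_of_unity x" "d \<ge> 1"
  obtains i N where "primitive_root_of_unity N (x ^ d ^ i)" "primitive_root_of_unity N (x ^ d ^ Suc i)"
proof -
  have "\<exists>N. primitive_root_of_unity N (x ^ d ^ i)" for i
  proof -
    obtain n where n: "n \<ge> 1" "x ^ n = 1" using assms(1) unfolding root_of_unity_def by blast
    have "(x ^ d ^ i) ^ n = (x ^ n) ^ d ^ i" by (simp add: mult.commute flip: power_mult)
    hence "(x ^ d ^ i) ^ n = 1" using n by simp
    from root_of_unity_is_primitive[OF this n(1)] show ?thesis by blast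
  qed
  then obtain N where N: "\<And>i. primitive_root_of_unity (N i) (x ^ d ^ i)" by metis
  define m where "m = (LEAST m. \<exists>i. N i = m)"
  have "\<exists>i. N i = m" unfolding m_def by (rule LeastI[of _ "N 0"]) blast
  then obtain i where i: "N i = m" by blast
  have "(x ^ d ^ i) ^ N i = 1" using N[of i] by (simp add: primitive_root_of_unity_def)
  hence "((x ^ d ^ i) ^ N i) ^ d = 1" by simp
  hence "(x ^ d ^ Suc i) ^ N i = 1" by (simp add: mult_ac flip: power_mult)
  hence "N (Suc i) dvd N i" using primitive_root_power_eq_1_iff[OF N[of "Suc i"]] by simp
  moreover have "N i > 0" using N[of i] by (auto simp: primitive_root_of_unity_def)
  ultimately have "N (Suc i) \<le> m" unfolding i by (intro dvd_imp_le) auto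
  moreover have "m \<le> N (Suc i)" unfolding m_def by (rule Least_le) blast
  ultimately have "N (Suc i) = N i" using i by simp
  thus ?thesis using that[of "N i" i] N[of i] N[of "Suc i"] by simp
qed

text \<open>Only the polynomial identities of a primitive sequence are kept, without the series: the
  cancellation is a matter of orders at individual points.\<close>

locale coprime_iteration =
  fixes d :: nat and A B C :: "rat poly" and p q G :: "nat \<Rightarrow> rat poly"
  assumes d2: "d \<ge> 2" and A0: "A \<noteq> 0" and B0: "B \<noteq> 0"
    and coprime_pq: "coprime (p n) (q n)" and q0: "q n \<noteq> 0"
    and num: "A * poly_compose_power (p n) d + C * poly_compose_power (q n) d = G n * p (Suc n)"
    and den: "B * poly_compose_power (q n) d = G n * q (Suc n)"
begin

abbreviation "num_at n x \<equiv> poly_cx (G n * p (Suc n)) x"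

lemma num_at: "num_at n x = poly_cx A x * poly_cx (p n) (x ^ d) + poly_cx C x * poly_cx (q n) (x ^ d)"
  unfolding num[symmetric] by (simp add: poly_cx_add poly_cx_mult)

lemma den_at: "poly_cx (G n) x * poly_cx (q (Suc n)) x = poly_cx B x * poly_cx (q n) (x ^ d)"
  using arg_cong[OF den[of n], of "\<lambda>r. poly_cx r x"] by (simp add: poly_cx_mult)

lemma G0: "G n \<noteq> 0"
proof
  assume "G n = 0"
  hence "B * poly_compose_power (q n) d = 0" using den[of n] by simp
  thus False using B0 q0[of n] d2 by (simp add: compose_power_eq_0_iff)
qed

lemma order_recurrence:
  assumes "x \<noteq> 0"
  shows "root_order x (G n) + root_order x (q (Suc n)) = root_order x B + root_order (x ^ d) (q n)"
proof -
  have "root_order x (G n * q (Suc n)) = root_order x (B * poly_compose_power (q n) d)"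
    by (simp add: den)
  moreover have "root_order x (poly_compose_power (q n) d) = root_order (x ^ d) (q n)"
    unfolding map_poly_of_rat_pcompose using assms d2 q0 by (simp add: order_compose_power)
  ultimately show ?thesis using G0 q0 B0 d2 by (simp add: root_order_mult)
qed

text \<open>Where \<open>B\<close> does not vanish, \<open>G n\<close> is locally the greatest
  common divisor of \<open>A * p + C * q\<close> and \<open>q\<close>, with \<open>p\<close> and
  \<open>q\<close> taken at \<open>z ^ d\<close>. As these are coprime, this is the common part of
  \<open>A\<close> and \<open>q\<close>. The orders are compared by testing every power of the
  linear factor.\<close>

lemma root_order_common_factor:
  assumes "poly_cx B x \<noteq> 0"
  shows "root_order x (G n) = min (root_order x A) (root_order x (poly_compose_power (q n) d))"
proof -
  let ?L = "\<lambda>j. [:-x, 1:] ^ j :: complex poly"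
  let ?m = "map_poly of_rat :: rat poly \<Rightarrow> complex poly"
  let ?q = "poly_compose_power (q n) d" and ?p = "poly_compose_power (p n) d"
  have q0': "?q \<noteq> 0" using q0 d2 by simp
  have B: "root_order x B = 0" using assms by (rule order_0I)
  have num': "?m (G n * p (Suc n)) = ?m A * ?m ?p + ?m C * ?m ?q"
    unfolding num[symmetric] by (simp add: map_poly_of_rat_add map_poly_of_rat_mult)
  have dvd_iff: "?L j dvd ?m r \<longleftrightarrow> j \<le> root_order x r" if "r \<noteq> 0" for j r
    using order_divides[of x j "?m r"] that by simp
  have "j \<le> root_order x (G n) \<longleftrightarrow> j \<le> root_order x A \<and> j \<le> root_order x ?q" for j
  proof
    assume j: "j \<le> root_order x (G n)"
    hence L: "?L j dvd ?m (G n)" using dvd_iff[OF G0] by blast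
    have "?L j dvd ?m (B * ?q)" unfolding den map_poly_of_rat_mult using L by (rule dvd_mult2)
    hence jq: "j \<le> root_order x ?q"
      using dvd_iff[of "B * ?q"] B0 q0' B by (simp add: root_order_mult)
    have "j \<le> root_order x A"
    proof (cases "j = 0")
      case False
      hence "root_order x ?q > 0" using jq by simp
      hence "poly_cx (q n) (x ^ d) = 0" using root_order_pos_iff[OF q0'] by simp
      hence px: "poly_cx ?p x \<noteq> 0"
        using coprime_no_common_root[of "q n" "p n"] coprime_pq[of n] by (simp add: coprime_commute)
      have p: "?p \<noteq> 0" using px by (metis map_poly_0 poly_0)
      have po: "root_order x ?p = 0" using px by (rule order_0I)
      have "?L j dvd ?m (G n * p (Suc n)) - ?m C * ?m ?q"
        using L dvd_iff[OF q0'] jq unfolding map_poly_of_rat_mult by (intro dvd_diff dvd_mult2 dvd_mult) auto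
      hence "?L j dvd ?m (A * ?p)" unfolding num' by (simp add: map_poly_of_rat_mult)
      thus ?thesis using dvd_iff[of "A * ?p"] A0 p po by (simp add: root_order_mult)
    qed simp
    thus "j \<le> root_order x A \<and> j \<le> root_order x ?q" using jq by blast
  next
    assume j: "j \<le> root_order x A \<and> j \<le> root_order x ?q"
    hence L: "?L j dvd ?m A" "?L j dvd ?m ?q" using dvd_iff A0 q0' by auto
    have P: "?L j dvd ?m (G n * p (Suc n))" unfolding num' using L by (intro dvd_add dvd_mult dvd_mult2)
    have Q: "?L j dvd ?m (G n * q (Suc n))" unfolding den[symmetric] map_poly_of_rat_mult
      using L by (intro dvd_mult)
    have "poly_cx (p (Suc n)) x \<noteq> 0 \<or> poly_cx (q (Suc n)) x \<noteq> 0"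
      using coprime_no_common_root[OF coprime_pq] by blast
    thus "j \<le> root_order x (G n)"
    proof
      assume p: "poly_cx (p (Suc n)) x \<noteq> 0"
      hence "p (Suc n) \<noteq> 0" "root_order x (p (Suc n)) = 0" by (auto intro: order_0I)
      thus ?thesis using P dvd_iff[of "G n * p (Suc n)"] G0 by (simp add: root_order_mult)
    next
      assume q: "poly_cx (q (Suc n)) x \<noteq> 0"
      hence "q (Suc n) \<noteq> 0" "root_order x (q (Suc n)) = 0" by (auto intro: order_0I)
      thus ?thesis using Q dvd_iff[of "G n * q (Suc n)"] G0 by (simp add: root_order_mult)
    qed
  qed
  hence "j \<le> root_order x (G n) \<longleftrightarrow> j \<le> min (root_order x A) (root_order x ?q)" for j
    unfolding min.bounded_iff .
  thus ?thesis by (blast intro: order_antisym)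
qed

lemma common_factor_dvd: "G n dvd A * B"
proof -
  obtain s t where st: "s * p n + t * q n = 1" using coprime_bezout_poly[OF coprime_pq] .
  let ?c = "\<lambda>p. poly_compose_power p d"
  have "?c (s * p n + t * q n) = 1" unfolding st by (simp add: pcompose_1)
  hence st': "?c s * ?c (p n) + ?c t * ?c (q n) = 1" by (simp add: pcompose_add pcompose_mult)
  have "A * B = A * B * (?c s * ?c (p n) + ?c t * ?c (q n))" unfolding st' by simp
  also have "\<dots> = ?c s * (B * (A * ?c (p n) + C * ?c (q n)) - C * (B * ?c (q n))) + ?c t * A * (B * ?c (q n))"
    by (simp add: algebra_simps)
  finally show ?thesis unfolding num den by (metis dvd_add dvd_diff dvd_mult dvd_triv_left)
qed

end

text \<open>\<open>regular\<close> is where the assumptions on \<open>B\<close> enter: from some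
  index on nothing cancels at a nonzero root of \<open>B\<close>. The order recurrence at such a
  root would otherwise contain the unknown order of a numerator.\<close>

locale coprime_iteration_regular = coprime_iteration +
  assumes A_0: "poly_cx A 0 \<noteq> 0"
    and regular: "\<And>x. x \<noteq> 0 \<Longrightarrow> poly_cx B x = 0 \<Longrightarrow> \<forall>\<^sub>F n in sequentially. num_at n x \<noteq> 0"
begin

lemma common_factor_order_eventually_0:
  assumes "x \<noteq> 0" "poly_cx B x = 0"
  shows "\<forall>\<^sub>F n in sequentially. root_order x (G n) = 0"
  using regular[OF assms] by eventually_elim (auto simp: poly_cx_mult intro: order_0I)

text \<open>Truncated subtraction is meant: the order of \<open>A\<close> is used up only as far as
  the order of the old denominator allows.\<close>

lemma order_q_Suc_unit:
  assumes "x \<noteq> 0" "poly_cx B x \<noteq> 0"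
  shows "root_order x (G n) = min (root_order x A) (root_order (x ^ d) (q n))"
    and "root_order x (q (Suc n)) = root_order (x ^ d) (q n) - root_order x A"
proof -
  have "root_order x (poly_compose_power (q n) d) = root_order (x ^ d) (q n)"
    unfolding map_poly_of_rat_pcompose using assms d2 q0 by (simp add: order_compose_power)
  thus 1: "root_order x (G n) = min (root_order x A) (root_order (x ^ d) (q n))"
    using root_order_common_factor[OF assms(2), of n] by simp
  have "root_order x B = 0" using assms(2) by (rule order_0I)
  thus "root_order x (q (Suc n)) = root_order (x ^ d) (q n) - root_order x A"
    using order_recurrence[OF assms(1), of n] 1 by linarith
qed

lemma settles_step:
  assumes x: "x \<noteq> 0" and set: "settles (\<lambda>n. root_order (x ^ d) (q n))"
  shows "settles (\<lambda>n. root_order x (q n))"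
proof (cases "poly_cx B x = 0")
  case True
  obtain N where N: "\<And>n. n \<ge> N \<Longrightarrow> root_order x (G n) = 0"
    using common_factor_order_eventually_0[OF x True] unfolding eventually_sequentially by blast
  show ?thesis
  proof (rule settles_compose[OF set])
    show "root_order x (q (Suc n)) = root_order x B + root_order (x ^ d) (q n)" if "n \<ge> N" for n
      using order_recurrence[OF x, of n] N[OF that] by simp
    show "filterlim (\<lambda>m. root_order x B + m) at_top at_top"
      by (intro filterlim_at_top_mono[OF filterlim_ident] always_eventually) auto
  qed
next
  case False
  show ?thesis
  proof (rule settles_compose[OF set])
    show "root_order x (q (Suc n)) = root_order (x ^ d) (q n) - root_order x A" if "n \<ge> 0" for n
      by (rule order_q_Suc_unit(2)[OF x False])
    show "filterlim (\<lambda>m. m - root_order x A) at_top at_top"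
      unfolding filterlim_at_top
    proof
      fix Z show "\<forall>\<^sub>F m in at_top. Z \<le> m - root_order x A"
        using eventually_ge_at_top[of "Z + root_order x A"] by eventually_elim simp
    qed
  qed
qed

text \<open>Since \<open>y\<close> and \<open>y ^ d\<close> are conjugate, the recurrence refers to
  a single order. At a root of \<open>B\<close> it grows strictly once nothing cancels; elsewhere it
  never grows.\<close>

lemma settles_root_of_unity_cycle:
  assumes y: "primitive_root_of_unity N y" "primitive_root_of_unity N (y ^ d)"
  shows "settles (\<lambda>n. root_order y (q n))"
proof -
  have y0: "y \<noteq> 0" using y(1) by (auto simp: primitive_root_of_unity_def power_0_left)
  have same: "root_order (y ^ d) (q n) = root_order y (q n)" for n
    by (rule order_primitive_root_eq[OF q0 y(2,1)])
  show ?thesis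
  proof (cases "poly_cx B y = 0")
    case True
    obtain M where M: "\<And>n. n \<ge> M \<Longrightarrow> root_order y (G n) = 0"
      using common_factor_order_eventually_0[OF y0 True] unfolding eventually_sequentially by blast
    have "root_order y B > 0" using True B0 root_order_pos_iff by blast
    hence "root_order y (q (Suc n)) > root_order y (q n)" if "n \<ge> M" for n
      using order_recurrence[OF y0, of n] M[OF that] same by simp
    thus ?thesis by (rule settles_increasing)
  next
    case False
    show ?thesis
      by (rule settles_decreasing[of 0]) (simp add: order_q_Suc_unit(2)[OF y0 False] same)
  qed
qed

text \<open>The orbit has infinitely many points, so from some index on it meets no root of
  \<open>B\<close> and no root of \<open>q 0\<close>. Out there an order at one point is bounded by
  the previous one at the next point, and \<open>n\<close> steps lead back to \<open>q 0\<close>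
  where it does not vanish.\<close>

lemma settles_not_root_of_unity:
  assumes x: "x \<noteq> 0" "\<not> root_of_unity x"
  obtains i where "settles (\<lambda>n. root_order (x ^ d ^ i) (q n))"
proof -
  obtain I where I: "\<And>i. i \<ge> I \<Longrightarrow> poly_cx B (x ^ d ^ i) \<noteq> 0"
    using eventually_not_root_iterated_powers[OF x(2,1) d2 B0] unfolding eventually_sequentially by blast
  obtain J where J: "\<And>i. i \<ge> J \<Longrightarrow> poly_cx (q 0) (x ^ d ^ i) \<noteq> 0"
    using eventually_not_root_iterated_powers[OF x(2,1) d2 q0] unfolding eventually_sequentially by blast
  have le: "root_order (x ^ d ^ i) (q n) \<le> root_order (x ^ d ^ (i + n)) (q 0)" if "i \<ge> I" for i n
    using that
  proof (induction n arbitrary: i)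
    case (Suc n)
    have "x ^ d ^ i \<noteq> 0" using x by simp
    from order_q_Suc_unit(2)[OF this I[OF Suc.prems], of n]
    have "root_order (x ^ d ^ i) (q (Suc n)) \<le> root_order (x ^ d ^ Suc i) (q n)"
      by (simp add: mult.commute flip: power_mult)
    thus ?case using Suc.IH[of "Suc i"] Suc.prems by simp
  qed simp
  have "root_order (x ^ d ^ I) (q n) = 0" if "n \<ge> J" for n
    using le[of I n] J[of "I + n"] that by (simp add: order_0I)
  hence "settles (\<lambda>n. root_order (x ^ d ^ I) (q n))"
    unfolding settles_def eventually_sequentially by blast
  thus ?thesis by (rule that)
qed

text \<open>What is known far out on the orbit is pulled back to \<open>x\<close> one
  \<open>d\<close>-th power at a time.\<close>

lemma settles_order_q:
  assumes "x \<noteq> 0"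
  shows "settles (\<lambda>n. root_order x (q n))"
proof -
  have "\<exists>i. settles (\<lambda>n. root_order (x ^ d ^ i) (q n))"
  proof (cases "root_of_unity x")
    case True
    moreover have "d \<ge> 1" using d2 by simp
    ultimately obtain i N where N: "primitive_root_of_unity N (x ^ d ^ i)" "primitive_root_of_unity N (x ^ d ^ Suc i)"
      by (rule root_of_unity_same_order)
    have "x ^ d ^ Suc i = (x ^ d ^ i) ^ d" unfolding power_Suc2 power_mult by (rule refl)
    with N have "settles (\<lambda>n. root_order (x ^ d ^ i) (q n))"
      by (intro settles_root_of_unity_cycle[of N]) simp_all
    thus ?thesis by (rule exI)
  next
    case False
    show ?thesis using settles_not_root_of_unity[OF assms False] by metis
  qed
  then obtain i where "settles (\<lambda>n. root_order (x ^ d ^ i) (q n))" by blast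
  thus ?thesis
  proof (induction i)
    case (Suc i)
    have x0: "x ^ d ^ i \<noteq> 0" using assms by simp
    have eq: "x ^ d ^ Suc i = (x ^ d ^ i) ^ d" unfolding power_Suc2 power_mult by (rule refl)
    show ?case by (rule Suc.IH[OF settles_step[OF x0 Suc.prems[unfolded eq]]])
  qed simp
qed

text \<open>Zero is fixed by the power map but ramified, so it needs an argument of its own. The
  dichotomy is whether some denominator vanishes there.\<close>

lemma common_factor_order_eventually_const:
  "\<exists>c. \<forall>\<^sub>F n in sequentially. root_order x (G n) = c"
proof (cases "x = 0")
  case False
  show ?thesis
  proof (cases "poly_cx B x = 0")
    case True
    thus ?thesis using common_factor_order_eventually_0[OF False] by blast
  next
    case B: False
    have "x ^ d \<noteq> 0" using False by simp
    from settles_min[OF settles_order_q[OF this]] show ?thesis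
      using order_q_Suc_unit(1)[OF False B] by simp
  qed
next
  case True
  have d0: "(0::complex) ^ d = 0" using d2 by (simp add: power_0_left)
  have A0': "root_order 0 A = 0" using A_0 by (rule order_0I)
  show ?thesis
  proof (cases "poly_cx B 0 = 0")
    case False
    have "root_order 0 (G n) = 0" for n
      using root_order_common_factor[OF False, of n] A0' by simp
    thus ?thesis unfolding True by simp
  next
    case B: True
    show ?thesis
    proof (cases "\<exists>m. poly_cx (q m) 0 = 0")
      case True
      then obtain m where m: "poly_cx (q m) 0 = 0" by blast
      \<comment> \<open>If a denominator vanishes at 0, its numerator does not, and with
        \<open>A\<close> nonzero at 0 the stepped numerator is nonzero as well. So nothing cancels,
        and the next denominator vanishes again.\<close>
      have G: "poly_cx (G n) 0 \<noteq> 0" if "poly_cx (q n) 0 = 0" for n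
      proof -
        have "poly_cx (p n) 0 \<noteq> 0"
          using coprime_no_common_root[of "q n" "p n" 0] coprime_pq[of n] that by (simp add: coprime_commute)
        hence "num_at n 0 \<noteq> 0" using A_0 that unfolding num_at d0 by simp
        thus ?thesis by (simp add: poly_cx_mult)
      qed
      have "poly_cx (q n) 0 = 0" if "n \<ge> m" for n
        using that
      proof (induction n rule: dec_induct)
        case (step n)
        show ?case using den_at[of n 0] G[OF step.IH] step.IH d0 by simp
      qed (rule m)
      hence "root_order 0 (G n) = 0" if "n \<ge> m" for n using G that by (auto intro: order_0I)
      thus ?thesis unfolding eventually_sequentially \<open>x = 0\<close> by blast
    next
      case False
      \<comment> \<open>If no denominator ever vanishes at 0, the whole order of \<open>B\<close>
        there has to be cancelled in every step.\<close>
      have "root_order 0 (G n) = root_order 0 B" for n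
      proof -
        have "poly_cx (poly_compose_power (q n) d) 0 \<noteq> 0"
          unfolding poly_cx_compose_power d0 using False by blast
        hence "root_order 0 (poly_compose_power (q n) d) = 0" by (rule order_0I)
        moreover have "root_order 0 (q (Suc n)) = 0" using False by (intro order_0I) blast
        moreover have "root_order 0 (G n * q (Suc n)) = root_order 0 (B * poly_compose_power (q n) d)"
          by (simp add: den)
        ultimately show ?thesis using G0 q0 B0 d2 by (simp add: root_order_mult)
      qed
      thus ?thesis unfolding True by simp
    qed
  qed
qed

theorem degree_common_factor_eventually_const:
  "\<exists>N c. \<forall>n\<ge>N. degree (G n) = c"
proof -
  define S where "S = {x. poly_cx (A * B) x = 0}"
  have fin: "finite S" unfolding S_def using A0 B0 by (intro finite_roots_rat) simp
  obtain c where c: "\<And>x. \<forall>\<^sub>F n in sequentially. root_order x (G n) = c x"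
    using common_factor_order_eventually_const by metis
  have "\<forall>\<^sub>F n in sequentially. \<forall>x\<in>S. root_order x (G n) = c x"
    using fin c by (simp add: eventually_ball_finite)
  hence "\<forall>\<^sub>F n in sequentially. degree (G n) = (\<Sum>x\<in>S. c x)"
  proof eventually_elim
    case (elim n)
    have "degree (G n) = (\<Sum>x\<in>S. root_order x (G n))"
      by (rule degree_eq_sum_root_order[OF G0 fin])
         (use poly_cx_dvd[OF common_factor_dvd] in \<open>auto simp: S_def\<close>)
    thus ?case using elim by simp
  qed
  thus ?thesis unfolding eventually_sequentially by blast
qed

end

section \<open>Numerators at points outside the unit disc\<close>

lemma filterlim_iterated_powers:
  fixes z :: "'a :: real_normed_field"
  assumes "norm z > 1" "d \<ge> 2"
  shows "filterlim (\<lambda>i. z ^ d ^ i) at_infinity sequentially"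
proof -
  have "filterlim (\<lambda>i. d ^ i) at_top sequentially" using assms(2)
    by (intro filterlim_subseq) (simp add: strict_mono_Suc_iff)
  from filterlim_compose[OF filterlim_realpow_sequentially_gt1[OF assms(1)] this]
  show ?thesis .
qed

lemma tendsto_zero_ratio:
  fixes D :: "nat \<Rightarrow> 'a :: {real_normed_field, banach}"
  assumes "\<forall>\<^sub>F n in sequentially. D n \<noteq> 0" "(\<lambda>n. D (Suc n) / D n) \<longlonglongrightarrow> 0"
  shows "D \<longlonglongrightarrow> 0"
proof -
  have "\<forall>\<^sub>F n in sequentially. norm (D (Suc n) / D n) < 1 / 2"
    using order_tendstoD(2)[OF tendsto_norm[OF assms(2)], of "1 / 2"] by simp
  with assms(1) have "\<forall>\<^sub>F n in sequentially. norm (D (Suc n)) \<le> 1 / 2 * norm (D n)"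
    by eventually_elim (simp add: norm_divide field_simps)
  then obtain N where N: "\<And>n. n \<ge> N \<Longrightarrow> norm (D (Suc n)) \<le> 1 / 2 * norm (D n)"
    unfolding eventually_sequentially by blast
  have "summable D" by (rule summable_ratio_test[of "1 / 2" N]) (use N in auto)
  thus ?thesis by (rule summable_LIMSEQ_zero)
qed

text \<open>The letters \<open>za\<close>, \<open>zb\<close>, \<open>zu\<close> and so on stand for
  the powers of \<open>z\<close> describing the growth of \<open>A\<close>, \<open>B\<close>, the
  denominator and the error. Normalising every quantity by its power costs exactly the one factor
  \<open>inverse (...)\<close>.\<close>

lemma rescaled_quotient:
  fixes \<alpha> \<beta> e q e' q' za zb zu zv zdu zdv :: "'a :: field"
  assumes "za \<noteq> 0" "zb \<noteq> 0" "zu \<noteq> 0" "zv \<noteq> 0" "zdu \<noteq> 0" "zdv \<noteq> 0"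
  shows "((\<alpha> / za) / (\<beta> / zb)) * ((e' / inverse zdv) / (q' / zdu)) / ((e / inverse zv) / (q / zu)) *
    inverse (zb * zdv * zdu / (za * zv * zu)) = (\<alpha> / \<beta>) * (e' / q') / (e / q)"
proof -
  have 1: "(\<alpha> / za) / (\<beta> / zb) = (\<alpha> / \<beta>) * (zb / za)" by simp
  have 2: "(e' / inverse zdv) / (q' / zdu) = (e' / q') * (zdv * zdu)" by (simp add: divide_inverse)
  have 3: "(e / inverse zv) / (q / zu) = (e / q) * (zv * zu)" by (simp add: divide_inverse)
  have 4: "x * (zb / za) * (y * (zdv * zdu)) / (w * (zv * zu)) *
    inverse (zb * zdv * zdu / (za * zv * zu)) = x * y / w" for x y w
    using assms by (cases "w = 0") (simp_all add: field_simps)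
  show ?thesis unfolding 1 2 3 4 ..
qed

context mahler_series begin

text \<open>The error identity of a step, evaluated at a point. With \<open>norm z > 1\<close> the
  point \<open>z ^ d\<close> lies farther out, so convergence there is inherited.\<close>

lemma step_value:
  assumes st: "step k l G" and conv: "fls_converges f z" and z: "norm z > 1"
  shows "poly_cx G z * fls_value (cf_error l) z = poly_cx A z * fls_value (cf_error k) (z ^ d)"
proof -
  have z0: "z \<noteq> 0" using z by auto
  have cerr: "fls_converges (cf_error i) x" if "fls_converges f x" for i x
    using that unfolding cf_error_def
    by (intro fls_converges_diff fls_converges_mult) (auto simp: fls_converges_def)
  have "norm z ^ 1 \<le> norm z ^ d" using z d_ge_2 by (intro power_increasing) auto
  hence "fls_converges f (z ^ d)" using fls_converges_mono[OF conv] by (simp add: norm_power)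
  note c = cerr[OF this, of k]
  have "poly_to_fls G * cf_error l = poly_to_fls (step_den k) * f - poly_to_fls (step_num k)"
    using st unfolding step_def by (simp add: cf_error_def poly_to_fls_mult algebra_simps)
  also have "\<dots> = poly_to_fls A * fls_compose_power (cf_error k) d"
    unfolding step_den_def step_num_def cf_error_def by (rule step_error)
  finally have "fls_value (poly_to_fls G * cf_error l) z =
      fls_value (poly_to_fls A * fls_compose_power (cf_error k) d) z" by simp
  thus ?thesis
    using fls_value_mult[of "poly_to_fls G" z "cf_error l"] cerr[OF conv]
      fls_value_mult[of "poly_to_fls A" z "fls_compose_power (cf_error k) d"]
      fls_value_compose_power[OF d_pos z0 c] z0 by simp
qed

text \<open>The expression decays like \<open>z\<close> to the power
  \<open>-((d - 1) * (u + v) + deg B - deg A)\<close>, where \<open>u\<close> and \<open>v\<close>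
  are the ends of the gap; bigness makes this exponent negative. Along an orbit it is the ratio of
  successive relative errors.\<close>

lemma error_ratio_tendsto:
  assumes conv: "fls_conv_radius (fls_of_rat f) > 0" and big: "big k"
  shows "((\<lambda>z. (poly_cx A z / poly_cx B z) *
      (fls_value (cf_error k) (z ^ d) / poly_cx (qq k) (z ^ d)) /
      (fls_value (cf_error k) z / poly_cx (qq k) z)) \<longlongrightarrow> 0) at_infinity"
proof -
  define u where "u = int (uu k)"
  define v where "v = int (uu (Suc k))"
  define a where "a = int (degree A)"
  define b where "b = int (degree B)"
  let ?e = "fls_value (cf_error k)"
  have eradius: "fls_conv_radius (fls_of_rat (cf_error k)) > 0"
  proof -
    have "fls_conv_radius (fls_of_rat (cf_error k)) \<ge> fls_conv_radius (fls_of_rat f)"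
      unfolding cf_error_def fls_of_rat_diff fls_of_rat_mult
      by (intro fls_conv_radius_diff_ge fls_conv_radius_mult_ge) auto
    thus ?thesis using conv by simp
  qed
  define ce where "ce = (of_rat (fls_nth (cf_error k) (fls_subdegree (cf_error k))) :: complex)"
  have ce: "ce \<noteq> 0" by (simp add: ce_def)
  have le: "((\<lambda>z. ?e z / z powi (- v)) \<longlongrightarrow> ce) at_infinity"
    using fls_value_asymp[OF eradius] by (simp add: cf_error_subdegree v_def ce_def)
  obtain cA where cA: "cA \<noteq> 0" and lA: "((\<lambda>z. poly_cx A z / z powi a) \<longlongrightarrow> cA) at_infinity"
    unfolding a_def using poly_cx_asymp[OF A_nonzero] by blast
  obtain cB where cB: "cB \<noteq> 0" and lB: "((\<lambda>z. poly_cx B z / z powi b) \<longlongrightarrow> cB) at_infinity"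
    unfolding b_def using poly_cx_asymp[OF B_nonzero] by blast
  obtain cq where cq: "cq \<noteq> 0" and lq: "((\<lambda>z. poly_cx (qq k) z / z powi u) \<longlongrightarrow> cq) at_infinity"
    unfolding u_def using poly_cx_asymp[OF qq_nonzero[of k]] by blast
  have pow: "filterlim (\<lambda>z::complex. z ^ d) at_infinity at_infinity"
    using Limits.filterlim_power_at_infinity[OF filterlim_ident d_pos] by simp
  have led: "((\<lambda>z. ?e (z ^ d) / (z ^ d) powi (- v)) \<longlongrightarrow> ce) at_infinity"
    by (rule filterlim_compose[OF le pow])
  have lqd: "((\<lambda>z. poly_cx (qq k) (z ^ d) / (z ^ d) powi u) \<longlongrightarrow> cq) at_infinity"
    by (rule filterlim_compose[OF lq pow])
  define m where "m = nat ((int d - 1) * (u + v) + b - a)"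
  have m: "int m = (int d - 1) * (u + v) + b - a" "m > 0"
  proof -
    have "int ((d - 1) * (uu (Suc k) - uu k)) > int (degree A + degree B)"
      using big unfolding big_def by (simp only: of_nat_less_iff)
    hence "(int d - 1) * (v - u) > a + b"
      using d_ge_2 degree_qq_less[of k] unfolding u_def v_def a_def b_def
      by (subst (asm) of_nat_mult, subst (asm) of_nat_diff, simp, subst (asm) of_nat_diff) (auto intro: less_imp_le)
    moreover have "(int d - 1) * (v - u) \<le> (int d - 1) * (u + v)"
      using d_ge_2 by (intro mult_left_mono) (auto simp: u_def)
    moreover have "b \<ge> 0" by (simp add: b_def)
    ultimately have "(int d - 1) * (u + v) + b - a > 0" by linarith
    thus "int m = (int d - 1) * (u + v) + b - a" "m > 0" by (auto simp: m_def)
  qed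
  have "((\<lambda>z::complex. inverse (z ^ m)) \<longlongrightarrow> 0) at_infinity"
    by (rule tendsto_inverse_0[THEN filterlim_compose]) (rule Limits.filterlim_power_at_infinity[OF filterlim_ident m(2)])
  hence "((\<lambda>z. ((poly_cx A z / z powi a) / (poly_cx B z / z powi b)) *
      ((?e (z ^ d) / (z ^ d) powi (- v)) / (poly_cx (qq k) (z ^ d) / (z ^ d) powi u)) /
      ((?e z / z powi (- v)) / (poly_cx (qq k) z / z powi u)) * inverse (z ^ m)) \<longlongrightarrow>
      (cA / cB) * (ce / cq) / (ce / cq) * 0) at_infinity"
    using cB cq ce by (intro tendsto_mult tendsto_divide lA lB le lq led lqd) auto
  moreover have "\<forall>\<^sub>F z in at_infinity. ((poly_cx A z / z powi a) / (poly_cx B z / z powi b)) *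
      ((?e (z ^ d) / (z ^ d) powi (- v)) / (poly_cx (qq k) (z ^ d) / (z ^ d) powi u)) /
      ((?e z / z powi (- v)) / (poly_cx (qq k) z / z powi u)) * inverse (z ^ m) =
      (poly_cx A z / poly_cx B z) * (?e (z ^ d) / poly_cx (qq k) (z ^ d)) / (?e z / poly_cx (qq k) z)"
    using eventually_not_equal_at_infinity[of 0]
  proof eventually_elim
    case (elim z)
    define X where "X = z powi b * z powi (int d * v) * z powi (int d * u) / (z powi a * z powi v * z powi u)"
    have "z ^ m = z powi (b + int d * v + int d * u - a - v - u)"
      unfolding power_int_of_nat[symmetric] m(1) by (simp add: algebra_simps)
    also have "\<dots> = X" using elim by (simp add: X_def power_int_add power_int_diff)
    finally have X: "z ^ m = X" .
    have zd: "(z ^ d) powi j = z powi (int d * j)" for j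
      by (simp add: power_int_mult)
    have neg: "z powi (int d * - v) = inverse (z powi (int d * v))" "z powi (- v) = inverse (z powi v)"
      by (simp_all add: power_int_minus)
    show ?case unfolding X zd X_def neg
      by (rule rescaled_quotient) (simp_all only: power_int_eq_0_iff elim, simp_all)
  qed
  ultimately show ?thesis unfolding mult_zero_right by (rule Lim_transform_eventually)
qed

end

section \<open>Values of convergents along an orbit of the power map\<close>

context mahler_series begin

text \<open>The quotients of the convergents at \<open>w\<close> eventually miss each prescribed
  number \<open>s\<close>. All \<open>s\<close> are included because a step carries quotients at
  \<open>w ^ d\<close> to quotients at \<open>w\<close> by the affine map from \<open>r\<close> to
  \<open>(A * r + C) / B\<close>, so that the property travels along the orbit; the value needed in
  the end is \<open>- C / A\<close>.\<close>

definition avoids :: "(nat \<Rightarrow> nat) \<Rightarrow> complex \<Rightarrow> bool" where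
  "avoids k w \<longleftrightarrow> (\<forall>s. \<forall>\<^sub>F n in sequentially.
     poly_cx (qq (k n)) w \<noteq> 0 \<and> poly_cx (pp (k n)) w \<noteq> s * poly_cx (qq (k n)) w)"

lemma step_num_at:
  "poly_cx (step_num k) x = poly_cx A x * poly_cx (pp k) (x ^ d) + poly_cx C x * poly_cx (qq k) (x ^ d)"
  by (simp add: step_num_def poly_cx_add poly_cx_mult)

lemma step_den_at: "poly_cx (step_den k) x = poly_cx B x * poly_cx (qq k) (x ^ d)"
  by (simp add: step_den_def poly_cx_mult)

lemma step_at:
  assumes "step k l G"
  shows "poly_cx (step_num k) x = poly_cx G x * poly_cx (pp l) x"
    and "poly_cx (step_den k) x = poly_cx G x * poly_cx (qq l) x"
  using assms by (simp_all add: step_def poly_cx_mult)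

lemma avoids_step:
  assumes seq: "primitive_sequence k G" and A: "poly_cx A w \<noteq> 0" and B: "poly_cx B w \<noteq> 0"
    and av: "avoids k (w ^ d)"
  shows "avoids k w"
  unfolding avoids_def
proof
  fix s
  \<comment> \<open>The preimage of \<open>s\<close> under the affine map of the step.\<close>
  define s' where "s' = (s * poly_cx B w - poly_cx C w) / poly_cx A w"
  have "\<forall>\<^sub>F n in sequentially. poly_cx (qq (k n)) (w ^ d) \<noteq> 0 \<and>
      poly_cx (pp (k n)) (w ^ d) \<noteq> s' * poly_cx (qq (k n)) (w ^ d)"
    using av unfolding avoids_def by blast
  hence "\<forall>\<^sub>F n in sequentially. poly_cx (qq (k (Suc n))) w \<noteq> 0 \<and>
      poly_cx (pp (k (Suc n))) w \<noteq> s * poly_cx (qq (k (Suc n))) w"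
  proof eventually_elim
    case (elim n)
    have st: "step (k n) (k (Suc n)) (G n)" using seq by (simp add: primitive_sequence_def)
    have nz: "poly_cx (G n) w \<noteq> 0" "poly_cx (qq (k (Suc n))) w \<noteq> 0"
      using elim B step_at(2)[OF st, of w] unfolding step_den_at by auto
    moreover have "poly_cx (pp (k (Suc n))) w \<noteq> s * poly_cx (qq (k (Suc n))) w"
    proof
      assume "poly_cx (pp (k (Suc n))) w = s * poly_cx (qq (k (Suc n))) w"
      hence "poly_cx (step_num (k n)) w = s * poly_cx (step_den (k n)) w"
        unfolding step_at[OF st] by simp
      hence "poly_cx A w * poly_cx (pp (k n)) (w ^ d) =
          (s * poly_cx B w - poly_cx C w) * poly_cx (qq (k n)) (w ^ d)"
        unfolding step_num_at step_den_at by (simp add: algebra_simps)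
      hence "poly_cx (pp (k n)) (w ^ d) = s' * poly_cx (qq (k n)) (w ^ d)"
        using A by (simp add: s'_def field_simps)
      thus False using elim by blast
    qed
    ultimately show ?case by blast
  qed
  thus "\<forall>\<^sub>F n in sequentially. poly_cx (qq (k n)) w \<noteq> 0 \<and>
      poly_cx (pp (k n)) w \<noteq> s * poly_cx (qq (k n)) w"
    by (rule eventually_sequentially_Suc[THEN iffD1])
qed

lemma avoids_imp_step_num_nonzero:
  assumes A: "poly_cx A w \<noteq> 0" and av: "avoids k (w ^ d)"
  shows "\<forall>\<^sub>F n in sequentially. poly_cx (step_num (k n)) w \<noteq> 0"
proof -
  have "\<forall>\<^sub>F n in sequentially. poly_cx (qq (k n)) (w ^ d) \<noteq> 0 \<and>
      poly_cx (pp (k n)) (w ^ d) \<noteq> (- poly_cx C w / poly_cx A w) * poly_cx (qq (k n)) (w ^ d)"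
    using av unfolding avoids_def by blast
  thus ?thesis
  proof eventually_elim
    case (elim n)
    show ?case
    proof
      assume "poly_cx (step_num (k n)) w = 0"
      hence "poly_cx A w * poly_cx (pp (k n)) (w ^ d) = - poly_cx C w * poly_cx (qq (k n)) (w ^ d)"
        unfolding step_num_at by (simp add: eq_neg_iff_add_eq_0)
      hence "poly_cx (pp (k n)) (w ^ d) = (- poly_cx C w / poly_cx A w) * poly_cx (qq (k n)) (w ^ d)"
        using A by (simp add: field_simps)
      thus False using elim by blast
    qed
  qed
qed

lemma fls_error_value:
  assumes "fls_converges f z"
  shows "fls_value (cf_error k) z = poly_cx (qq k) z * fls_value f z - poly_cx (pp k) z"
proof -
  have z: "z \<noteq> 0" using assms by (simp add: fls_converges_def)
  have 1: "fls_converges (poly_to_fls (qq k)) z" "fls_converges (poly_to_fls (pp k)) z" using z by simp_all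
  show ?thesis unfolding cf_error_def
    using fls_value_diff[OF fls_converges_mult[OF 1(1) assms] 1(2)] fls_value_mult[OF 1(1) assms] z
    by simp
qed

lemma norm_iterated_power_gt_1:
  fixes z :: complex
  assumes "norm z > 1"
  shows "norm (z ^ d ^ i) > 1"
  using assms d_ge_2 by (simp add: norm_power one_less_power)

text \<open>
  Far out on the orbit of \<open>z\<close> the convergents of a primitive sequence converge to \<open>f\<close> without ever
  reaching it.
\<close>

lemma avoids_far_out:
  assumes conv: "fls_conv_radius (fls_of_rat f) > 0" and seq: "primitive_sequence k G"
    and z: "norm z > 1" and A: "\<And>i. poly_cx A (z ^ d ^ i) \<noteq> 0"
  shows "\<exists>J. avoids k (z ^ d ^ J) \<and> poly_cx B (z ^ d ^ J) \<noteq> 0"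
proof -
  define w where "w i = z ^ d ^ i" for i
  have w_Suc: "w (Suc i) = w i ^ d" for i unfolding w_def power_Suc2 power_mult ..
  have st: "step (k n) (k (Suc n)) (G n)" for n using seq by (simp add: primitive_sequence_def)
  have w_inf: "filterlim w at_infinity sequentially"
    unfolding w_def using filterlim_iterated_powers[OF z d_ge_2] .
  let ?e = "\<lambda>n. fls_value (cf_error (k n))" and ?q = "\<lambda>n. poly_cx (qq (k n))"
  have big0: "big (k 0)" by (rule primitive_sequence_big[OF seq])
  have z0: "z \<noteq> 0" using z by auto
  have nru: "\<not> root_of_unity z"
  proof
    assume "root_of_unity z"
    then obtain n where n: "n \<ge> 1" "z ^ n = 1" unfolding root_of_unity_def by blast
    hence "norm z ^ n = 1" by (metis norm_power norm_one)
    moreover have "norm z ^ n > 1" using z n(1) by (intro one_less_power) auto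
    ultimately show False by simp
  qed
  have ev1: "\<forall>\<^sub>F i in sequentially. poly_cx B (w i) \<noteq> 0"
    "\<forall>\<^sub>F i in sequentially. ?q 0 (w i) \<noteq> 0"
    unfolding w_def by (rule eventually_not_root_iterated_powers[OF nru z0 d_ge_2]; simp)+
  have ev2: "\<forall>\<^sub>F i in sequentially. fls_converges f (w i)"
    by (rule eventually_compose_filterlim[OF fls_converges_at_infinity[OF conv] w_inf])
  have ev3: "\<forall>\<^sub>F i in sequentially. ?e 0 (w i) \<noteq> 0"
  proof -
    have "fls_conv_radius (fls_of_rat (cf_error (k 0))) \<ge> fls_conv_radius (fls_of_rat f)"
      unfolding cf_error_def fls_of_rat_diff fls_of_rat_mult
      by (intro fls_conv_radius_diff_ge fls_conv_radius_mult_ge) auto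
    hence r: "fls_conv_radius (fls_of_rat (cf_error (k 0))) > 0" using conv by simp
    have nz: "(of_rat (fls_nth (cf_error (k 0)) (fls_subdegree (cf_error (k 0)))) :: complex) \<noteq> 0"
      by simp
    have "\<forall>\<^sub>F x in at_infinity. ?e 0 x / x powi (- fls_subdegree (cf_error (k 0))) \<noteq> 0"
      using tendsto_imp_eventually_ne[OF fls_value_asymp[OF r] nz] .
    hence "\<forall>\<^sub>F x in at_infinity. ?e 0 x \<noteq> 0" by eventually_elim auto
    thus ?thesis by (rule eventually_compose_filterlim[OF _ w_inf])
  qed
  obtain J where J: "\<And>i. i \<ge> J \<Longrightarrow> poly_cx B (w i) \<noteq> 0 \<and> ?q 0 (w i) \<noteq> 0 \<and>
      fls_converges f (w i) \<and> ?e 0 (w i) \<noteq> 0"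
    using eventually_conj[OF ev1(1) eventually_conj[OF ev1(2) eventually_conj[OF ev2 ev3]]]
    unfolding eventually_sequentially by blast
  \<comment> \<open>The factor \<open>G n\<close> drops out of the quotient of error and
    denominator. The relative error thus telescopes to a product over the orbit times the relative
    error of the first convergent at a point \<open>n\<close> steps farther out.\<close>
  have rec: "?q n (w j) \<noteq> 0 \<and> ?e n (w j) / ?q n (w j) =
      (\<Prod>i<n. poly_cx A (w (j + i)) / poly_cx B (w (j + i))) * (?e 0 (w (j + n)) / ?q 0 (w (j + n)))"
    if "j \<ge> J" for n j
    using that
  proof (induction n arbitrary: j)
    case 0
    thus ?case using J by simp
  next
    case (Suc n)
    have IH: "?q n (w (Suc j)) \<noteq> 0"
      "?e n (w (Suc j)) / ?q n (w (Suc j)) =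
      (\<Prod>i<n. poly_cx A (w (Suc j + i)) / poly_cx B (w (Suc j + i))) * (?e 0 (w (Suc j + n)) / ?q 0 (w (Suc j + n)))"
      using Suc.IH[of "Suc j"] Suc.prems by auto
    have j: "poly_cx B (w j) \<noteq> 0" "fls_converges f (w j)" using J[OF Suc.prems] by auto
    have q: "poly_cx (G n) (w j) * ?q (Suc n) (w j) = poly_cx B (w j) * ?q n (w (Suc j))"
      using step_at(2)[OF st[of n], of "w j"] unfolding step_den_at w_Suc by simp
    have e: "poly_cx (G n) (w j) * ?e (Suc n) (w j) = poly_cx A (w j) * ?e n (w (Suc j))"
      unfolding w_Suc
      by (rule step_value[OF st j(2)]) (use norm_iterated_power_gt_1[OF z] in \<open>simp add: w_def\<close>)
    have nz: "poly_cx (G n) (w j) \<noteq> 0" "?q (Suc n) (w j) \<noteq> 0" using q j(1) IH(1) by auto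
    have "?e (Suc n) (w j) / ?q (Suc n) (w j) =
        (poly_cx (G n) (w j) * ?e (Suc n) (w j)) / (poly_cx (G n) (w j) * ?q (Suc n) (w j))"
      using nz by simp
    also have "\<dots> = (poly_cx A (w j) / poly_cx B (w j)) * (?e n (w (Suc j)) / ?q n (w (Suc j)))"
      unfolding q e by simp
    also have "\<dots> = (\<Prod>i<Suc n. poly_cx A (w (j + i)) / poly_cx B (w (j + i))) *
        (?e 0 (w (j + Suc n)) / ?q 0 (w (j + Suc n)))"
      unfolding IH(2) prod.lessThan_Suc_shift by simp
    finally show ?case using nz(2) by blast
  qed
  define D where "D n = ?e n (w J) / ?q n (w J)" for n
  have D: "D n = (\<Prod>i<n. poly_cx A (w (J + i)) / poly_cx B (w (J + i))) *
      (?e 0 (w (J + n)) / ?q 0 (w (J + n)))" for n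
    unfolding D_def using rec[of J n] by simp
  \<comment> \<open>\<open>A\<close> has no zero on the orbit, so no relative error vanishes; this
    takes care of the value \<open>s\<close> equal to the limit.\<close>
  have Dnz: "D n \<noteq> 0" for n
    unfolding D using J A by (auto simp: w_def)
  have "(\<lambda>n. D (Suc n) / D n) \<longlonglongrightarrow> 0"
  proof -
    have wJ: "filterlim (\<lambda>n. w (J + n)) at_infinity sequentially"
      by (rule filterlim_compose[OF w_inf]) (auto intro!: filterlim_subseq simp: strict_mono_def)
    have "D (Suc n) / D n = (poly_cx A (w (J + n)) / poly_cx B (w (J + n))) *
      (?e 0 (w (J + n) ^ d) / ?q 0 (w (J + n) ^ d)) / (?e 0 (w (J + n)) / ?q 0 (w (J + n)))" for n
    proof -
      have "(\<Prod>i<n. poly_cx A (w (J + i)) / poly_cx B (w (J + i))) \<noteq> 0"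
        using J A by (auto simp: w_def)
      thus ?thesis unfolding D by (simp add: w_Suc mult.assoc)
    qed
    thus ?thesis using filterlim_compose[OF error_ratio_tendsto[OF conv big0] wJ] by simp
  qed
  moreover have "\<forall>\<^sub>F n in sequentially. D n \<noteq> 0" by (intro always_eventually allI Dnz)
  ultimately have D0: "D \<longlonglongrightarrow> 0" by (rule tendsto_zero_ratio[rotated])
  have qnz: "?q n (w J) \<noteq> 0" for n using rec[OF order_refl, of n] by (rule conjunct1)
  have cJ: "fls_converges f (w J)" using J by simp
  have p: "poly_cx (pp (k n)) (w J) = (fls_value f (w J) - D n) * ?q n (w J)" for n
    unfolding D_def fls_error_value[OF cJ] using qnz[of n] by (simp add: diff_divide_distrib)
  have "avoids k (w J)" unfolding avoids_def
  proof
    fix s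
    have "\<forall>\<^sub>F n in sequentially. fls_value f (w J) - D n \<noteq> s"
    proof (cases "s = fls_value f (w J)")
      case True
      thus ?thesis using Dnz by simp
    next
      case False
      have "(\<lambda>n. fls_value f (w J) - D n) \<longlonglongrightarrow> fls_value f (w J) - 0"
        by (intro tendsto_diff tendsto_const D0)
      thus ?thesis by (rule tendsto_imp_eventually_ne) (use False in simp)
    qed
    thus "\<forall>\<^sub>F n in sequentially. ?q n (w J) \<noteq> 0 \<and> poly_cx (pp (k n)) (w J) \<noteq> s * ?q n (w J)"
      by eventually_elim (simp add: p qnz)
  qed
  thus ?thesis using J[of J] unfolding w_def by blast
qed

lemma step_num_eventually_nonzero:
  assumes conv: "fls_conv_radius (fls_of_rat f) > 0" and seq: "primitive_sequence k G"
    and z: "norm z > 1" and A: "\<And>i. poly_cx A (z ^ d ^ i) \<noteq> 0" and B: "poly_cx B z = 0"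
  shows "\<forall>\<^sub>F n in sequentially. poly_cx (step_num (k n)) z \<noteq> 0"
proof -
  define w where "w i = z ^ d ^ i" for i
  have w_Suc: "w (Suc i) = w i ^ d" for i unfolding w_def power_Suc2 power_mult ..
  have st: "step (k n) (k (Suc n)) (G n)" for n using seq by (simp add: primitive_sequence_def)
  obtain J0 where J0: "avoids k (w J0)" "poly_cx B (w J0) \<noteq> 0"
    using avoids_far_out[OF conv seq z A] unfolding w_def by blast
  have w0: "w 0 = z" by (simp add: w_def)
  \<comment> \<open>Walking back along the orbit, points are avoided up to the last root of \<open>B\<close>; from there on
    they are roots of the denominators but not of the numerators.\<close>
  have "(\<forall>\<^sub>F n in sequentially. poly_cx (step_num (k n)) (w i) \<noteq> 0 \<and> poly_cx (step_den (k n)) (w i) = 0)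
      \<or> (avoids k (w i) \<and> poly_cx B (w i) \<noteq> 0)" if "i \<le> J0" for i
    using that
  proof (induction i rule: inc_induct)
    case (step i)
    have Ai: "poly_cx A (w i) \<noteq> 0" using A by (simp add: w_def)
    from step.IH show ?case
    proof
      assume IH: "\<forall>\<^sub>F n in sequentially. poly_cx (step_num (k n)) (w (Suc i)) \<noteq> 0 \<and>
          poly_cx (step_den (k n)) (w (Suc i)) = 0"
      hence "\<forall>\<^sub>F n in sequentially. poly_cx (step_num (k (Suc n))) (w i) \<noteq> 0 \<and>
          poly_cx (step_den (k (Suc n))) (w i) = 0"
      proof eventually_elim
        case (elim n)
        hence "poly_cx (pp (k (Suc n))) (w (Suc i)) \<noteq> 0" "poly_cx (qq (k (Suc n))) (w (Suc i)) = 0"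
          unfolding step_at[OF st[of n]] by auto
        thus ?case using Ai unfolding step_num_at step_den_at w_Suc by simp
      qed
      hence "\<forall>\<^sub>F n in sequentially. poly_cx (step_num (k n)) (w i) \<noteq> 0 \<and> poly_cx (step_den (k n)) (w i) = 0"
        by (rule eventually_sequentially_Suc[THEN iffD1])
      thus ?thesis ..
    next
      assume "avoids k (w (Suc i)) \<and> poly_cx B (w (Suc i)) \<noteq> 0"
      hence av: "avoids k (w (Suc i))" by blast
      show ?thesis
      proof (cases "poly_cx B (w i) = 0")
        case True
        have "\<forall>\<^sub>F n in sequentially. poly_cx (step_num (k n)) (w i) \<noteq> 0"
          by (rule avoids_imp_step_num_nonzero[OF Ai av[unfolded w_Suc]])
        thus ?thesis using True by (simp add: step_den_at)
      next
        case False
        thus ?thesis using avoids_step[OF seq Ai False av[unfolded w_Suc]] by simp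
      qed
    qed
  qed (use J0 in blast)
  \<comment> \<open>At \<open>i = 0\<close> the second alternative is excluded because
    \<open>z\<close> itself is a root of \<open>B\<close>.\<close>
  from this[of 0] have "\<forall>\<^sub>F n in sequentially. poly_cx (step_num (k n)) z \<noteq> 0 \<and> poly_cx (step_den (k n)) z = 0"
    using B by (simp add: w0)
  thus ?thesis by (rule eventually_mono) blast
qed

end

section \<open>Gaps as pairs, and the degree of the cancelled factor\<close>

context mahler_series begin

abbreviation "data \<equiv> (f, A, B, C)"
abbreviation "gap k \<equiv> (uu k, uu (Suc k))"

lemma is_gap_gap: "is_gap f (gap k)"
  unfolding is_gap_iff by blast

lemma is_big_gap_iff: "is_big_gap d data (gap k) \<longleftrightarrow> big k"
proof -
  have d1: "real (d - 1) > 0" using d_ge_2 by simp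
  have "real (uu (Suc k) - uu k) > real (degree A + degree B) / real (d - 1) \<longleftrightarrow>
      real (d - 1) * real (uu (Suc k) - uu k) > real (degree A + degree B)"
    using d1 by (simp only: pos_divide_less_eq mult.commute)
  also have "\<dots> \<longleftrightarrow> big k" unfolding big_def by (simp only: of_nat_less_iff flip: of_nat_mult)
  finally show ?thesis using is_gap_gap[of k] unfolding is_big_gap_def by (simp only: split_conv simp_thms)
qed

lemma next_num_gap: "next_num d data (uu k) = step_num k"
  unfolding next_num_def step_num_def by simp

text \<open>Equality of the fractions produces the cancelled factor because the convergent with
  index \<open>l\<close> is in lowest terms.\<close>

lemma direct_successor_iff: "direct_successor d data (gap k) (gap l) \<longleftrightarrow> (\<exists>G. step k l G)"
proof -
  have "direct_successor d data (gap k) (gap l) \<longleftrightarrow> pp l * step_den k = step_num k * qq l"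
    unfolding direct_successor_def split_conv conv_num_degree conv_den_degree next_num_gap
      step_den_def[symmetric] using is_gap_gap by (simp add: eq_fract)
  also have "\<dots> \<longleftrightarrow> (\<exists>G. step k l G)"
  proof
    assume "pp l * step_den k = step_num k * qq l"
    hence "step_den k * pp l = step_num k * qq l" by (simp only: mult.commute)
    from coprime_proportional[OF coprime_convergent qq_nonzero this]
    show "\<exists>G. step k l G" unfolding step_def by metis
  qed (auto simp: step_def)
  finally show ?thesis .
qed

lemma is_primitive_gap:
  assumes "primitive k"
  shows "is_primitive_gap d data (gap k)"
  unfolding is_primitive_gap_def
proof
  show "is_big_gap d data (gap k)" using assms by (simp add: primitive_def is_big_gap_iff)
  show "\<not> (\<exists>h. h \<noteq> gap k \<and> is_big_gap d data h \<and> direct_successor d data h (gap k))"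
  proof
    assume "\<exists>h. h \<noteq> gap k \<and> is_big_gap d data h \<and> direct_successor d data h (gap k)"
    then obtain u v where h: "is_big_gap d data (u, v)" "direct_successor d data (u, v) (gap k)" by auto
    hence "is_gap f (u, v)" by (simp add: is_big_gap_def)
    then obtain j where j: "(u, v) = gap j" unfolding is_gap_iff by blast
    show False using h assms unfolding j is_big_gap_iff direct_successor_iff primitive_def by blast
  qed
qed

lemma is_primitive_gap_sequence:
  assumes "primitive_sequence k G"
  shows "is_primitive_gap_sequence d data (\<lambda>n. gap (k n))"
  using assms is_primitive_gap direct_successor_iff
  unfolding is_primitive_gap_sequence_def primitive_sequence_def by blast

text \<open>The assumptions on \<open>B\<close> become regularity at its nonzero roots. A root of
  unity has a cyclotomic minimal polynomial dividing \<open>B\<close>, so the coprimality assumption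
  applies. Any other nonzero root belongs to \<open>B\<^sub>m\<close>; it may lie inside the unit
  disc, out of reach of the series, and is exchanged for a conjugate of modulus above 1.\<close>

theorem degree_eventually_const:
  assumes conv: "fls_conv_radius (fls_of_rat f) > 0"
    and A_0: "\<not> monom 1 1 dvd A"
    and Bm: "is_noncyclotomic_part B B\<^sub>m"
    and cop: "\<And>t. degree B\<^sub>m > 0 \<Longrightarrow> coprime B\<^sub>m (poly_compose_power A (d ^ t))"
    and out: "\<And>P. degree B\<^sub>m > 0 \<Longrightarrow> irreducible P \<Longrightarrow> P dvd B\<^sub>m \<Longrightarrow> \<exists>z. poly_cx P z = 0 \<and> norm z > 1"
    and cyc: "\<And>H. (\<exists>P. is_cyclotomic P \<and> P dvd B) \<Longrightarrow> is_primitive_gap_sequence d data H \<Longrightarrow>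
        \<forall>\<^sub>F n in sequentially. \<forall>P. is_cyclotomic P \<and> P dvd B \<longrightarrow> coprime (next_num d data (fst (H n))) P"
    and seq: "primitive_sequence k G"
  shows "\<exists>N c. \<forall>n\<ge>N. degree (G n) = c"
proof -
  have st: "step (k n) (k (Suc n)) (G n)" for n using seq by (simp add: primitive_sequence_def)
  have reg: "\<forall>\<^sub>F n in sequentially. poly_cx (step_num (k n)) x \<noteq> 0"
    if x: "x \<noteq> 0" "poly_cx B x = 0" for x
  proof (cases "root_of_unity x")
    case True
    then obtain m where m: "m \<ge> 1" "x ^ m = 1" by (auto simp: root_of_unity_def)
    obtain P where P: "irreducible P" "poly_cx P x = 0" "P dvd B" "lead_coeff P = 1"
      using minimal_polynomial[OF B_nonzero x(2)] .
    have "P dvd monom 1 m - 1" using irreducible_dvd_iff_root[OF P(1,2), of "monom 1 m - 1"] m by simp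
    hence cP: "is_cyclotomic P \<and> P dvd B" using P m unfolding is_cyclotomic_def by blast
    hence "\<exists>P. is_cyclotomic P \<and> P dvd B" by (rule exI)
    from cyc[OF this is_primitive_gap_sequence[OF seq]]
    have "\<forall>\<^sub>F n in sequentially. coprime (step_num (k n)) P"
      unfolding fst_conv next_num_gap using cP by (auto elim: eventually_mono)
    thus ?thesis
    proof eventually_elim
      case (elim n)
      hence "coprime P (step_num (k n))" by (simp add: coprime_commute)
      thus ?case using P(2) by (rule coprime_no_common_root)
    qed
  next
    case False
    obtain j M where M: "\<And>P. P \<in># M \<Longrightarrow> is_cyclotomic P" "B = monom 1 j * B\<^sub>m * prod_mset M"
      using Bm unfolding is_noncyclotomic_part_def by blast
    have "poly_cx (prod_mset M) x \<noteq> 0" using M(1)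
    proof (induction M)
      case (add P M)
      have "is_cyclotomic P" using add.prems by simp
      then obtain m where m: "m \<ge> 1" "P dvd monom 1 m - 1" unfolding is_cyclotomic_def by blast
      have "poly_cx P x \<noteq> 0"
      proof
        assume "poly_cx P x = 0"
        hence "poly_cx (monom 1 m - 1) x = 0" by (rule poly_cx_dvd[OF m(2)])
        thus False using False m(1) unfolding root_of_unity_def by simp
      qed
      moreover have "poly_cx (prod_mset M) x \<noteq> 0" using add by simp
      ultimately show ?case by (simp add: poly_cx_mult)
    qed simp
    hence Bmx: "poly_cx B\<^sub>m x = 0" using x unfolding M(2) by (simp add: poly_cx_mult poly_monom)
    have Bm0: "B\<^sub>m \<noteq> 0" using B_nonzero M(2) by auto
    have deg: "degree B\<^sub>m > 0"
    proof (rule ccontr)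
      assume "\<not> degree B\<^sub>m > 0"
      then obtain c where "B\<^sub>m = [:c:]" using degree_eq_zeroE by blast
      thus False using Bmx Bm0 by (simp add: map_poly_pCons)
    qed
    obtain P where P: "irreducible P" "poly_cx P x = 0" "P dvd B\<^sub>m"
      using minimal_polynomial[OF Bm0 Bmx] by blast
    obtain z where z: "poly_cx P z = 0" "norm z > 1" using out[OF deg P(1,3)] by blast
    have Bmz: "poly_cx B\<^sub>m z = 0" by (rule poly_cx_dvd[OF P(3) z(1)])
    have "poly_cx A (z ^ d ^ i) \<noteq> 0" for i
      using coprime_no_common_root[OF cop[OF deg] Bmz, of i] by simp
    moreover have "poly_cx B z = 0" using Bmz unfolding M(2) by (simp add: poly_cx_mult)
    ultimately have "\<forall>\<^sub>F n in sequentially. poly_cx (step_num (k n)) z \<noteq> 0"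
      by (rule step_num_eventually_nonzero[OF conv seq z(2)])
    \<comment> \<open>A rational polynomial vanishes at \<open>x\<close> exactly if \<open>P\<close>
      divides it, hence exactly if it vanishes at \<open>z\<close>.\<close>
    thus ?thesis
      by (rule eventually_mono) (use irreducible_dvd_iff_root[OF P(1,2)] irreducible_dvd_iff_root[OF P(1) z(1)] in blast)
  qed
  have "poly_cx A 0 \<noteq> 0"
  proof
    assume "poly_cx A 0 = 0"
    hence "of_rat (poly A 0) = (0 :: complex)" using poly_of_rat_of_rat[of A 0, where 'a = complex] by simp
    hence "poly A 0 = 0" by simp
    hence "[:- 0, 1:] dvd A" by (subst (asm) poly_eq_0_iff_dvd)
    thus False using A_0 by (simp add: monom_Suc monom_0)
  qed
  interpret coprime_iteration_regular d A B C "\<lambda>n. pp (k n)" "\<lambda>n. qq (k n)" G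
  proof unfold_locales
    fix n
    show "A * poly_compose_power (pp (k n)) d + C * poly_compose_power (qq (k n)) d = G n * pp (k (Suc n))"
      "B * poly_compose_power (qq (k n)) d = G n * qq (k (Suc n))"
      using st[of n] unfolding step_def step_num_def step_den_def by auto
  next
    fix x :: complex assume "x \<noteq> 0" "poly_cx B x = 0"
    moreover have "step_num (k n) = G n * pp (k (Suc n))" for n using st[of n] by (simp add: step_def)
    ultimately show "\<forall>\<^sub>F n in sequentially. poly_cx (G n * pp (k (Suc n))) x \<noteq> 0" using reg[of x] by simp
  qed (use d_ge_2 coprime_convergent \<open>poly_cx A 0 \<noteq> 0\<close> in simp_all)
  show ?thesis by (rule degree_common_factor_eventually_const)
qed

end

section \<open>Irrationality exponents\<close>

definition approximations :: "real \<Rightarrow> real \<Rightarrow> (int \<times> int) set" where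
  "approximations \<alpha> \<mu> = {(p, q). q \<ge> 1 \<and> \<bar>\<alpha> - of_int p / of_int q\<bar> < of_int q powr (- \<mu>)}"

lemma irrationality_exponent_altdef:
  "irrationality_exponent \<alpha> = (SUP \<mu> \<in> {\<mu>. infinite (approximations \<alpha> \<mu>)}. ereal \<mu>)"
  unfolding irrationality_exponent_def approximations_def ..

text \<open>\<open>K\<close> bounds the admissible distance for all \<open>q\<close> up to
  \<open>q0\<close> at once, whatever the sign of the exponent, so numerators are bounded too. An
  infinite set of approximations therefore has unbounded denominators.\<close>

lemma finite_approximations_bounded:
  "finite {x \<in> approximations \<alpha> \<mu>. snd x \<le> q0}"
proof -
  define K where "K = (\<Sum>q\<in>{1..q0}. of_int q powr (- \<mu>))"
  define N where "N = \<lceil>of_int q0 * (\<bar>\<alpha>\<bar> + K)\<rceil>"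
  have "{x \<in> approximations \<alpha> \<mu>. snd x \<le> q0} \<subseteq> {-N..N} \<times> {1..q0}"
  proof
    fix x assume "x \<in> {x \<in> approximations \<alpha> \<mu>. snd x \<le> q0}"
    then obtain p q where x: "x = (p, q)" and q: "q \<ge> 1" "q \<le> q0"
      and lt: "\<bar>\<alpha> - of_int p / of_int q\<bar> < of_int q powr (- \<mu>)"
      by (auto simp: approximations_def)
    have "of_int q powr (- \<mu>) \<le> K" unfolding K_def
      using q by (intro member_le_sum[of q "{1..q0}" "\<lambda>q. of_int q powr (- \<mu>)"]) auto
    hence "\<bar>of_int p / of_int q\<bar> \<le> \<bar>\<alpha>\<bar> + K" using lt by linarith
    hence "\<bar>of_int p\<bar> \<le> of_int q * (\<bar>\<alpha>\<bar> + K)"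
      using q by (simp add: abs_divide divide_le_eq mult.commute)
    also have "\<dots> \<le> of_int q0 * (\<bar>\<alpha>\<bar> + K)"
      using q by (intro mult_right_mono) (auto simp: K_def intro!: add_nonneg_nonneg sum_nonneg)
    finally have "real_of_int \<bar>p\<bar> \<le> of_int q0 * (\<bar>\<alpha>\<bar> + K)" by simp
    hence "\<bar>p\<bar> \<le> N" unfolding N_def by linarith
    thus "x \<in> {-N..N} \<times> {1..q0}" using q by (auto simp: x)
  qed
  thus ?thesis by (rule finite_subset) simp
qed

lemma irrationality_exponent_le:
  assumes "\<And>p q :: int. q \<ge> q0 \<Longrightarrow> of_int q powr (- \<nu>) \<le> \<bar>\<alpha> - of_int p / of_int q\<bar>"
  shows "irrationality_exponent \<alpha> \<le> ereal \<nu>"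
  unfolding irrationality_exponent_altdef
proof (rule SUP_least)
  fix \<mu> assume \<mu>: "\<mu> \<in> {\<mu>. infinite (approximations \<alpha> \<mu>)}"
  show "ereal \<mu> \<le> ereal \<nu>"
  proof (rule ccontr)
    assume "\<not> ereal \<mu> \<le> ereal \<nu>"
    hence "\<nu> < \<mu>" by simp
    have "approximations \<alpha> \<mu> \<subseteq> {x \<in> approximations \<alpha> \<mu>. snd x \<le> q0}"
    proof
      fix x assume "x \<in> approximations \<alpha> \<mu>"
      then obtain p q where x: "x = (p, q)" and pq: "(p, q) \<in> approximations \<alpha> \<mu>" by (cases x) auto
      hence q: "q \<ge> 1" "\<bar>\<alpha> - of_int p / of_int q\<bar> < of_int q powr (- \<mu>)"
        by (auto simp: approximations_def)
      have "of_int q powr (- \<mu>) \<le> of_int q powr (- \<nu>)"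
        using q(1) \<open>\<nu> < \<mu>\<close> by (intro powr_mono) auto
      hence "\<not> q \<ge> q0" using assms[of q p] q(2) by linarith
      thus "x \<in> {x \<in> approximations \<alpha> \<mu>. snd x \<le> q0}" using pq by (simp add: x)
    qed
    hence "finite (approximations \<alpha> \<mu>)" using finite_approximations_bounded finite_subset by blast
    thus False using \<mu> by simp
  qed
qed

lemma irrationality_exponent_ge:
  assumes "\<And>\<mu>. \<mu> < \<nu> \<Longrightarrow> infinite (approximations \<alpha> \<mu>)"
  shows "ereal \<nu> \<le> irrationality_exponent \<alpha>"
proof (rule dense_le)
  fix x assume "x < ereal \<nu>"
  then obtain \<mu> where \<mu>: "x < ereal \<mu>" "ereal \<mu> < ereal \<nu>" using ereal_dense2 by blast
  have "ereal \<mu> \<le> irrationality_exponent \<alpha>" unfolding irrationality_exponent_altdef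
    by (rule SUP_upper) (use assms \<mu> in simp)
  thus "x \<le> irrationality_exponent \<alpha>" using \<mu>(1) by simp
qed

text \<open>Neither signs nor lowest terms are prescribed for \<open>P\<close> and \<open>Q\<close>:
  the sign of \<open>Q\<close> moves to the numerator, and unbounded denominators alone yield
  infinitely many pairs.\<close>

lemma infinite_approximationsI:
  fixes P Q :: "nat \<Rightarrow> int"
  assumes Q: "filterlim (\<lambda>t. \<bar>real_of_int (Q t)\<bar>) at_top sequentially"
    and lt: "\<forall>\<^sub>F t in sequentially. \<bar>\<alpha> - of_int (P t) / of_int (Q t)\<bar> < \<bar>of_int (Q t)\<bar> powr (- \<mu>)"
  shows "infinite (approximations \<alpha> \<mu>)"
proof
  assume fin: "finite (approximations \<alpha> \<mu>)"
  define M where "M = (\<Sum>x\<in>approximations \<alpha> \<mu>. \<bar>real_of_int (snd x)\<bar>)"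
  have "\<forall>\<^sub>F t in sequentially. \<bar>real_of_int (Q t)\<bar> > max M 1"
    using Q unfolding filterlim_at_top_dense by blast
  with lt have "\<forall>\<^sub>F t in sequentially. False"
  proof eventually_elim
    case (elim t)
    have "of_int (sgn (Q t) * P t) / real_of_int \<bar>Q t\<bar> = of_int (P t) / of_int (Q t)"
      using elim(2) by (cases "Q t" "0 :: int" rule: linorder_cases) auto
    hence "(sgn (Q t) * P t, \<bar>Q t\<bar>) \<in> approximations \<alpha> \<mu>"
      using elim by (auto simp: approximations_def)
    from member_le_sum[OF this, of "\<lambda>x. \<bar>real_of_int (snd x)\<bar>"] fin
    have "\<bar>real_of_int (Q t)\<bar> \<le> M" unfolding M_def by simp
    thus False using elim by simp
  qed
  thus False by simp
qed

text \<open>Scaling by \<open>m / n\<close> changes the quality of an approximation by the constant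
  \<open>c\<close> only; beyond \<open>q1\<close> this is absorbed by any loss in the
  exponent.\<close>

lemma infinite_approximations_scale:
  assumes inf: "infinite (approximations \<alpha> \<mu>)" and r: "r \<noteq> 0" and lt: "\<mu>' < \<mu>"
  shows "infinite (approximations (of_rat r * \<alpha>) \<mu>')"
proof
  assume fin: "finite (approximations (of_rat r * \<alpha>) \<mu>')"
  obtain m n where mn: "quotient_of r = (m, n)" by (cases "quotient_of r")
  hence n: "n > 0" and r_eq: "r = of_int m / of_int n"
    using quotient_of_denom_pos quotient_of_div by blast+
  have m: "m \<noteq> 0" using r r_eq by auto
  define c where "c = \<bar>real_of_int m / of_int n\<bar> * of_int n powr \<mu>'"
  define q1 where "q1 = (\<bar>c\<bar> + 1) powr (1 / (\<mu> - \<mu>'))"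
  have q1: "q powr (\<mu> - \<mu>') > c" if "q \<ge> q1" for q
  proof -
    have "q1 powr (\<mu> - \<mu>') = \<bar>c\<bar> + 1" unfolding q1_def powr_powr using lt by simp
    moreover have "q1 powr (\<mu> - \<mu>') \<le> q powr (\<mu> - \<mu>')"
      using that lt by (intro powr_mono2) (auto simp: q1_def)
    ultimately show ?thesis by linarith
  qed
  have infS: "infinite (approximations \<alpha> \<mu> - {x \<in> approximations \<alpha> \<mu>. snd x \<le> \<lceil>q1\<rceil>})"
    using inf finite_approximations_bounded by (rule Diff_infinite_finite[rotated])
  have sub: "(\<lambda>(p, q). (m * p, n * q)) ` (approximations \<alpha> \<mu> - {x \<in> approximations \<alpha> \<mu>. snd x \<le> \<lceil>q1\<rceil>})
      \<subseteq> approximations (of_rat r * \<alpha>) \<mu>'"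
  proof
    fix y assume "y \<in> (\<lambda>(p, q). (m * p, n * q)) `
      (approximations \<alpha> \<mu> - {x \<in> approximations \<alpha> \<mu>. snd x \<le> \<lceil>q1\<rceil>})"
    then obtain x where x: "y = (case x of (p, q) \<Rightarrow> (m * p, n * q))"
      "x \<in> approximations \<alpha> \<mu> - {x \<in> approximations \<alpha> \<mu>. snd x \<le> \<lceil>q1\<rceil>}" by (rule imageE)
    obtain p q where pq': "x = (p, q)" by (cases x)
    have y: "y = (m * p, n * q)" and pq: "(p, q) \<in> approximations \<alpha> \<mu>" "q > \<lceil>q1\<rceil>"
      using x unfolding pq' by auto
    have q: "q \<ge> 1" "\<bar>\<alpha> - of_int p / of_int q\<bar> < of_int q powr (- \<mu>)" "of_int q \<ge> q1"
      using pq by (auto simp: approximations_def) linarith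
    have "real_of_rat r * \<alpha> - of_int (m * p) / of_int (n * q) =
        (of_int m / of_int n) * (\<alpha> - of_int p / of_int q)"
      by (simp add: r_eq of_rat_divide right_diff_distrib)
    hence "\<bar>real_of_rat r * \<alpha> - of_int (m * p) / of_int (n * q)\<bar> =
        \<bar>of_int m / of_int n\<bar> * \<bar>\<alpha> - of_int p / of_int q\<bar>" by (simp only: abs_mult)
    also have "\<dots> \<le> \<bar>of_int m / of_int n\<bar> * of_int q powr (- \<mu>)"
      using q by (intro mult_left_mono) auto
    also have "\<dots> = c * (of_int n powr (- \<mu>') * of_int q powr (- \<mu>))"
      using n by (simp add: c_def powr_minus)
    also have "\<dots> < of_int q powr (\<mu> - \<mu>') * (of_int n powr (- \<mu>') * of_int q powr (- \<mu>))"
      using q1[OF q(3)] q(1) n by (intro mult_strict_right_mono) auto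
    also have "\<dots> = of_int (n * q) powr (- \<mu>')"
    proof -
      have e: "real_of_int q powr (\<mu> - \<mu>') * of_int q powr (- \<mu>) = of_int q powr (- \<mu>')"
        by (simp flip: powr_add)
      have "real_of_int (n * q) powr (- \<mu>') = of_int n powr (- \<mu>') * of_int q powr (- \<mu>')"
        using q(1) n by (simp add: powr_mult)
      also have "\<dots> = of_int q powr (\<mu> - \<mu>') * (of_int n powr (- \<mu>') * of_int q powr (- \<mu>))"
        unfolding e[symmetric] by (simp only: mult_ac)
      finally show ?thesis ..
    qed
    finally have "\<bar>real_of_rat r * \<alpha> - of_int (m * p) / of_int (n * q)\<bar> < of_int (n * q) powr (- \<mu>')" .
    moreover have "n * q > 0" using n q(1) by (intro mult_pos_pos) auto
    hence "n * q \<ge> 1" by linarith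
    ultimately show "y \<in> approximations (of_rat r * \<alpha>) \<mu>'"
      unfolding approximations_def y by blast
  qed
  have inj: "inj (\<lambda>(p :: int, q :: int). (m * p, n * q))"
    using m n by (auto simp: inj_on_def)
  show False
    using finite_imageD[OF finite_subset[OF sub fin] inj_on_subset[OF inj subset_UNIV]] infS by simp
qed

lemma irrationality_exponent_scale_ge:
  assumes "r \<noteq> 0"
  shows "irrationality_exponent \<alpha> \<le> irrationality_exponent (of_rat r * \<alpha>)"
  unfolding irrationality_exponent_altdef[of \<alpha>]
proof (rule SUP_least)
  fix \<mu> assume "\<mu> \<in> {\<mu>. infinite (approximations \<alpha> \<mu>)}"
  thus "ereal \<mu> \<le> irrationality_exponent (of_rat r * \<alpha>)"
    using infinite_approximations_scale[OF _ assms] by (intro irrationality_exponent_ge) blast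
qed

lemma irrationality_exponent_scale:
  assumes "r \<noteq> 0"
  shows "irrationality_exponent (of_rat r * \<alpha>) = irrationality_exponent \<alpha>"
proof (rule antisym)
  have "irrationality_exponent (of_rat r * \<alpha>) \<le> irrationality_exponent (of_rat (inverse r) * (of_rat r * \<alpha>))"
    using assms by (intro irrationality_exponent_scale_ge) simp
  thus "irrationality_exponent (of_rat r * \<alpha>) \<le> irrationality_exponent \<alpha>"
    using assms by (simp add: of_rat_inverse flip: mult.assoc)
qed (rule irrationality_exponent_scale_ge[OF assms])

text \<open>The integer \<open>p * Q - q * P\<close> is nonzero, hence at least 1 in absolute value.
  At most half of that can come from the error of \<open>P / Q\<close>; the rest must come from
  \<open>p / q\<close>.\<close>

lemma distinct_approximation_bound:
  fixes P Q p q :: int and \<alpha> :: real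
  assumes "q \<ge> 1" "of_int q * \<bar>of_int Q * \<alpha> - of_int P\<bar> \<le> 1 / 2" "p * Q \<noteq> q * P"
  shows "1 / (2 * of_int q * \<bar>of_int Q\<bar>) \<le> \<bar>\<alpha> - of_int p / of_int q\<bar>"
proof -
  have "1 \<le> \<bar>p * Q - q * P\<bar>" using assms(3) by simp
  hence "1 \<le> real_of_int \<bar>p * Q - q * P\<bar>" by (simp only: of_int_1_le_iff)
  also have "\<dots> = \<bar>of_int q * (of_int Q * \<alpha> - of_int P) - of_int Q * (of_int q * \<alpha> - of_int p)\<bar>"
    by (simp add: algebra_simps)
  also have "\<dots> \<le> of_int q * \<bar>of_int Q * \<alpha> - of_int P\<bar> + \<bar>of_int Q\<bar> * \<bar>of_int q * \<alpha> - of_int p\<bar>"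
    by (rule order_trans[OF abs_triangle_ineq4]) (use assms(1) in \<open>simp add: abs_mult\<close>)
  also have "\<dots> \<le> 1 / 2 + \<bar>of_int Q\<bar> * (of_int q * \<bar>\<alpha> - of_int p / of_int q\<bar>)"
  proof -
    have "of_int q * \<alpha> - of_int p = of_int q * (\<alpha> - of_int p / of_int q)"
      using assms(1) by (simp add: right_diff_distrib)
    hence "\<bar>of_int q * \<alpha> - of_int p\<bar> = of_int q * \<bar>\<alpha> - of_int p / of_int q\<bar>"
      using assms(1) by (simp add: abs_mult)
    thus ?thesis using assms(2) by simp
  qed
  finally have *: "1 / 2 \<le> \<bar>of_int Q\<bar> * (of_int q * \<bar>\<alpha> - of_int p / of_int q\<bar>)" by simp
  hence "Q \<noteq> 0" by auto
  thus ?thesis using * assms(1) by (simp add: divide_le_eq mult_ac)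
qed

section \<open>Approximation schemes with two indices\<close>

lemma tendsto_of_nat_div_power:
  assumes "(d :: nat) \<ge> 2"
  shows "(\<lambda>t. of_nat t / real d ^ t) \<longlonglongrightarrow> 0"
  using powser_times_n_limit_0[of "1 / real d"] assms by (simp add: power_one_over field_simps)

text \<open>Terms \<open>m * d ^ i\<close> with bounded perturbation sum to
  \<open>m * d ^ t / (d - 1)\<close> up to \<open>O(t)\<close>. This geometric series is the origin
  of the denominators \<open>d - 1\<close> in the growth rates.\<close>

lemma tendsto_sum_div_power:
  fixes y :: "nat \<Rightarrow> real"
  assumes d: "(d :: nat) \<ge> 2" and lim: "(\<lambda>i. y i - m * real d ^ i) \<longlonglongrightarrow> c"
  shows "(\<lambda>t. (\<Sum>i<t. y i) / real d ^ t) \<longlonglongrightarrow> m / (real d - 1)"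
proof -
  define z where "z i = y i - m * real d ^ i" for i
  have "Bseq z" unfolding z_def using lim by (intro convergent_imp_Bseq convergentI)
  then obtain K where K: "\<And>i. \<bar>z i\<bar> \<le> K" unfolding Bseq_def by (metis real_norm_def)
  have dp: "real d ^ t > 0" "real d - 1 > 0" for t using d by auto
  have "(\<lambda>t. (\<Sum>i<t. z i) / real d ^ t) \<longlonglongrightarrow> 0"
  proof (rule tendsto_rabs_zero_cancel, rule tendsto_sandwich[OF _ _ tendsto_const])
    show "(\<lambda>t. K * (of_nat t / real d ^ t)) \<longlonglongrightarrow> 0"
      using tendsto_mult_right_zero[OF tendsto_of_nat_div_power[OF d], of K] .
    show "\<forall>\<^sub>F t in sequentially. \<bar>(\<Sum>i<t. z i) / real d ^ t\<bar> \<le> K * (of_nat t / real d ^ t)"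
    proof (intro always_eventually allI)
      fix t
      have "\<bar>\<Sum>i<t. z i\<bar> \<le> (\<Sum>i<t. \<bar>z i\<bar>)" by (rule sum_abs)
      also have "\<dots> \<le> (\<Sum>i<t. K)" by (intro sum_mono K)
      finally show "\<bar>(\<Sum>i<t. z i) / real d ^ t\<bar> \<le> K * (of_nat t / real d ^ t)"
        using dp(1)[of t] by (simp add: abs_divide divide_right_mono mult.commute)
    qed
  qed simp
  moreover have "(\<lambda>t. m / (real d - 1) * (1 - (1 / real d) ^ t)) \<longlonglongrightarrow> m / (real d - 1) * (1 - 0)"
    using d by (intro tendsto_mult tendsto_const tendsto_diff LIMSEQ_realpow_zero) auto
  ultimately have "(\<lambda>t. (\<Sum>i<t. z i) / real d ^ t + m / (real d - 1) * (1 - (1 / real d) ^ t)) \<longlonglongrightarrow>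
      0 + m / (real d - 1) * (1 - 0)" by (rule tendsto_add)
  moreover have "(\<Sum>i<t. z i) / real d ^ t + m / (real d - 1) * (1 - (1 / real d) ^ t) = (\<Sum>i<t. y i) / real d ^ t" for t
  proof -
    have "(\<Sum>i<t. real d ^ i) = (real d ^ t - 1) / (real d - 1)"
      using d by (intro geometric_sum) simp
    hence "(\<Sum>i<t. y i) = (\<Sum>i<t. z i) + m * ((real d ^ t - 1) / (real d - 1))"
      by (simp add: z_def sum_subtractf flip: sum_distrib_left)
    moreover have "(real d ^ t - 1) / real d ^ t = 1 - (1 / real d) ^ t"
      using dp(1)[of t] by (simp add: diff_divide_distrib power_one_over)
    ultimately show ?thesis
      by (simp add: add_divide_distrib) (simp add: divide_inverse mult_ac)
  qed
  ultimately show ?thesis by simp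
qed

lemma filterlim_real_nat_power:
  assumes "d \<ge> 2"
  shows "filterlim (\<lambda>t. real d ^ t) at_top sequentially"
proof -
  have "filterlim (\<lambda>t. norm (real d ^ t)) at_top sequentially"
    by (rule filterlim_at_infinity_imp_norm_at_top[OF filterlim_realpow_sequentially_gt1])
       (use assms in simp)
  thus ?thesis by simp
qed

text \<open>For each \<open>k\<close>, denominators and errors have logarithms
  \<open>\<beta> * d ^ t\<close> times \<open>u k\<close> and \<open>- u (Suc k)\<close>, up to an
  amount \<open>M\<close> common to all \<open>k\<close>; only the onset in \<open>t\<close> may
  depend on \<open>k\<close>. \<open>red_ge\<close> limits what reduction to lowest terms can
  save.\<close>

locale approximation_scheme =
  fixes \<alpha> \<beta> M L :: real and d :: nat and u :: "nat \<Rightarrow> real" and P Q :: "nat \<Rightarrow> nat \<Rightarrow> int"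
  assumes \<beta>: "\<beta> > 0" and d: "d \<ge> 2" and M: "M \<ge> 0"
    and u_less: "\<And>k. u k < u (Suc k)" and u_lim: "filterlim u at_top sequentially"
    and den_nonzero: "\<And>k. \<forall>\<^sub>F t in sequentially. Q k t \<noteq> 0"
    and den_le: "\<And>k. \<forall>\<^sub>F t in sequentially. \<bar>of_int (Q k t)\<bar> \<le> exp (\<beta> * real d ^ t * (u k + M))"
    and den_ge: "\<And>k. \<forall>\<^sub>F t in sequentially. exp (\<beta> * real d ^ t * (u k - M)) \<le> \<bar>of_int (Q k t)\<bar>"
    and err_le: "\<And>k. \<forall>\<^sub>F t in sequentially.
      \<bar>of_int (Q k t) * \<alpha> - of_int (P k t)\<bar> \<le> exp (- (\<beta> * real d ^ t * (u (Suc k) - M)))"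
    and err_ge: "\<And>k. \<forall>\<^sub>F t in sequentially.
      exp (- (\<beta> * real d ^ t * (u (Suc k) + M))) \<le> \<bar>of_int (Q k t) * \<alpha> - of_int (P k t)\<bar>"
    and red_ge: "\<And>k. \<forall>\<^sub>F t in sequentially. \<forall>p q. q \<ge> 1 \<and> p * Q k t = q * P k t \<longrightarrow>
      exp (\<beta> * real d ^ t * (u k - M)) \<le> real_of_int q"
    and upper: "\<And>\<epsilon>. \<epsilon> > 0 \<Longrightarrow> \<forall>\<^sub>F k in sequentially. u (Suc k) / u k < L + \<epsilon>"
    and lower: "\<And>\<epsilon>. \<epsilon> > 0 \<Longrightarrow> \<exists>\<^sub>F k in sequentially. u (Suc k) / u k > L - \<epsilon>"
begin

lemma eventually_u_gt: "\<forall>\<^sub>F k in sequentially. u k > c"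
  using u_lim unfolding filterlim_at_top_dense by blast

lemma u_mono: "j \<le> k \<Longrightarrow> u j \<le> u k"
  by (rule lift_Suc_mono_le[of u]) (auto intro: less_imp_le u_less)

lemma L_ge_1: "L \<ge> 1"
proof (rule ccontr)
  assume "\<not> L \<ge> 1"
  hence "\<forall>\<^sub>F k in sequentially. u (Suc k) / u k < L + (1 - L)" by (intro upper) simp
  with eventually_u_gt[of 0] have "\<forall>\<^sub>F k :: nat in sequentially. False"
  proof eventually_elim
    case (elim k)
    thus ?case using u_less[of k] by (simp add: divide_less_eq)
  qed
  thus False by simp
qed

lemma approximation_error:
  assumes "Q k t \<noteq> 0"
  shows "\<bar>\<alpha> - of_int (P k t) / of_int (Q k t)\<bar> = \<bar>of_int (Q k t) * \<alpha> - of_int (P k t)\<bar> / \<bar>of_int (Q k t)\<bar>"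
proof -
  have "\<alpha> - of_int (P k t) / of_int (Q k t) = (of_int (Q k t) * \<alpha> - of_int (P k t)) / of_int (Q k t)"
    using assms by (simp add: diff_divide_distrib)
  thus ?thesis by (simp only: abs_divide)
qed

text \<open>A single \<open>k\<close> with ratio close to \<open>L\<close> and with
  \<open>u k\<close> large against \<open>M\<close> suffices; its iterates supply infinitely many
  approximations as \<open>t\<close> grows.\<close>

lemma exponent_ge: "ereal (1 + L) \<le> irrationality_exponent \<alpha>"
proof (rule irrationality_exponent_ge)
  fix \<mu>0 assume "\<mu>0 < 1 + L"
  \<comment> \<open>A nonnegative exponent makes the power of the denominator monotone; going down
    to \<open>\<mu>0\<close> only enlarges the set of approximations.\<close>
  define \<mu> where "\<mu> = max \<mu>0 0"
  have \<mu>: "\<mu> \<ge> 0" "\<mu> < 1 + L" using \<open>\<mu>0 < 1 + L\<close> L_ge_1 by (auto simp: \<mu>_def)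
  define \<epsilon> where "\<epsilon> = (1 + L - \<mu>) / 2"
  have \<epsilon>: "\<epsilon> > 0" "1 + L = \<mu> + 2 * \<epsilon>" using \<mu> by (auto simp: \<epsilon>_def)
  obtain k where k: "u (Suc k) / u k > L - \<epsilon>" "u k > M" "u k > (\<mu> + 2) * M / \<epsilon>"
    using frequently_ex[OF frequently_eventually_conj[OF lower[OF \<epsilon>(1)] eventually_u_gt[of "max M ((\<mu> + 2) * M / \<epsilon>)"]]]
    by auto
  have uk: "u k > 0" using k M by linarith
  have "(L - \<epsilon>) * u k < u (Suc k)" using k(1) uk by (simp add: pos_less_divide_eq)
  moreover have "(\<mu> + 2) * M < \<epsilon> * u k" using k(3) \<epsilon>(1) by (simp add: pos_divide_less_eq mult.commute)
  moreover have "(\<mu> + 2 * \<epsilon>) * u k = u k + L * u k" unfolding \<epsilon>(2)[symmetric] by (simp add: distrib_right)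
  ultimately have gap: "\<mu> * (u k + M) < u (Suc k) - M + (u k - M)"
    by (simp add: algebra_simps)
  have "infinite (approximations \<alpha> \<mu>)"
  proof (rule infinite_approximationsI)
    have dlim: "filterlim (\<lambda>t. real d ^ t) at_top sequentially"
      using d by (rule filterlim_real_nat_power)
    have "filterlim (\<lambda>t. (\<beta> * (u k - M)) * real d ^ t) at_top sequentially"
      using \<beta> k(2) by (intro filterlim_tendsto_pos_mult_at_top[OF tendsto_const _ dlim]) simp
    hence "filterlim (\<lambda>t. exp (\<beta> * (u k - M) * real d ^ t)) at_top sequentially"
      by (rule filterlim_compose[OF exp_at_top])
    thus "filterlim (\<lambda>t. \<bar>real_of_int (Q k t)\<bar>) at_top sequentially"
      by (rule filterlim_at_top_mono) (use den_ge[of k] in eventually_elim, simp add: mult_ac)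
    show "\<forall>\<^sub>F t in sequentially. \<bar>\<alpha> - of_int (P k t) / of_int (Q k t)\<bar> < \<bar>of_int (Q k t)\<bar> powr (- \<mu>)"
      using den_nonzero[of k] den_le[of k] den_ge[of k] err_le[of k]
    proof eventually_elim
      case (elim t)
      define T where "T = \<beta> * real d ^ t"
      have T: "T > 0" using \<beta> d by (simp add: T_def)
      have "\<bar>\<alpha> - of_int (P k t) / of_int (Q k t)\<bar> \<le> exp (- (T * (u (Suc k) - M))) / exp (T * (u k - M))"
        unfolding approximation_error[OF elim(1)] T_def using elim(3,4) by (intro frac_le) auto
      also have "\<dots> = exp (- (T * (u (Suc k) - M + (u k - M))))"
        by (simp add: algebra_simps flip: exp_diff)
      also have "\<dots> < exp (- (T * (\<mu> * (u k + M))))" using gap T by simp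
      also have "\<dots> = exp (T * (u k + M)) powr (- \<mu>)" by (simp add: powr_def mult_ac)
      also have "\<dots> \<le> \<bar>of_int (Q k t)\<bar> powr (- \<mu>)"
        using elim(1,2) \<mu> by (intro powr_mono2') (auto simp: T_def)
      finally show ?case .
    qed
  qed
  moreover have "approximations \<alpha> \<mu> \<subseteq> approximations \<alpha> \<mu>0"
  proof
    fix x assume "x \<in> approximations \<alpha> \<mu>"
    then obtain p q where x: "x = (p, q)" "q \<ge> 1" "\<bar>\<alpha> - of_int p / of_int q\<bar> < of_int q powr (- \<mu>)"
      unfolding approximations_def by blast
    moreover have "real_of_int q powr (- \<mu>) \<le> of_int q powr (- \<mu>0)"
      using x(2) by (intro powr_mono) (auto simp: \<mu>_def)
    ultimately show "x \<in> approximations \<alpha> \<mu>0" unfolding approximations_def by auto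
  qed
  ultimately show "infinite (approximations \<alpha> \<mu>0)" using finite_subset by blast
qed

text \<open>For large \<open>q = exp (\<beta> * y)\<close> a pair \<open>(k, t)\<close> is chosen
  with \<open>d ^ t * (u k - N) < y \<le> d ^ t * (u (Suc k) - N)\<close>. The onset in
  \<open>t\<close> is uniform only over finitely many \<open>k\<close>, so \<open>k\<close> stays in
  a block from \<open>K\<close> to \<open>K'\<close> with \<open>u K' > d * u K\<close>: the ranges
  of \<open>y\<close> for consecutive \<open>t\<close> then overlap and exhaust all large
  \<open>y\<close>. Either \<open>p / q\<close> and \<open>P k t / Q k t\<close> differ and repel
  each other, or they agree and the error of the scheme is used directly.\<close>

lemma exponent_le_eps:
  assumes \<epsilon>: "\<epsilon> > 0"
  shows "irrationality_exponent \<alpha> \<le> ereal (1 + L + 2 * \<epsilon>)"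
proof -
  define \<nu> where "\<nu> = 1 + L + 2 * \<epsilon>"
  \<comment> \<open>One more than \<open>M\<close>: the excess \<open>d ^ t\<close> in the exponent
    makes \<open>q\<close> times the error at most 1/2.\<close>
  define N where "N = M + 1"
  define \<sigma> where "\<sigma> = L + \<epsilon>"
  have \<sigma>: "\<sigma> > 1" "\<nu> = 1 + \<sigma> + \<epsilon>" using L_ge_1 \<epsilon> by (auto simp: \<sigma>_def \<nu>_def)
  obtain K0 where K0: "\<And>k. k \<ge> K0 \<Longrightarrow> u (Suc k) / u k < \<sigma>"
    using upper[OF \<epsilon>] unfolding eventually_sequentially \<sigma>_def by blast
  have "\<forall>\<^sub>F k in sequentially. k \<ge> K0 \<and> u k > max N (max ((M + \<sigma> * N) / (\<sigma> - 1)) ((\<nu> + 2) * M / \<epsilon>))"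
    by (intro eventually_conj eventually_ge_at_top eventually_u_gt)
  then obtain K where "K \<ge> K0 \<and> u K > max N (max ((M + \<sigma> * N) / (\<sigma> - 1)) ((\<nu> + 2) * M / \<epsilon>))"
    unfolding eventually_sequentially by (elim exE allE) (erule impE, rule order_refl)
  hence K: "K \<ge> K0" "u K > N" "u K > (M + \<sigma> * N) / (\<sigma> - 1)" "u K > (\<nu> + 2) * M / \<epsilon>" by auto
  have Kk: "u k > N" "u (Suc k) < \<sigma> * u k" "u k + M \<le> \<sigma> * (u k - N)" "(\<nu> + 2) * M \<le> \<epsilon> * u k"
    if "k \<ge> K" for k
  proof -
    have uk: "u k \<ge> u K" using that by (rule u_mono)
    show 1: "u k > N" using uk K by linarith
    have "u k > 0" using 1 M by (simp add: N_def)
    thus "u (Suc k) < \<sigma> * u k" using K0[of k] that K(1) by (simp add: pos_divide_less_eq)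
    have "M + \<sigma> * N < u K * (\<sigma> - 1)" using K(3) \<sigma>(1) by (simp add: pos_divide_less_eq)
    also have "\<dots> \<le> u k * (\<sigma> - 1)" using uk \<sigma>(1) by (intro mult_right_mono) auto
    finally show "u k + M \<le> \<sigma> * (u k - N)" by (simp add: algebra_simps)
    have "(\<nu> + 2) * M < u K * \<epsilon>" using K(4) \<epsilon> by (simp add: pos_divide_less_eq)
    also have "\<dots> \<le> u k * \<epsilon>" using uk \<epsilon> by (intro mult_right_mono) auto
    finally show "(\<nu> + 2) * M \<le> \<epsilon> * u k" by (simp add: mult.commute)
  qed
  obtain K' where K': "u K' > real d * u K"
    using eventually_u_gt[of "real d * u K"] unfolding eventually_sequentially by blast
  have uK: "u K > 0" using Kk(1)[of K] M by (simp add: N_def)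
  have "real d * u K \<ge> 1 * u K" using uK d by (intro mult_right_mono) auto
  hence "\<not> K' \<le> K" using K' u_mono[of K' K] by linarith
  hence "K < K'" by simp
  define X where "X = u K' - N"
  have X: "X > 0" "X \<ge> real d * (u K - N)"
  proof -
    have "real d * N \<ge> 1 * N" using d M by (intro mult_right_mono) (auto simp: N_def)
    thus "X \<ge> real d * (u K - N)" using K' by (simp add: X_def algebra_simps)
    have "u K' \<ge> u K" using \<open>K < K'\<close> by (intro u_mono) simp
    thus "X > 0" using Kk(1)[of K] by (simp add: X_def)
  qed
  have dlim: "filterlim (\<lambda>t. real d ^ t) at_top sequentially"
    using d by (rule filterlim_real_nat_power)
  define good where "good k t \<longleftrightarrow> Q k t \<noteq> 0 \<and>
      \<bar>of_int (Q k t)\<bar> \<le> exp (\<beta> * real d ^ t * (u k + M)) \<and>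
      \<bar>of_int (Q k t) * \<alpha> - of_int (P k t)\<bar> \<le> exp (- (\<beta> * real d ^ t * (u (Suc k) - M))) \<and>
      exp (- (\<beta> * real d ^ t * (u (Suc k) + M))) \<le> \<bar>of_int (Q k t) * \<alpha> - of_int (P k t)\<bar> \<and>
      (\<forall>p q. q \<ge> 1 \<and> p * Q k t = q * P k t \<longrightarrow> exp (\<beta> * real d ^ t * (u k - M)) \<le> real_of_int q)" for k t
  have "\<forall>\<^sub>F t in sequentially. good k t" for k
    unfolding good_def by (intro eventually_conj den_nonzero den_le err_le err_ge red_ge)
  hence "\<forall>\<^sub>F t in sequentially. \<forall>k\<in>{K..<K'}. good k t"
    by (intro eventually_ball_finite) simp_all
  moreover have "\<forall>\<^sub>F t in sequentially. ln 2 / \<beta> < real d ^ t"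
    using dlim unfolding filterlim_at_top_dense by (rule spec)
  ultimately have "\<forall>\<^sub>F t in sequentially. (\<forall>k\<in>{K..<K'}. good k t) \<and> ln 2 / \<beta> < real d ^ t"
    by (rule eventually_conj)
  then obtain t0 where t0: "\<forall>t\<ge>t0. (\<forall>k\<in>{K..<K'}. good k t) \<and> ln 2 / \<beta> < real d ^ t"
    unfolding eventually_sequentially by (elim exE)
  \<comment> \<open>The first entry forces \<open>t > t0\<close> later on; the second lets
    \<open>\<beta> * \<epsilon> * y\<close> absorb the factor 2 of the repulsion bound.\<close>
  define y0 where "y0 = max (real d ^ t0 * X) (ln 2 / (\<beta> * \<epsilon>))"
  define q0 where "q0 = \<lceil>exp (\<beta> * y0) + 1\<rceil>"
  show ?thesis unfolding \<nu>_def[symmetric]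
  proof (rule irrationality_exponent_le[of q0])
    fix p q :: int assume q: "q \<ge> q0"
    have q_gt: "exp (\<beta> * y0) < real_of_int q" using q unfolding q0_def by linarith
    have qpos: "real_of_int q > 0" using less_trans[OF exp_gt_zero q_gt] .
    define y where "y = ln (real_of_int q) / \<beta>"
    have "\<beta> * y = ln (real_of_int q)" using \<beta> by (simp add: y_def)
    hence qy: "real_of_int q = exp (\<beta> * y)" using qpos by (simp only: exp_ln)
    have "\<beta> * y0 < \<beta> * y" using q_gt unfolding qy by (simp only: exp_less_cancel_iff)
    hence "y > y0" using \<beta> by (simp only: mult_less_cancel_left_pos)
    hence y: "y > real d ^ t0 * X" "y > ln 2 / (\<beta> * \<epsilon>)" by (auto simp: y0_def)
    have q1: "q \<ge> 1" using qpos by linarith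
    have ex: "\<exists>t. y \<le> real d ^ t * X"
    proof -
      have "\<forall>\<^sub>F t in sequentially. real d ^ t > y / X" using dlim unfolding filterlim_at_top_dense by blast
      then obtain t where "real d ^ t > y / X" unfolding eventually_sequentially by blast
      thus ?thesis using X(1) by (intro exI[of _ t]) (simp add: pos_divide_less_eq less_imp_le)
    qed
    define t where "t = (LEAST t. y \<le> real d ^ t * X)"
    have t: "y \<le> real d ^ t * X" unfolding t_def using LeastI_ex[OF ex] .
    have "t > t0"
    proof (rule ccontr)
      assume "\<not> t > t0"
      hence "real d ^ t * X \<le> real d ^ t0 * X" using d X(1) by (intro mult_right_mono power_increasing) auto
      thus False using t y(1) by linarith
    qed
    then obtain t' where t': "t = Suc t'" by (cases t) auto
    have "t' < t" by (simp add: t')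
    hence "\<not> y \<le> real d ^ t' * X" unfolding t_def by (rule not_less_Least)
    hence small: "real d ^ t' * X < y" by simp
    define k where "k = (LEAST k. K \<le> k \<and> y \<le> real d ^ t * (u (Suc k) - N))"
    have wit: "K \<le> K' - 1 \<and> y \<le> real d ^ t * (u (Suc (K' - 1)) - N)"
      using \<open>K < K'\<close> t by (simp add: X_def)
    have k: "K \<le> k \<and> y \<le> real d ^ t * (u (Suc k) - N)" unfolding k_def by (rule LeastI[of _ "K' - 1"]) (rule wit)
    have "k \<le> K' - 1" unfolding k_def by (rule Least_le) (rule wit)
    hence kin: "k \<in> {K..<K'}" using k \<open>K < K'\<close> by auto
    \<comment> \<open>For \<open>k = K\<close> the minimality of \<open>t\<close> replaces that of
      \<open>k\<close>: the previous \<open>t'\<close> did not reach \<open>y\<close>, and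
      \<open>X\<close> is at least \<open>d * (u K - N)\<close>.\<close>
    have below: "real d ^ t * (u k - N) < y"
    proof (cases "k = K")
      case True
      have "real d ^ t * (u K - N) = real d ^ t' * (real d * (u K - N))" by (simp add: t' mult_ac)
      also have "\<dots> \<le> real d ^ t' * X" using X(2) d by (intro mult_left_mono) auto
      finally show ?thesis using small True by simp
    next
      case False
      then obtain j where j: "k = Suc j" "K \<le> j" using k by (cases k) auto
      have "j < k" using j by simp
      hence "\<not> (K \<le> j \<and> y \<le> real d ^ t * (u (Suc j) - N))" unfolding k_def by (rule not_less_Least)
      thus ?thesis using j by simp
    qed
    define T where "T = real d ^ t"
    have T: "T > 0" "ln 2 < \<beta> * T"
    proof -
      show "T > 0" using d by (simp add: T_def)
      have "ln 2 / \<beta> < T" using t0 \<open>t > t0\<close> by (simp add: T_def)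
      thus "ln 2 < \<beta> * T" using \<beta> by (simp add: pos_divide_less_eq mult.commute)
    qed
    have "good k t" using t0 kin \<open>t > t0\<close> by simp
    note good = this[unfolded good_def T_def[symmetric]]
    have scheme: "Q k t \<noteq> 0" "\<bar>of_int (Q k t)\<bar> \<le> exp (\<beta> * T * (u k + M))"
      "\<bar>of_int (Q k t) * \<alpha> - of_int (P k t)\<bar> \<le> exp (- (\<beta> * T * (u (Suc k) - M)))"
      "exp (- (\<beta> * T * (u (Suc k) + M))) \<le> \<bar>of_int (Q k t) * \<alpha> - of_int (P k t)\<bar>"
      "\<And>p q. q \<ge> 1 \<Longrightarrow> p * Q k t = q * P k t \<Longrightarrow> exp (\<beta> * T * (u k - M)) \<le> real_of_int q"
      using good by simp_all
    have kK: "k \<ge> K" using k by simp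
    have qpow: "real_of_int q powr (- \<nu>) = exp (- (\<nu> * (\<beta> * y)))"
      unfolding qy by (simp add: powr_def)
    show "real_of_int q powr (- \<nu>) \<le> \<bar>\<alpha> - of_int p / of_int q\<bar>"
    proof (cases "p * Q k t = q * P k t")
      case False
      have "of_int q * \<bar>of_int (Q k t) * \<alpha> - of_int (P k t)\<bar> \<le> exp (\<beta> * y) * exp (- (\<beta> * T * (u (Suc k) - M)))"
        unfolding qy using scheme(3) by (intro mult_left_mono) auto
      also have "\<dots> = exp (\<beta> * y - \<beta> * (T * (u (Suc k) - M)))" by (simp add: mult_exp_exp mult.assoc)
      also have "\<dots> \<le> exp (- ln 2)"
      proof -
        have "y \<le> T * (u (Suc k) - M) - T" using k by (simp add: T_def N_def algebra_simps)
        hence "\<beta> * y \<le> \<beta> * (T * (u (Suc k) - M) - T)" using \<beta> by (intro mult_left_mono) auto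
        also have "\<dots> = \<beta> * (T * (u (Suc k) - M)) - \<beta> * T" by (rule right_diff_distrib)
        finally show ?thesis using T(2) by simp
      qed
      finally have "of_int q * \<bar>of_int (Q k t) * \<alpha> - of_int (P k t)\<bar> \<le> 1 / 2" by (simp add: exp_minus inverse_eq_divide)
      from distinct_approximation_bound[OF q1 this False]
      have lb: "1 / (2 * of_int q * \<bar>of_int (Q k t)\<bar>) \<le> \<bar>\<alpha> - of_int p / of_int q\<bar>" .
      have "ln 2 < \<beta> * \<epsilon> * y" using y(2) \<beta> \<epsilon> by (simp add: pos_divide_less_eq mult_ac)
      moreover have "T * (u k + M) \<le> \<sigma> * y"
      proof -
        have "T * (u k + M) \<le> T * (\<sigma> * (u k - N))" using Kk(3)[OF kK] T by (intro mult_left_mono) auto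
        also have "\<dots> = \<sigma> * (T * (u k - N))" by simp
        also have "\<dots> \<le> \<sigma> * y" using below \<sigma>(1) by (intro mult_left_mono) (auto simp: T_def)
        finally show ?thesis .
      qed
      hence "\<beta> * (T * (u k + M)) \<le> \<beta> * (\<sigma> * y)" using \<beta> by (intro mult_left_mono) auto
      ultimately have ineq: "ln 2 + \<beta> * y + \<beta> * T * (u k + M) \<le> \<nu> * (\<beta> * y)"
        unfolding \<sigma>(2) by (simp add: algebra_simps)
      have "2 * of_int q * \<bar>of_int (Q k t)\<bar> \<le> 2 * exp (\<beta> * y) * exp (\<beta> * T * (u k + M))"
        unfolding qy using scheme(2) by (intro mult_left_mono) auto
      also have "\<dots> = exp (ln 2 + \<beta> * y + \<beta> * T * (u k + M))" by (simp add: exp_add)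
      also have "\<dots> \<le> exp (\<nu> * (\<beta> * y))" using ineq by simp
      finally have "1 / exp (\<nu> * (\<beta> * y)) \<le> 1 / (2 * of_int q * \<bar>of_int (Q k t)\<bar>)"
        using qpos scheme(1) by (intro divide_left_mono) auto
      thus ?thesis using lb unfolding qpow by (simp add: exp_minus inverse_eq_divide)
    next
      case True
      \<comment> \<open>Equal fractions may have \<open>q\<close> much smaller than
        \<open>Q k t\<close>. The bound on reduction limits this, so the error of the scheme is
        still large against the required power of \<open>q\<close>.\<close>
      have "exp (\<beta> * T * (u k - M)) \<le> exp (\<beta> * y)" using scheme(5)[OF q1 True] unfolding qy .
      hence "\<beta> * (T * (u k - M)) \<le> \<beta> * y" by (simp add: mult.assoc)
      hence "\<nu> * (\<beta> * (T * (u k - M))) \<le> \<nu> * (\<beta> * y)"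
        by (rule mult_left_mono) (use L_ge_1 \<epsilon> in \<open>simp add: \<nu>_def\<close>)
      moreover have "u (Suc k) + M + (u k + M) \<le> \<nu> * (u k - M)"
        using Kk(2,4)[OF kK] unfolding \<sigma>(2) by (simp add: algebra_simps)
      hence "\<beta> * T * (u (Suc k) + M + (u k + M)) \<le> \<beta> * T * (\<nu> * (u k - M))"
        using \<beta> T by (intro mult_left_mono) auto
      ultimately have ineq: "\<beta> * T * (u (Suc k) + M + (u k + M)) \<le> \<nu> * (\<beta> * y)" by (simp add: mult_ac)
      have "of_int p / of_int q = (of_int (P k t) / of_int (Q k t) :: real)"
      proof -
        have "real_of_int p * of_int (Q k t) = of_int q * of_int (P k t)"
          using True by (simp only: flip: of_int_mult)
        thus ?thesis using qpos scheme(1) by (simp add: frac_eq_eq mult.commute)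
      qed
      hence "\<bar>\<alpha> - of_int p / of_int q\<bar> = \<bar>of_int (Q k t) * \<alpha> - of_int (P k t)\<bar> / \<bar>of_int (Q k t)\<bar>"
        using approximation_error[OF scheme(1)] by simp
      also have "\<dots> \<ge> exp (- (\<beta> * T * (u (Suc k) + M))) / exp (\<beta> * T * (u k + M))"
        using scheme(1,2,4) by (intro frac_le) auto
      moreover have "exp (- (\<beta> * T * (u (Suc k) + M))) / exp (\<beta> * T * (u k + M)) =
          exp (- (\<beta> * T * (u (Suc k) + M + (u k + M))))"
        by (simp add: algebra_simps flip: exp_diff)
      moreover have "exp (- (\<nu> * (\<beta> * y))) \<le> exp (- (\<beta> * T * (u (Suc k) + M + (u k + M))))"
        using ineq by simp
      ultimately show ?thesis unfolding qpow by linarith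
    qed
  qed
qed

theorem exponent_eq: "irrationality_exponent \<alpha> = ereal (1 + L)"
proof (rule antisym)
  show "irrationality_exponent \<alpha> \<le> ereal (1 + L)"
  proof (rule ereal_le_epsilon2)
    fix e :: real assume "e > 0"
    thus "irrationality_exponent \<alpha> \<le> ereal (1 + L) + ereal e"
      using exponent_le_eps[of "e / 2"] by simp
  qed
qed (rule exponent_ge)

end

section \<open>Integer values and logarithmic growth\<close>

lemma clear_denominators_list:
  "\<exists>s :: int. s > 0 \<and> (\<forall>P\<in>set Ps. \<exists>p. map_poly of_int p = smult (of_int s :: rat) P)"
proof (induction Ps)
  case (Cons P Ps)
  then obtain s where s: "s > 0" "\<forall>P\<in>set Ps. \<exists>p. map_poly of_int p = smult (of_int s :: rat) P" by blast
  obtain a p where a: "a > 0" "map_poly of_int p = smult (of_int a :: rat) P" by (rule clear_denominators)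
  have "map_poly of_int (smult s p) = smult (of_int (a * s) :: rat) P"
    by (simp add: map_poly_smult a mult.commute)
  moreover have "\<exists>p. map_poly of_int p = smult (of_int (a * s) :: rat) R" if R: "R \<in> set Ps" for R
  proof -
    obtain r where "map_poly of_int r = smult (of_int s :: rat) R" using s(2) R by blast
    hence "map_poly of_int (smult a r) = smult (of_int (a * s) :: rat) R"
      by (simp add: map_poly_smult)
    thus ?thesis by blast
  qed
  ultimately show ?case using a(1) s(1) by (intro exI[of _ "a * s"]) auto
qed (auto intro: exI[of _ 1])

lemma poly_int_value:
  assumes "map_poly of_int p = smult (of_int s :: rat) P"
  shows "(of_int (poly p y) :: complex) = of_int s * poly_cx P (of_int y)"
proof -
  have "poly (map_poly of_int p) (of_int y) = (of_int (poly p y) :: rat)"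
    by (induction p) (simp_all add: map_poly_pCons)
  hence "(of_int (poly p y) :: rat) = of_int s * poly P (of_int y)" using assms by simp
  hence "(of_rat (of_int (poly p y)) :: complex) = of_rat (of_int s * poly P (of_int y))" by simp
  thus ?thesis using poly_of_rat_of_rat[of P "of_int y", where 'a = complex] by (simp add: of_rat_mult)
qed

text \<open>The constant \<open>R\<close> takes the place of a resultant: it bounds the common
  factors of the two values independently of the argument.\<close>

lemma coprime_bezout_int:
  assumes "coprime P Q" and p: "map_poly of_int p = smult (of_int s :: rat) P"
    and q: "map_poly of_int q = smult (of_int s :: rat) Q" and s: "s \<noteq> 0"
  obtains R :: int where "R \<noteq> 0" "\<And>y. \<exists>U V. U * poly p y + V * poly q y = R"
proof -
  obtain S T where ST: "S * P + T * Q = 1" using coprime_bezout_poly[OF assms(1)] .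
  obtain a where "a > 0" and a: "\<forall>P\<in>set [S, T]. \<exists>p. map_poly of_int p = smult (of_int a :: rat) P"
    using clear_denominators_list[of "[S, T]"] by blast
  then obtain S' T' where S': "map_poly of_int S' = smult (of_int a :: rat) S"
    and T': "map_poly of_int T' = smult (of_int a :: rat) T" by auto
  have "poly S' y * poly p y + poly T' y * poly q y = a * s" for y
  proof -
    have "(of_int (poly S' y * poly p y + poly T' y * poly q y) :: complex) =
        of_int (a * s) * poly_cx (S * P + T * Q) (of_int y)"
      by (simp add: poly_int_value[OF S'] poly_int_value[OF T'] poly_int_value[OF p] poly_int_value[OF q]
          poly_cx_add poly_cx_mult algebra_simps)
    also have "\<dots> = of_int (a * s)" unfolding ST by simp
    finally show ?thesis by (simp only: of_int_eq_iff)
  qed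
  thus ?thesis using that[of "a * s"] \<open>a > 0\<close> s by auto
qed

text \<open>The factor \<open>s\<close> will be an integer that clears denominators; it and the
  leading coefficient \<open>c\<close> contribute only to the bounded term.\<close>

lemma log_growth:
  fixes h :: "complex \<Rightarrow> complex"
  assumes c: "c \<noteq> 0" and lim: "((\<lambda>z. h z / z powi m) \<longlongrightarrow> c) at_infinity"
    and b: "norm b > 1" and d: "d \<ge> 2" and s: "s > 0"
  shows "(\<lambda>i. ln (s * norm (h (b ^ d ^ i))) - of_int m * ln (norm b) * real d ^ i) \<longlonglongrightarrow> ln (s * norm c)"
    and "\<forall>\<^sub>F i in sequentially. h (b ^ d ^ i) \<noteq> 0"
proof -
  have w: "filterlim (\<lambda>i. b ^ d ^ i) at_infinity sequentially"
    by (rule filterlim_iterated_powers[OF b d])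
  have l: "(\<lambda>i. h (b ^ d ^ i) / (b ^ d ^ i) powi m) \<longlonglongrightarrow> c" by (rule filterlim_compose[OF lim w])
  have ne: "\<forall>\<^sub>F i in sequentially. h (b ^ d ^ i) / (b ^ d ^ i) powi m \<noteq> 0"
    by (rule tendsto_imp_eventually_ne[OF l c])
  thus nz: "\<forall>\<^sub>F i in sequentially. h (b ^ d ^ i) \<noteq> 0" by eventually_elim auto
  have "(\<lambda>i. ln (s * norm (h (b ^ d ^ i) / (b ^ d ^ i) powi m))) \<longlonglongrightarrow> ln (s * norm c)"
    using c s by (intro tendsto_ln tendsto_mult tendsto_const tendsto_norm l) simp
  moreover have "\<forall>\<^sub>F i in sequentially. ln (s * norm (h (b ^ d ^ i) / (b ^ d ^ i) powi m)) =
      ln (s * norm (h (b ^ d ^ i))) - of_int m * ln (norm b) * real d ^ i"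
    using nz
  proof eventually_elim
    case (elim i)
    have B: "norm b > 0" using b by linarith
    have "norm ((b ^ d ^ i) powi m) = norm b powr (of_int m * real d ^ i)"
    proof -
      have "norm ((b ^ d ^ i) powi m) = (norm b ^ d ^ i) powi m" by (simp add: norm_power_int norm_power)
      also have "\<dots> = (norm b powr (real d ^ i)) powr of_int m"
        using B powr_realpow[OF B, of "d ^ i"] by (simp add: powr_real_of_int')
      finally show ?thesis by (simp add: powr_powr mult.commute)
    qed
    hence "s * norm (h (b ^ d ^ i) / (b ^ d ^ i) powi m) =
        (s * norm (h (b ^ d ^ i))) / norm b powr (of_int m * real d ^ i)" by (simp add: norm_divide)
    also have "ln \<dots> = ln (s * norm (h (b ^ d ^ i))) - ln (norm b powr (of_int m * real d ^ i))"
      using elim s B by (subst ln_divide_pos) auto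
    finally show ?case using B by (simp add: ln_powr)
  qed
  ultimately show "(\<lambda>i. ln (s * norm (h (b ^ d ^ i))) - of_int m * ln (norm b) * real d ^ i) \<longlonglongrightarrow> ln (s * norm c)"
    by (rule Lim_transform_eventually)
qed

lemma tendsto_div_power:
  fixes y :: "nat \<Rightarrow> real"
  assumes "(\<lambda>i. y i - m * real d ^ i) \<longlonglongrightarrow> c" "d \<ge> 2"
  shows "(\<lambda>i. y i / real d ^ i) \<longlonglongrightarrow> m"
proof -
  have "(\<lambda>i. (y i - m * real d ^ i) / real d ^ i + m) \<longlonglongrightarrow> 0 + m"
    by (intro tendsto_add tendsto_const real_tendsto_divide_at_top[OF assms(1)] filterlim_real_nat_power assms(2))
  moreover have "(y i - m * real d ^ i) / real d ^ i + m = y i / real d ^ i" for i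
    using assms(2) by (simp add: field_simps)
  ultimately show ?thesis by simp
qed

text \<open>With rational coefficients the value at an integer is its own complex conjugate, so the
  real part taken in \<open>value_at\<close> loses nothing.\<close>

lemma fls_value_real:
  assumes "fls_converges f (of_int b)"
  shows "fls_value f (of_int b) = of_real (value_at f b)"
proof -
  define w where "w = (inverse (of_int b) :: complex)"
  define n where "n = fls_subdegree (fls_of_rat f)"
  have w: "cnj w = w" by (simp add: w_def)
  have b0: "w \<noteq> 0" "ereal (norm w) < fls_conv_radius (fls_of_rat f)"
    using assms norm_inverse_conv[OF assms] by (simp_all add: w_def fls_converges_def)
  have s: "(\<lambda>k. fls_nth (fls_of_rat f) (int k + n) * w powi (int k + n)) sums eval_fls (fls_of_rat f) w"
    unfolding n_def by (rule sums_eval_fls) (use b0 in auto)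
  have rat: "cnj (of_rat r) = of_rat r" for r by (cases r) (simp add: of_rat_rat)
  have pw: "cnj (w powi m) = w powi m" for m
    by (cases m rule: int_cases2) (simp_all add: power_int_minus w)
  have "(\<lambda>k. cnj (fls_nth (fls_of_rat f) (int k + n) * w powi (int k + n))) sums cnj (eval_fls (fls_of_rat f) w)"
    using s by (simp only: sums_cnj)
  hence "(\<lambda>k. fls_nth (fls_of_rat f) (int k + n) * w powi (int k + n)) sums cnj (eval_fls (fls_of_rat f) w)"
    by (simp only: complex_cnj_mult pw nth_fls_of_rat rat)
  hence "cnj (eval_fls (fls_of_rat f) w) = eval_fls (fls_of_rat f) w"
    using s by (rule sums_unique2)
  hence "of_real (Re (eval_fls (fls_of_rat f) w)) = eval_fls (fls_of_rat f) w"
    by (simp add: complex_eq_iff)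
  thus ?thesis by (simp add: fls_value_def value_at_def w_def inverse_eq_divide)
qed

section \<open>The exponent as a limit superior\<close>

lemma log_prod_growth:
  fixes H g :: "nat \<Rightarrow> complex"
  assumes d: "d \<ge> 2" and H: "\<And>j. H j \<noteq> 0" and g: "\<forall>\<^sub>F t in sequentially. g t \<noteq> 0"
    and lH: "(\<lambda>j. ln (norm (H j)) - m * real d ^ j) \<longlonglongrightarrow> c1"
    and lg: "(\<lambda>t. ln (norm (g t)) - m' * real d ^ t) \<longlonglongrightarrow> c2"
  shows "(\<lambda>t. ln (norm ((\<Prod>j<t. H j) * g t)) / real d ^ t) \<longlonglongrightarrow> m / (real d - 1) + m'"
    and "\<forall>\<^sub>F t in sequentially. (\<Prod>j<t. H j) * g t \<noteq> 0"
proof -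
  show "\<forall>\<^sub>F t in sequentially. (\<Prod>j<t. H j) * g t \<noteq> 0"
    using g by eventually_elim (simp add: H)
  have "(\<lambda>t. (\<Sum>j<t. ln (norm (H j))) / real d ^ t + ln (norm (g t)) / real d ^ t) \<longlonglongrightarrow> m / (real d - 1) + m'"
    by (rule tendsto_add[OF tendsto_sum_div_power[OF d lH] tendsto_div_power[OF lg d]])
  moreover have "\<forall>\<^sub>F t in sequentially. (\<Sum>j<t. ln (norm (H j))) / real d ^ t + ln (norm (g t)) / real d ^ t =
      ln (norm ((\<Prod>j<t. H j) * g t)) / real d ^ t"
    using g
  proof eventually_elim
    case (elim t)
    have "ln (\<Prod>j<t. norm (H j)) = (\<Sum>j<t. ln (norm (H j)))" by (rule ln_prod) (simp_all add: H)
    moreover have "(\<Prod>j<t. norm (H j)) > 0" by (rule prod_pos) (simp add: H)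
    ultimately have "ln (norm ((\<Prod>j<t. H j) * g t)) = (\<Sum>j<t. ln (norm (H j))) + ln (norm (g t))"
      using elim by (simp add: norm_mult prod_norm ln_mult_pos flip: prod_norm)
    thus ?case by (simp add: add_divide_distrib)
  qed
  ultimately show "(\<lambda>t. ln (norm ((\<Prod>j<t. H j) * g t)) / real d ^ t) \<longlonglongrightarrow> m / (real d - 1) + m'"
    by (rule Lim_transform_eventually)
qed

lemma abs_le_expI: "x \<noteq> 0 \<Longrightarrow> ln \<bar>x\<bar> \<le> z \<Longrightarrow> \<bar>x :: real\<bar> \<le> exp z"
  using exp_le_cancel_iff[of "ln \<bar>x\<bar>" z] by (simp del: exp_le_cancel_iff)

lemma exp_le_absI: "x \<noteq> 0 \<Longrightarrow> z \<le> ln \<bar>x\<bar> \<Longrightarrow> exp z \<le> \<bar>x :: real\<bar>"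
  using exp_le_cancel_iff[of z "ln \<bar>x\<bar>"] by (simp del: exp_le_cancel_iff)

context mahler_series begin

lemma value_equation:
  assumes "fls_converges f z" "fls_converges f (z ^ d)"
  shows "poly_cx B z * fls_value f z = poly_cx A z * fls_value f (z ^ d) + poly_cx C z"
proof -
  have z: "z \<noteq> 0" using assms(1) by (simp add: fls_converges_def)
  have p: "fls_converges (poly_to_fls p) z" for p using z by simp
  note c = fls_value_compose_power[OF d_pos z assms(2)]
  have "fls_value (poly_to_fls B * f) z = fls_value (poly_to_fls A * fls_compose_power f d + poly_to_fls C) z"
    by (simp only: equation_cleared)
  thus ?thesis
    using fls_value_mult[OF p assms(1)] fls_value_mult[OF p c(2)]
      fls_value_add[OF fls_converges_mult[OF p c(2)] p] c(1) z by simp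
qed

text \<open>The convergent at the far point \<open>y t\<close> is carried back to \<open>y 0\<close>
  through \<open>t\<close> steps of the equation. Each step is cleared by \<open>s\<close>, the
  convergent once by \<open>r\<close>. The third identity is the determinant of the product of
  triangular matrices: every common divisor of \<open>P\<close> and \<open>Q\<close> divides
  it.\<close>

lemma integer_iterates:
  fixes b :: int
  defines "y \<equiv> \<lambda>i. (of_int b :: complex) ^ d ^ i"
  assumes conv: "\<And>i. fls_converges f (y i)"
  shows "\<exists>s r R :: int. s > 0 \<and> r > 0 \<and> R \<noteq> 0 \<and> (\<forall>t. \<exists>P Q U V :: int.
    of_int Q = (\<Prod>j<t. of_int s * poly_cx B (y j)) * (of_int r * poly_cx (qq k) (y t)) \<and>
    of_int Q * fls_value f (y 0) - of_int P =
      (\<Prod>j<t. of_int s * poly_cx A (y j)) * (of_int r * fls_value (cf_error k) (y t)) \<and>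
    of_int (U * P + V * Q) = (\<Prod>j<t. (of_int s * poly_cx A (y j)) * (of_int s * poly_cx B (y j))) * of_int R)"
proof -
  obtain s where s: "s > 0" "\<forall>P\<in>set [A, B, C]. \<exists>p. map_poly of_int p = smult (of_int s :: rat) P"
    using clear_denominators_list[of "[A, B, C]"] by blast
  then obtain a b' c where a: "map_poly of_int a = smult (of_int s :: rat) A"
    and b': "map_poly of_int b' = smult (of_int s :: rat) B"
    and c: "map_poly of_int c = smult (of_int s :: rat) C" by auto
  obtain r where r: "r > 0" "\<forall>P\<in>set [pp k, qq k]. \<exists>p. map_poly of_int p = smult (of_int r :: rat) P"
    using clear_denominators_list[of "[pp k, qq k]"] by blast
  then obtain p q where p: "map_poly of_int p = smult (of_int r :: rat) (pp k)"
    and q: "map_poly of_int q = smult (of_int r :: rat) (qq k)" by auto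
  have "r \<noteq> 0" using r by simp
  then obtain R where R: "R \<noteq> 0" "\<And>x. \<exists>U V. U * poly p x + V * poly q x = R"
    using coprime_bezout_int[OF coprime_convergent p q] by metis
  define x where "x i = b ^ d ^ i" for i
  have yx: "y i = of_int (x i)" for i by (simp add: y_def x_def)
  have y_Suc: "y (Suc i) = y i ^ d" for i unfolding y_def power_Suc2 power_mult ..
  \<comment> \<open>The start is shifted to an arbitrary \<open>i\<close>, since a further step is
    applied at the near end of the orbit.\<close>
  have "\<exists>P Q U V :: int.
    of_int Q = (\<Prod>j<t. of_int s * poly_cx B (y (i + j))) * (of_int r * poly_cx (qq k) (y (i + t))) \<and>
    of_int Q * fls_value f (y i) - of_int P =
      (\<Prod>j<t. of_int s * poly_cx A (y (i + j))) * (of_int r * fls_value (cf_error k) (y (i + t))) \<and>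
    of_int (U * P + V * Q) =
      (\<Prod>j<t. (of_int s * poly_cx A (y (i + j))) * (of_int s * poly_cx B (y (i + j)))) * (of_int R :: complex)" for t i
  proof (induction t arbitrary: i)
    case 0
    obtain U V where UV: "U * poly p (x i) + V * poly q (x i) = R" using R(2) by blast
    have "(of_int (poly q (x i)) :: complex) = of_int r * poly_cx (qq k) (y i)"
      "(of_int (poly p (x i)) :: complex) = of_int r * poly_cx (pp k) (y i)"
      unfolding yx by (rule poly_int_value[OF q], rule poly_int_value[OF p])
    thus ?case using UV
      by (intro exI[of _ "poly p (x i)"] exI[of _ "poly q (x i)"] exI[of _ U] exI[of _ V])
         (simp add: fls_error_value[OF conv] algebra_simps)
  next
    case (Suc t)
    obtain P Q U V :: int where IH:
      "of_int Q = (\<Prod>j<t. of_int s * poly_cx B (y (Suc i + j))) * (of_int r * poly_cx (qq k) (y (Suc i + t)))"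
      "of_int Q * fls_value f (y (Suc i)) - of_int P =
        (\<Prod>j<t. of_int s * poly_cx A (y (Suc i + j))) * (of_int r * fls_value (cf_error k) (y (Suc i + t)))"
      "of_int (U * P + V * Q) =
        (\<Prod>j<t. (of_int s * poly_cx A (y (Suc i + j))) * (of_int s * poly_cx B (y (Suc i + j)))) * (of_int R :: complex)"
      using Suc.IH[of "Suc i"] by blast
    define ai bi ci where "ai = poly a (x i)" and "bi = poly b' (x i)" and "ci = poly c (x i)"
    have abc: "(of_int ai :: complex) = of_int s * poly_cx A (y i)"
      "(of_int bi :: complex) = of_int s * poly_cx B (y i)" "(of_int ci :: complex) = of_int s * poly_cx C (y i)"
      unfolding yx ai_def bi_def ci_def by (rule poly_int_value[OF a], rule poly_int_value[OF b'], rule poly_int_value[OF c])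
    have fe: "of_int bi * fls_value f (y i) = of_int ai * fls_value f (y (Suc i)) + of_int ci"
    proof -
      have "poly_cx B (y i) * fls_value f (y i) = poly_cx A (y i) * fls_value f (y (Suc i)) + poly_cx C (y i)"
        using value_equation[of "y i"] conv[of i] conv[of "Suc i"] unfolding y_Suc by simp
      hence "of_int s * (poly_cx B (y i) * fls_value f (y i)) =
          of_int s * (poly_cx A (y i) * fls_value f (y (Suc i)) + poly_cx C (y i))" by (rule arg_cong)
      thus ?thesis unfolding abc by (simp only: distrib_left mult.assoc)
    qed
    \<comment> \<open>\<open>U'\<close> and \<open>V'\<close> come from the adjugate of the
      triangular matrix with rows \<open>(ai, ci)\<close> and \<open>(0, bi)\<close>, so that its
      determinant \<open>ai * bi\<close> splits off.\<close>
    define P' Q' U' V' where "P' = ai * P + ci * Q" and "Q' = bi * Q"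
      and "U' = bi * U" and "V' = ai * V - U * ci"
    have shift: "(\<Prod>j<Suc t. h (i + j)) = h i * (\<Prod>j<t. h (Suc i + j))" for h :: "nat \<Rightarrow> complex"
      unfolding prod.lessThan_Suc_shift by simp
    have 1: "of_int Q' = (\<Prod>j<Suc t. of_int s * poly_cx B (y (i + j))) * (of_int r * poly_cx (qq k) (y (i + Suc t)))"
      unfolding shift[of "\<lambda>j. of_int s * poly_cx B (y j)"] abc(2)[symmetric] Q'_def of_int_mult IH(1) by simp
    have "of_int Q' * fls_value f (y i) - of_int P' =
        of_int Q * (of_int bi * fls_value f (y i)) - (of_int ai * of_int P + of_int ci * of_int Q)"
      by (simp add: Q'_def P'_def)
    also have "\<dots> = of_int ai * (of_int Q * fls_value f (y (Suc i)) - of_int P)"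
      unfolding fe by (simp add: algebra_simps)
    finally have 2: "of_int Q' * fls_value f (y i) - of_int P' =
        (\<Prod>j<Suc t. of_int s * poly_cx A (y (i + j))) * (of_int r * fls_value (cf_error k) (y (i + Suc t)))"
      unfolding shift[of "\<lambda>j. of_int s * poly_cx A (y j)"] abc(1)[symmetric] IH(2) by simp
    have "U' * P' + V' * Q' = ai * bi * (U * P + V * Q)"
      by (simp add: U'_def V'_def P'_def Q'_def algebra_simps)
    hence "of_int (U' * P' + V' * Q') = of_int ai * of_int bi * (of_int (U * P + V * Q) :: complex)"
      by (simp only: of_int_mult)
    hence 3: "of_int (U' * P' + V' * Q') =
      (\<Prod>j<Suc t. (of_int s * poly_cx A (y (i + j))) * (of_int s * poly_cx B (y (i + j)))) * (of_int R :: complex)"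
      unfolding shift[of "\<lambda>j. (of_int s * poly_cx A (y j)) * (of_int s * poly_cx B (y j))"] abc(1,2)[symmetric] IH(3)
      by (simp only: mult.assoc)
    show ?case using 1 2 3 by blast
  qed
  from this[where i = 0] show ?thesis using s(1) r(1) R(1)
    by (intro exI[of _ s] exI[of _ r] exI[of _ R]) (simp only: add_0 simp_thms)
qed

theorem irrationality_exponent_limsup:
  fixes b :: int
  assumes b: "\<bar>b\<bar> \<ge> 2" and conv: "fls_converges f (of_int b)"
    and nz: "\<And>t. poly A (of_int b ^ d ^ t) * poly B (of_int b ^ d ^ t) \<noteq> 0"
    and up: "\<And>\<epsilon>. \<epsilon> > 0 \<Longrightarrow> \<forall>\<^sub>F k in sequentially. gap_ratio k < L + \<epsilon>"
    and low: "\<And>\<epsilon>. \<epsilon> > 0 \<Longrightarrow> \<exists>\<^sub>F k in sequentially. gap_ratio k > L - \<epsilon>"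
  shows "irrationality_exponent (value_at f b) = ereal (1 + L)"
proof -
  define y where "y i = (of_int b :: complex) ^ d ^ i" for i
  define \<beta> where "\<beta> = ln (norm (of_int b :: complex))"
  have nb: "norm (of_int b :: complex) > 1" using b by simp
  have \<beta>: "\<beta> > 0" unfolding \<beta>_def using nb by simp
  have AB: "poly_cx A (y i) \<noteq> 0" "poly_cx B (y i) \<noteq> 0" for i
  proof -
    have "y i = of_rat (of_int b ^ d ^ i)" by (simp add: y_def of_rat_power)
    thus "poly_cx A (y i) \<noteq> 0" "poly_cx B (y i) \<noteq> 0"
      using nz[of i] by (auto simp: poly_of_rat_of_rat)
  qed
  have convy: "fls_converges f (y i)" for i
  proof (rule fls_converges_mono[OF conv])
    have "norm (of_int b :: complex) ^ 1 \<le> norm (of_int b :: complex) ^ d ^ i"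
      using nb d_ge_2 by (intro power_increasing) auto
    thus "norm (of_int b :: complex) \<le> norm (y i)" by (simp add: y_def norm_power)
  qed
  define \<alpha> where "\<alpha> = value_at f b"
  have \<alpha>: "fls_value f (y 0) = of_real \<alpha>" unfolding y_def \<alpha>_def using fls_value_real[OF conv] by simp
  define iter where "iter k s r R t P Q U V \<longleftrightarrow>
    of_int Q = (\<Prod>j<t. of_int s * poly_cx B (y j)) * (of_int r * poly_cx (qq k) (y t)) \<and>
    of_int Q * fls_value f (y 0) - of_int P =
      (\<Prod>j<t. of_int s * poly_cx A (y j)) * (of_int r * fls_value (cf_error k) (y t)) \<and>
    of_int (U * P + V * Q) = (\<Prod>j<t. (of_int s * poly_cx A (y j)) * (of_int s * poly_cx B (y j))) * (of_int R :: complex)"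
    for k t and s r R P Q U V :: int
  have "\<exists>s r R. s > 0 \<and> r > 0 \<and> R \<noteq> 0 \<and> (\<forall>t. \<exists>P Q U V. iter k s r R t P Q U V)" for k
    using integer_iterates[of b k] convy unfolding y_def iter_def by simp
  then obtain s r R where srR: "\<And>k. s k > 0" "\<And>k. r k > 0" "\<And>k. R k \<noteq> 0"
    and ex: "\<And>k t. \<exists>P Q U V. iter k (s k) (r k) (R k) t P Q U V"
    by metis
  then obtain P Q U V where it: "\<And>k t. iter k (s k) (r k) (R k) t (P k t) (Q k t) (U k t) (V k t)"
    by metis
  have Q: "of_int (Q k t) = (\<Prod>j<t. of_int (s k) * poly_cx B (y j)) * (of_int (r k) * poly_cx (qq k) (y t))"
    and E: "of_int (Q k t) * fls_value f (y 0) - of_int (P k t) =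
      (\<Prod>j<t. of_int (s k) * poly_cx A (y j)) * (of_int (r k) * fls_value (cf_error k) (y t))"
    and W: "of_int (U k t * P k t + V k t * Q k t) =
      (\<Prod>j<t. (of_int (s k) * poly_cx A (y j)) * (of_int (s k) * poly_cx B (y j))) * (of_int (R k) :: complex)"
    for k t using it[of k t] unfolding iter_def by blast+
  define ra where "ra = real (degree A)"
  define rb where "rb = real (degree B)"
  define e where "e = real d - 1"
  have e: "e \<ge> 1" using d_ge_2 by (simp add: e_def)
  have rpos: "ra / e \<ge> 0" "rb / e \<ge> 0" using e by (auto simp: ra_def rb_def)
  \<comment> \<open>The growth rates below deviate from \<open>u k\<close> and
    \<open>- u (Suc k)\<close> by at most \<open>ra / e + rb / e\<close>. The two extra units serve
    the reduced denominators: a common factor of rate below \<open>M - 1\<close> is taken from a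
    denominator of rate above \<open>u k - 1\<close>.\<close>
  define M where "M = ra / e + rb / e + 2"
  define u where "u k = real (uu k)" for k
  note growth = log_growth[OF _ _ nb d_ge_2, folded y_def \<beta>_def]
  have gp: "\<exists>c. (\<lambda>i. ln (norm (of_int m * poly_cx p (y i))) - real (degree p) * \<beta> * real d ^ i) \<longlonglongrightarrow> c"
    "\<forall>\<^sub>F i in sequentially. poly_cx p (y i) \<noteq> 0" if p: "p \<noteq> 0" and m: "m > 0" for p and m :: int
  proof -
    obtain c where c: "c \<noteq> 0" "((\<lambda>z. poly_cx p z / z powi int (degree p)) \<longlongrightarrow> c) at_infinity"
      using poly_cx_asymp[OF p] by blast
    have "real_of_int m > 0" using m by simp
    from growth[OF c this] m
    show "\<exists>c. (\<lambda>i. ln (norm (of_int m * poly_cx p (y i))) - real (degree p) * \<beta> * real d ^ i) \<longlonglongrightarrow> c"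
      "\<forall>\<^sub>F i in sequentially. poly_cx p (y i) \<noteq> 0"
      by (auto simp: norm_mult)
  qed
  have limQ: "(\<lambda>t. ln \<bar>real_of_int (Q k t)\<bar> / real d ^ t) \<longlonglongrightarrow> \<beta> * (u k + rb / e)"
    and nzQ: "\<forall>\<^sub>F t in sequentially. Q k t \<noteq> 0" for k
  proof -
    obtain c1 where c1: "(\<lambda>i. ln (norm (of_int (s k) * poly_cx B (y i))) - real (degree B) * \<beta> * real d ^ i) \<longlonglongrightarrow> c1"
      using gp(1)[OF B_nonzero srR(1)] by blast
    obtain c2 where c2: "(\<lambda>i. ln (norm (of_int (r k) * poly_cx (qq k) (y i))) - real (uu k) * \<beta> * real d ^ i) \<longlonglongrightarrow> c2"
      using gp(1)[OF qq_nonzero srR(2)] by blast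
    have "\<forall>\<^sub>F t in sequentially. of_int (r k) * poly_cx (qq k) (y t) \<noteq> 0"
      using gp(2)[OF qq_nonzero[of k] srR(2)[of k]] by eventually_elim (use srR(2)[of k] in simp)
    moreover have "of_int (s k) * poly_cx B (y j) \<noteq> 0" for j using AB srR(1)[of k] by simp
    ultimately have l: "(\<lambda>t. ln (norm (of_int (Q k t) :: complex)) / real d ^ t) \<longlonglongrightarrow>
        real (degree B) * \<beta> / (real d - 1) + real (uu k) * \<beta>"
      and n: "\<forall>\<^sub>F t in sequentially. (of_int (Q k t) :: complex) \<noteq> 0"
      using log_prod_growth[OF d_ge_2 _ _ c1 c2] unfolding Q by blast+
    have eq: "real (degree B) * \<beta> / (real d - 1) + real (uu k) * \<beta> = \<beta> * (u k + rb / e)"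
      by (simp add: u_def rb_def e_def algebra_simps)
    show "(\<lambda>t. ln \<bar>real_of_int (Q k t)\<bar> / real d ^ t) \<longlonglongrightarrow> \<beta> * (u k + rb / e)"
      using l unfolding eq by simp
    show "\<forall>\<^sub>F t in sequentially. Q k t \<noteq> 0" using n by simp
  qed
  have nE: "norm (of_int (Q k t) * fls_value f (y 0) - of_int (P k t)) = \<bar>of_int (Q k t) * \<alpha> - of_int (P k t)\<bar>" for k t
  proof -
    have "of_int (Q k t) * fls_value f (y 0) - of_int (P k t) = of_real (of_int (Q k t) * \<alpha> - of_int (P k t))"
      unfolding \<alpha> by simp
    thus ?thesis by (simp only: norm_of_real)
  qed
  have limE: "(\<lambda>t. ln \<bar>of_int (Q k t) * \<alpha> - of_int (P k t)\<bar> / real d ^ t) \<longlonglongrightarrow> \<beta> * (ra / e - u (Suc k))"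
    and nzE: "\<forall>\<^sub>F t in sequentially. of_int (Q k t) * \<alpha> - of_int (P k t) \<noteq> 0" for k
  proof -
    have rad: "fls_conv_radius (fls_of_rat (cf_error k)) > 0"
    proof -
      have "fls_conv_radius (fls_of_rat (cf_error k)) \<ge> fls_conv_radius (fls_of_rat f)"
        unfolding cf_error_def fls_of_rat_diff fls_of_rat_mult
        by (intro fls_conv_radius_diff_ge fls_conv_radius_mult_ge) auto
      thus ?thesis using fls_converges_imp_conv_radius_pos[OF conv] by simp
    qed
    obtain c1 where c1: "(\<lambda>i. ln (norm (of_int (s k) * poly_cx A (y i))) - real (degree A) * \<beta> * real d ^ i) \<longlonglongrightarrow> c1"
      using gp(1)[OF A_nonzero srR(1)] by blast
    have ce: "(of_rat (fls_nth (cf_error k) (fls_subdegree (cf_error k))) :: complex) \<noteq> 0" by simp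
    have rp: "real_of_int (r k) > 0" using srR(2) by simp
    note g = growth[OF ce fls_value_asymp[OF rad] rp]
    have "real_of_int (- fls_subdegree (cf_error k)) = - real (uu (Suc k))" by (simp add: cf_error_subdegree)
    with g(1) obtain c2 where c2: "(\<lambda>i. ln (norm (of_int (r k) * fls_value (cf_error k) (y i))) - (- real (uu (Suc k)) * \<beta>) * real d ^ i) \<longlonglongrightarrow> c2"
      using rp by (auto simp: norm_mult)
    have "\<forall>\<^sub>F t in sequentially. of_int (r k) * fls_value (cf_error k) (y t) \<noteq> 0"
      using g(2) by eventually_elim (use srR(2)[of k] in simp)
    moreover have "of_int (s k) * poly_cx A (y j) \<noteq> 0" for j using AB srR(1)[of k] by simp
    ultimately have l: "(\<lambda>t. ln (norm (of_int (Q k t) * fls_value f (y 0) - of_int (P k t))) / real d ^ t) \<longlonglongrightarrow>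
        real (degree A) * \<beta> / (real d - 1) + - real (uu (Suc k)) * \<beta>"
      and n: "\<forall>\<^sub>F t in sequentially. of_int (Q k t) * fls_value f (y 0) - of_int (P k t) \<noteq> 0"
      using log_prod_growth[OF d_ge_2 _ _ c1 c2] unfolding E by blast+
    have eq: "real (degree A) * \<beta> / (real d - 1) + - real (uu (Suc k)) * \<beta> = \<beta> * (ra / e - u (Suc k))"
      by (simp add: u_def ra_def e_def algebra_simps)
    show "(\<lambda>t. ln \<bar>of_int (Q k t) * \<alpha> - of_int (P k t)\<bar> / real d ^ t) \<longlonglongrightarrow> \<beta> * (ra / e - u (Suc k))"
      using l unfolding eq nE .
    show "\<forall>\<^sub>F t in sequentially. of_int (Q k t) * \<alpha> - of_int (P k t) \<noteq> 0"
      using n by (rule eventually_mono) (use nE in \<open>metis abs_eq_0 norm_eq_zero\<close>)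
  qed
  have limW: "(\<lambda>t. ln \<bar>real_of_int (U k t * P k t + V k t * Q k t)\<bar> / real d ^ t) \<longlonglongrightarrow> \<beta> * (ra / e + rb / e)"
    and nzW: "\<And>t. U k t * P k t + V k t * Q k t \<noteq> 0" for k
  proof -
    obtain c1 where c1: "(\<lambda>i. ln (norm (of_int (s k) * poly_cx A (y i))) - real (degree A) * \<beta> * real d ^ i) \<longlonglongrightarrow> c1"
      using gp(1)[OF A_nonzero srR(1)] by blast
    obtain c2 where c2: "(\<lambda>i. ln (norm (of_int (s k) * poly_cx B (y i))) - real (degree B) * \<beta> * real d ^ i) \<longlonglongrightarrow> c2"
      using gp(1)[OF B_nonzero srR(1)] by blast
    have nz': "(of_int (s k) * poly_cx A (y j)) * (of_int (s k) * poly_cx B (y j)) \<noteq> 0" for j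
      using AB srR(1)[of k] by simp
    have l1: "(\<lambda>i. ln (norm ((of_int (s k) * poly_cx A (y i)) * (of_int (s k) * poly_cx B (y i)))) -
        (ra + rb) * \<beta> * real d ^ i) \<longlonglongrightarrow> c1 + c2"
    proof -
      have "ln (norm ((of_int (s k) * poly_cx A (y i)) * (of_int (s k) * poly_cx B (y i)))) - (ra + rb) * \<beta> * real d ^ i =
        (ln (norm (of_int (s k) * poly_cx A (y i))) - real (degree A) * \<beta> * real d ^ i) +
        (ln (norm (of_int (s k) * poly_cx B (y i))) - real (degree B) * \<beta> * real d ^ i)" for i
      proof -
        have "norm (of_int (s k) * poly_cx A (y i)) > 0" "norm (of_int (s k) * poly_cx B (y i)) > 0"
          using AB srR(1)[of k] by auto
        hence "ln (norm ((of_int (s k) * poly_cx A (y i)) * (of_int (s k) * poly_cx B (y i)))) =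
          ln (norm (of_int (s k) * poly_cx A (y i))) + ln (norm (of_int (s k) * poly_cx B (y i)))"
          unfolding norm_mult[of "of_int (s k) * poly_cx A (y i)"] by (rule ln_mult_pos)
        thus ?thesis by (simp add: ra_def rb_def algebra_simps)
      qed
      thus ?thesis using tendsto_add[OF c1 c2] by simp
    qed
    have l2: "(\<lambda>t. ln (norm (of_int (R k) :: complex)) - 0 * real d ^ t) \<longlonglongrightarrow> ln (norm (of_int (R k) :: complex))"
      by simp
    have l3: "\<forall>\<^sub>F t :: nat in sequentially. (of_int (R k) :: complex) \<noteq> 0" using srR(3) by simp
    have "(\<lambda>t. ln (norm (of_int (U k t * P k t + V k t * Q k t) :: complex)) / real d ^ t) \<longlonglongrightarrow>
        (ra + rb) * \<beta> / (real d - 1) + 0"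
      unfolding W
      by (rule log_prod_growth(1)[where H = "\<lambda>j. (of_int (s k) * poly_cx A (y j)) * (of_int (s k) * poly_cx B (y j))"
            and g = "\<lambda>_. of_int (R k)", OF d_ge_2 nz' l3 l1 l2])
    moreover have "(ra + rb) * \<beta> / (real d - 1) + 0 = \<beta> * (ra / e + rb / e)"
      by (simp add: e_def add_divide_distrib algebra_simps)
    moreover have "norm (of_int (U k t * P k t + V k t * Q k t) :: complex) =
        \<bar>real_of_int (U k t * P k t + V k t * Q k t)\<bar>" for t by (rule norm_of_int)
    ultimately show "(\<lambda>t. ln \<bar>real_of_int (U k t * P k t + V k t * Q k t)\<bar> / real d ^ t) \<longlonglongrightarrow> \<beta> * (ra / e + rb / e)"
      by (simp only:)
    show "U k t * P k t + V k t * Q k t \<noteq> 0" for t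
    proof
      assume "U k t * P k t + V k t * Q k t = 0"
      hence "(\<Prod>j<t. (of_int (s k) * poly_cx A (y j)) * (of_int (s k) * poly_cx B (y j))) * (of_int (R k) :: complex) = 0"
        using W[of k t] by (simp only: of_int_0)
      thus False using nz' srR(3)[of k] by simp
    qed
  qed
  have dp: "real d ^ t > 0" for t by simp
  have less: "\<beta> * x < \<beta> * z" if "x < z" for x z using \<beta> that by simp
  have Qle: "\<forall>\<^sub>F t in sequentially. ln \<bar>real_of_int (Q k t)\<bar> < \<beta> * real d ^ t * (u k + M)" for k
    using order_tendstoD(2)[OF limQ[of k] less[of _ "u k + M"]] rpos
    by (auto simp: M_def pos_divide_less_eq mult_ac)
  have Qge: "\<forall>\<^sub>F t in sequentially. \<beta> * real d ^ t * (u k - 1) < ln \<bar>real_of_int (Q k t)\<bar>" for k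
    using order_tendstoD(1)[OF limQ[of k] less[of "u k - 1"]] rpos
    by (auto simp: pos_less_divide_eq mult_ac)
  have Ele: "\<forall>\<^sub>F t in sequentially. ln \<bar>of_int (Q k t) * \<alpha> - of_int (P k t)\<bar> < \<beta> * real d ^ t * (M - u (Suc k))" for k
    using order_tendstoD(2)[OF limE[of k] less[of _ "M - u (Suc k)"]] rpos
    by (auto simp: M_def pos_divide_less_eq mult_ac)
  have Ege: "\<forall>\<^sub>F t in sequentially. \<beta> * real d ^ t * (- u (Suc k) - M) < ln \<bar>of_int (Q k t) * \<alpha> - of_int (P k t)\<bar>" for k
  proof -
    have "- u (Suc k) - M < ra / e - u (Suc k)" using rpos unfolding M_def by linarith
    from order_tendstoD(1)[OF limE[of k] less[OF this]] show ?thesis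
      by (simp add: pos_less_divide_eq mult_ac)
  qed
  have Wle: "\<forall>\<^sub>F t in sequentially. ln \<bar>real_of_int (U k t * P k t + V k t * Q k t)\<bar> < \<beta> * real d ^ t * (M - 1)" for k
    using order_tendstoD(2)[OF limW[of k] less[of _ "M - 1"]] rpos
    by (auto simp: M_def pos_divide_less_eq mult_ac)
  have T: "\<beta> * real d ^ t > 0" for t using \<beta> by simp
  interpret approximation_scheme \<alpha> \<beta> M L d u P Q
  proof
    show "\<beta> > 0" "d \<ge> 2" "M \<ge> 0" using \<beta> d_ge_2 rpos by (auto simp: M_def)
    show "filterlim u at_top sequentially" unfolding u_def by (rule filterlim_degree_qq)
  next
    fix k
    show "u k < u (Suc k)" unfolding u_def using degree_qq_less[of k] by (simp only: of_nat_less_iff)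
    show nQ: "\<forall>\<^sub>F t in sequentially. Q k t \<noteq> 0" by (rule nzQ)
    show "\<forall>\<^sub>F t in sequentially. \<bar>of_int (Q k t)\<bar> \<le> exp (\<beta> * real d ^ t * (u k + M))"
      using nQ Qle[of k]
    proof eventually_elim
      case (elim t)
      show ?case by (rule abs_le_expI) (use elim in simp_all)
    qed
    show "\<forall>\<^sub>F t in sequentially. exp (\<beta> * real d ^ t * (u k - M)) \<le> \<bar>of_int (Q k t)\<bar>"
      using nQ Qge[of k]
    proof eventually_elim
      case (elim t)
      have "\<beta> * real d ^ t * (u k - M) \<le> \<beta> * real d ^ t * (u k - 1)"
        using T[of t] rpos by (intro mult_left_mono) (auto simp: M_def)
      hence "\<beta> * real d ^ t * (u k - M) \<le> ln \<bar>real_of_int (Q k t)\<bar>" using elim(2) by linarith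
      thus ?case by (rule exp_le_absI[rotated]) (use elim(1) in simp)
    qed
    show "\<forall>\<^sub>F t in sequentially. \<bar>of_int (Q k t) * \<alpha> - of_int (P k t)\<bar> \<le> exp (- (\<beta> * real d ^ t * (u (Suc k) - M)))"
      using nzE[of k] Ele[of k]
    proof eventually_elim
      case (elim t)
      have "\<beta> * real d ^ t * (M - u (Suc k)) = - (\<beta> * real d ^ t * (u (Suc k) - M))" by (simp add: algebra_simps)
      hence "ln \<bar>of_int (Q k t) * \<alpha> - of_int (P k t)\<bar> \<le> - (\<beta> * real d ^ t * (u (Suc k) - M))"
        using elim(2) by linarith
      thus ?case by (rule abs_le_expI[OF elim(1)])
    qed
    show "\<forall>\<^sub>F t in sequentially. exp (- (\<beta> * real d ^ t * (u (Suc k) + M))) \<le> \<bar>of_int (Q k t) * \<alpha> - of_int (P k t)\<bar>"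
      using nzE[of k] Ege[of k]
    proof eventually_elim
      case (elim t)
      have "\<beta> * real d ^ t * (- u (Suc k) - M) = - (\<beta> * real d ^ t * (u (Suc k) + M))" by (simp add: algebra_simps)
      hence "- (\<beta> * real d ^ t * (u (Suc k) + M)) \<le> ln \<bar>of_int (Q k t) * \<alpha> - of_int (P k t)\<bar>"
        using elim(2) by linarith
      thus ?case by (rule exp_le_absI[OF elim(1)])
    qed
    show "\<forall>\<^sub>F t in sequentially. \<forall>p q. q \<ge> 1 \<and> p * Q k t = q * P k t \<longrightarrow>
      exp (\<beta> * real d ^ t * (u k - M)) \<le> real_of_int q"
      using nQ Qge[of k] Wle[of k]
    proof eventually_elim
      case (elim t)
      show ?case
      proof (intro allI impI)
        fix p q assume pq: "q \<ge> 1 \<and> p * Q k t = q * P k t"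
        \<comment> \<open>As \<open>p * Q k t = q * P k t\<close>, the number \<open>w * q\<close>
          is a multiple of \<open>Q k t\<close>. So \<open>q\<close> is at least
          \<open>Q k t\<close> divided by the determinant, up to sign.\<close>
        define w where "w = U k t * P k t + V k t * Q k t"
        have w: "w \<noteq> 0" unfolding w_def by (rule nzW)
        have "w * q = U k t * (q * P k t) + V k t * Q k t * q" by (simp add: w_def algebra_simps)
        also have "\<dots> = Q k t * (U k t * p + V k t * q)"
          using pq by (simp add: algebra_simps flip: conjunct2[OF pq])
        finally have "Q k t dvd w * q" by simp
        hence "\<bar>Q k t\<bar> \<le> \<bar>w * q\<bar>" using w pq by (intro dvd_imp_le_int) auto
        hence "\<bar>Q k t\<bar> \<le> \<bar>w\<bar> * q" using pq by (simp add: abs_mult)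
        hence "real_of_int \<bar>Q k t\<bar> \<le> real_of_int (\<bar>w\<bar> * q)" by (simp only: of_int_le_iff)
        hence le: "\<bar>real_of_int (Q k t)\<bar> \<le> \<bar>real_of_int w\<bar> * real_of_int q" by simp
        have qp: "real_of_int q > 0" using pq by simp
        have "ln \<bar>real_of_int (Q k t)\<bar> \<le> ln (\<bar>real_of_int w\<bar> * real_of_int q)"
          using le elim(1) w qp by (subst ln_le_cancel_iff) auto
        also have "\<dots> = ln \<bar>real_of_int w\<bar> + ln (real_of_int q)" using w qp by (intro ln_mult_pos) auto
        finally have "ln \<bar>real_of_int (Q k t)\<bar> \<le> ln \<bar>real_of_int w\<bar> + ln (real_of_int q)" .
        moreover have "\<beta> * real d ^ t * (u k - 1) - \<beta> * real d ^ t * (M - 1) = \<beta> * real d ^ t * (u k - M)"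
          by (simp add: algebra_simps)
        ultimately have "\<beta> * real d ^ t * (u k - M) \<le> ln (real_of_int q)"
          using elim(2,3) unfolding w_def[symmetric] by linarith
        thus "exp (\<beta> * real d ^ t * (u k - M)) \<le> real_of_int q"
          using exp_le_absI[of "real_of_int q"] qp by simp
      qed
    qed
  next
    fix \<epsilon> :: real assume "\<epsilon> > 0"
    thus "\<forall>\<^sub>F k in sequentially. u (Suc k) / u k < L + \<epsilon>" "\<exists>\<^sub>F k in sequentially. u (Suc k) / u k > L - \<epsilon>"
      using up low unfolding u_def gap_ratio_def by auto
  qed
  show ?thesis using exponent_eq by (simp add: \<alpha>_def)
qed

end

section \<open>Rationality of the irrationality exponent\<close>

theorem theorem6p9:
  fixes d :: nat and b :: int
    and f g :: "rat fls"
    and A\<^sub>0 B\<^sub>0 C\<^sub>0 A B C B\<^sub>m :: "rat poly"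
  assumes d: "d \<ge> 2"
    and nonzero: "A\<^sub>0 \<noteq> 0" "B\<^sub>0 \<noteq> 0" "C\<^sub>0 \<noteq> 0"
    and not_rational: "\<not> is_rational_function f"
    and equation: "mahler_equation d f A\<^sub>0 B\<^sub>0 C\<^sub>0"
    and b: "\<bar>b\<bar> \<ge> 2" "inside_disc_of_convergence f b"
    and AB_nonzero: "\<And>t. poly A\<^sub>0 (of_int b ^ (d ^ t)) * poly B\<^sub>0 (of_int b ^ (d ^ t)) \<noteq> 0"
    and irrational: "value_at f b \<notin> \<rat>"
    and normalisation: "normalises_to d (f, A\<^sub>0, B\<^sub>0, C\<^sub>0) (g, A, B, C)"
    and B\<^sub>m: "is_noncyclotomic_part B B\<^sub>m"
    and i: "degree B\<^sub>m > 0 \<Longrightarrow>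
      (\<forall>t. coprime B\<^sub>m (poly_compose_power A (d ^ t))) \<and>
      int (degree C) > int d * laurent_degree g + int (degree A) \<and>
      (\<forall>B'. irreducible B' \<and> B' dvd B\<^sub>m \<longrightarrow>
        (\<exists>z\<^sub>0. poly_cx B' z\<^sub>0 = 0 \<and> norm z\<^sub>0 > 1 \<and>
          (\<exists>u. (\<forall>t\<ge>u. poly_cx B (z\<^sub>0 ^ (d ^ (t + 1))) * poly_cx C (z\<^sub>0 ^ (d ^ t)) \<noteq> 0) \<and>
            (\<Sum>k. \<Prod>t=u..<k.
               (poly_cx C (z\<^sub>0 ^ (d ^ (t + 1))) * poly_cx A (z\<^sub>0 ^ (d ^ t))) /
               (poly_cx C (z\<^sub>0 ^ (d ^ t)) * poly_cx B (z\<^sub>0 ^ (d ^ (t + 1))))) \<noteq> 0)))"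
    and ii: "(\<exists>P. is_cyclotomic P \<and> P dvd B) \<Longrightarrow>
      (\<forall>G. is_primitive_gap_sequence d (g, A, B, C) G \<longrightarrow>
        (\<forall>\<^sub>F n in sequentially. \<forall>P. is_cyclotomic P \<and> P dvd B \<longrightarrow>
           coprime (next_num d (g, A, B, C) (fst (G n))) P))"
  shows "\<exists>r :: rat. irrationality_exponent (value_at g b) = ereal (of_rat r) \<and>
                    irrationality_exponent (value_at f b) = ereal (of_rat r)"
proof -
  have b': "norm (of_int b :: complex) = \<bar>of_int b\<bar>" by simp
  have convf: "fls_converges f (of_int b)"
    using b(2) unfolding inside_disc_of_convergence_def fls_converges_def b'
    by (simp add: inverse_eq_divide)
  have "admissible d b (f, A\<^sub>0, B\<^sub>0, C\<^sub>0)"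
    unfolding admissible_def using nonzero equation not_rational convf AB_nonzero by simp
  from normalises_to_admissible[OF normalisation this b(1) d]
  obtain W where adm: "admissible d b (g, A, B, C)" and W: "poly W (of_int b) \<noteq> 0"
    and g: "g = poly_to_fls W * f" by auto
  have AB: "A \<noteq> 0" "B \<noteq> 0" "mahler_equation d g A B C" "\<not> is_rational_function g"
    "fls_converges g (of_int b)" "\<And>t. poly A (of_int b ^ d ^ t) * poly B (of_int b ^ d ^ t) \<noteq> 0"
    using adm unfolding admissible_def by simp_all
  interpret mahler_series g d A B C
    by unfold_locales (use AB d in simp_all)
  have A_0: "\<not> monom 1 1 dvd A"
    using normalisation unfolding normalises_to_def is_normalised_def by simp
  have cop: "coprime B\<^sub>m (poly_compose_power A (d ^ t))" if "degree B\<^sub>m > 0" for t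
    using i[OF that] by blast
  have out: "\<exists>z. poly_cx P z = 0 \<and> norm z > 1" if "degree B\<^sub>m > 0" "irreducible P" "P dvd B\<^sub>m" for P
    using i[OF that(1)] that(2,3) by blast
  have cyc: "\<forall>\<^sub>F n in sequentially. \<forall>P. is_cyclotomic P \<and> P dvd B \<longrightarrow>
      coprime (next_num d (g, A, B, C) (fst (H n))) P"
    if "\<exists>P. is_cyclotomic P \<and> P dvd B" "is_primitive_gap_sequence d (g, A, B, C) H" for H
    using ii[OF that(1)] that(2) by (elim allE impE)
  have stab: "\<exists>N c. \<forall>n\<ge>N. degree (G n) = c" if "primitive_sequence k G" for k G
    by (rule degree_eventually_const[OF fls_converges_imp_conv_radius_pos[OF AB(5)] A_0 B\<^sub>m cop out cyc that])
  have "\<exists>L :: rat. (\<forall>\<epsilon>>0. \<forall>\<^sub>F k in sequentially. gap_ratio k < of_rat L + \<epsilon>) \<and>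
      (\<forall>\<epsilon>>0. \<exists>\<^sub>F k in sequentially. gap_ratio k > of_rat L - \<epsilon>)"
    by (rule limsup_gap_ratio) (rule stab)
  then obtain L :: rat where
    up: "\<forall>\<epsilon>>0. \<forall>\<^sub>F k in sequentially. gap_ratio k < of_rat L + \<epsilon>" and
    low: "\<forall>\<epsilon>>0. \<exists>\<^sub>F k in sequentially. gap_ratio k > of_rat L - \<epsilon>" by blast
  have "irrationality_exponent (value_at g b) = ereal (1 + of_rat L)"
    by (rule irrationality_exponent_limsup[OF b(1) AB(5,6)]) (use up low in simp_all)
  hence exp_g: "irrationality_exponent (value_at g b) = ereal (of_rat (1 + L))"
    by (simp add: of_rat_add)
  \<comment> \<open>The polynomial relating \<open>g\<close> to \<open>f\<close> takes a nonzero
    rational value at \<open>b\<close>, and scaling by such a number leaves the exponent unchanged.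
    The comparison passes through the complex numbers because evaluation is complex.\<close>
  have "of_real (value_at g b) = (of_real (of_rat (poly W (of_int b)) * value_at f b) :: complex)"
  proof -
    have b0: "(of_int b :: complex) \<noteq> 0" using b(1) by auto
    have "(of_real (value_at g b) :: complex) = fls_value (poly_to_fls W * f) (of_int b)"
      using fls_value_real[OF AB(5)] g by simp
    also have "\<dots> = poly_cx W (of_rat (of_int b)) * of_real (value_at f b)"
      using fls_value_mult[of "poly_to_fls W" "of_int b" f] convf b0 fls_value_real[OF convf] by simp
    also have "poly_cx W (of_rat (of_int b)) = of_rat (poly W (of_int b))" by (rule poly_of_rat_of_rat)
    also have "\<dots> = of_real (of_rat (poly W (of_int b)))"
      by (cases "poly W (of_int b)") (simp add: of_rat_rat)
    finally show ?thesis by simp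
  qed
  hence "value_at g b = of_rat (poly W (of_int b)) * value_at f b" by (simp only: of_real_eq_iff)
  hence "irrationality_exponent (value_at g b) = irrationality_exponent (value_at f b)"
    using irrationality_exponent_scale[OF W] by simp
  with exp_g show ?thesis by (intro exI[of _ "1 + L"] conjI) simp_all
qed

end
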